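(* Let $(A,\mathfrak{m})$ be a Noetherian local ring with infinite residue field, and let $\mathfrak{F}=(I_n)_{n\ge0}$ be a good filtration of $A$ such that $I_1$ contains a regular element (a nonzerodivisor of $A$), $\dim F(\mathfrak{F})=1$, and $r=r(\mathfrak{F})$ is the reduction number of $\mathfrak{F}$. Then the following conditions are equivalent: (1) $F(\mathfrak{F})$ is Cohen-Macaulay; (2) $(0:_{F(\mathfrak{F})}a^{o})=0$ for any minimal reduction $J=(a)\subseteq I_1$ of $\mathfrak{F}$; (3) for any minimal reduction $(a)$ of $\mathfrak{F}$, $I_n\cap(\mathfrak{m}I_{n+1}:a)=\mathfrak{m}I_n$ for $1\le n\le r-1$; (4) for any minimal reduction $(a)$ of $\mathfrak{F}$, $aI_n\cap\mathfrak{m}I_{n+1}=a\mathfrak{m}I_n$ for $1\le n\le r-1$; (5) for any minimal reduction $(a)$ of $\mathfrak{F}$, $\lambda(I_n/(\mathfrak{m}I_n+aI_{n-1}))=\mu(I_n)-\mu(I_{n-1})$ for $1\le n\le r$.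
   Context: A filtration of $A$ is a sequence $\mathfrak{F}=(I_n)_{n\ge0}$ of ideals with $I_0=A\supset I_1\supseteq I_2\supseteq\cdots$, $I_1\ne A$ and $I_iI_j\subseteq I_{i+j}$ for all $i,j\ge0$. It is good if $I_{n+1}=I_1I_n$ for all $n\gg0$. $F(\mathfrak{F})=\bigoplus_{n\ge0}I_n/\mathfrak{m}I_n$ is the fiber cone; for $a\in I_1$, $a^{o}$ is its image in $F(\mathfrak{F})_1=I_1/\mathfrak{m}I_1$. A reduction of $\mathfrak{F}$ is an ideal $J\subseteq I_1$ with $JI_n=I_{n+1}$ for $n\gg0$; a minimal reduction is one minimal under inclusion. (Minimal reductions are generated by $\dim F(\mathfrak{F})$ elements since the residue field is infinite.) Set $r_J(\mathfrak{F})=\sup\{n\in\mathbb{Z}: I_n\neq JI_{n-1}\}$ (with $I_m=A$ for $m\le 0$) and $r(\mathfrak{F})=\min\{r_J(\mathfrak{F}) : J \text{ a minimal reduction of }\mathfrak{F}\}$. $\lambda$ denotes length and $\mu(I_n)=\lambda(I_n/\mathfrak{m}I_n)$ the minimal number of generators. *)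

theory Defs
  imports
    "HOL-Algebra.QuotRing"
    "HOL-Algebra.Ideal_Product"
    "HOL-Algebra.Module"
    "HOL-Algebra.Ring_Divisibility"
    "HOL-Library.Extended_Real"
begin

definition local_ring :: "('a, 'b) ring_scheme \<Rightarrow> 'a set \<Rightarrow> bool" where
  "local_ring R m \<longleftrightarrow> cring R \<and> maximalideal m R \<and> (\<forall>M. maximalideal M R \<longrightarrow> M = m)"

definition nonzerodivisor :: "('a, 'b) ring_scheme \<Rightarrow> 'a \<Rightarrow> bool" where
  "nonzerodivisor R x \<longleftrightarrow>
     x \<in> carrier R \<and> (\<forall>y\<in>carrier R. x \<otimes>\<^bsub>R\<^esub> y = \<zero>\<^bsub>R\<^esub> \<longrightarrow> y = \<zero>\<^bsub>R\<^esub>)"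

definition colon :: "('a, 'b) ring_scheme \<Rightarrow> 'a set \<Rightarrow> 'a \<Rightarrow> 'a set" where
  "colon R K a = {x \<in> carrier R. x \<otimes>\<^bsub>R\<^esub> a \<in> K}"

text \<open>The zero ring, which has no prime ideals, gets the value 0.\<close>

definition krull_dim :: "('a, 'b) ring_scheme \<Rightarrow> enat" where
  "krull_dim R = Sup {enat n | n. \<exists>P :: nat \<Rightarrow> 'a set.
     (\<forall>i\<le>n. primeideal (P i) R) \<and> (\<forall>i<n. P i \<subset> P (Suc i))}"

definition regular_sequence :: "('a, 'b) ring_scheme \<Rightarrow> 'a list \<Rightarrow> bool" where
  "regular_sequence R xs \<longleftrightarrow> set xs \<subseteq> carrier R \<and>
     (\<forall>i<length xs. nonzerodivisor (R Quot (Idl\<^bsub>R\<^esub> (set (take i xs))))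
                                   ((Idl\<^bsub>R\<^esub> (set (take i xs))) +>\<^bsub>R\<^esub> (xs ! i))) \<and>
     Idl\<^bsub>R\<^esub> (set xs) \<noteq> carrier R"

definition depth :: "('a, 'b) ring_scheme \<Rightarrow> 'a set \<Rightarrow> enat" where
  "depth R m = Sup {enat (length xs) | xs. set xs \<subseteq> m \<and> regular_sequence R xs}"

text \<open>
  Localization of a commutative ring at a multiplicative set \<open>S\<close>: \<open>fraction R S a s\<close> is the
  class of $a/s$, with $a/s = b/t$ iff $u(at - bs) = 0$ for some $u \in S$.  The operations
  on classes are unions over representatives; these unions are over a single class because
  the operations are well defined.
\<close>

definition fraction :: "('a, 'b) ring_scheme \<Rightarrow> 'a set \<Rightarrow> 'a \<Rightarrow> 'a \<Rightarrow> ('a \<times> 'a) set" where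
  "fraction R S a s = {(b, t). b \<in> carrier R \<and> t \<in> S \<and>
     (\<exists>u\<in>S. u \<otimes>\<^bsub>R\<^esub> ((a \<otimes>\<^bsub>R\<^esub> t) \<ominus>\<^bsub>R\<^esub> (b \<otimes>\<^bsub>R\<^esub> s)) = \<zero>\<^bsub>R\<^esub>)}"

definition localization :: "('a, 'b) ring_scheme \<Rightarrow> 'a set \<Rightarrow> ('a \<times> 'a) set ring" where
  "localization R S =
     \<lparr> carrier = {fraction R S a s | a s. a \<in> carrier R \<and> s \<in> S},
       monoid.mult = (\<lambda>X Y. \<Union>(a, s)\<in>X. \<Union>(b, t)\<in>Y. fraction R S (a \<otimes>\<^bsub>R\<^esub> b) (s \<otimes>\<^bsub>R\<^esub> t)),
       one = fraction R S \<one>\<^bsub>R\<^esub> \<one>\<^bsub>R\<^esub>,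
       zero = fraction R S \<zero>\<^bsub>R\<^esub> \<one>\<^bsub>R\<^esub>,
       add = (\<lambda>X Y. \<Union>(a, s)\<in>X. \<Union>(b, t)\<in>Y.
                fraction R S ((a \<otimes>\<^bsub>R\<^esub> t) \<oplus>\<^bsub>R\<^esub> (b \<otimes>\<^bsub>R\<^esub> s)) (s \<otimes>\<^bsub>R\<^esub> t)) \<rparr>"

definition cohen_macaulay_local :: "('a, 'b) ring_scheme \<Rightarrow> bool" where
  "cohen_macaulay_local R \<longleftrightarrow>
     noetherian_ring R \<and> (\<exists>m. local_ring R m \<and> depth R m = krull_dim R)"

definition cohen_macaulay :: "('a, 'b) ring_scheme \<Rightarrow> bool" where
  "cohen_macaulay R \<longleftrightarrow> cring R \<and> noetherian_ring R \<and>
     (\<forall>M. maximalideal M R \<longrightarrow> cohen_macaulay_local (localization R (carrier R - M)))"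

text \<open>
  The \<open>R\<close>-module $I/J$ for ideals $J \subseteq I$.  The fields \<open>mult\<close> and \<open>one\<close> play no role;
  they are present only because the record of modules extends that of rings.
\<close>

definition ideal_quotient ::
    "('a, 'b) ring_scheme \<Rightarrow> 'a set \<Rightarrow> 'a set \<Rightarrow> ('a, 'a set) module" where
  "ideal_quotient R I J =
     \<lparr> carrier = {J +>\<^bsub>R\<^esub> x | x. x \<in> I},
       monoid.mult = rcoset_mult R J,
       one = J +>\<^bsub>R\<^esub> \<one>\<^bsub>R\<^esub>,
       zero = J,
       add = set_add R,
       smult = (\<lambda>a X. \<Union>x\<in>X. J +>\<^bsub>R\<^esub> (a \<otimes>\<^bsub>R\<^esub> x)) \<rparr>"

definition module_length ::
    "('a, 'b) ring_scheme \<Rightarrow> ('a, 'c, 'd) module_scheme \<Rightarrow> enat" where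
  "module_length R M = Sup {enat n | n. \<exists>N :: nat \<Rightarrow> 'c set.
     (\<forall>i\<le>n. submodule (N i) R M) \<and> (\<forall>i<n. N i \<subset> N (Suc i))}"

definition filtration :: "('a, 'b) ring_scheme \<Rightarrow> (nat \<Rightarrow> 'a set) \<Rightarrow> bool" where
  "filtration A I \<longleftrightarrow>
     (\<forall>n. ideal (I n) A) \<and> I 0 = carrier A \<and> I 1 \<noteq> carrier A \<and>
     (\<forall>n. I (Suc n) \<subseteq> I n) \<and> (\<forall>i j. I i \<cdot>\<^bsub>A\<^esub> I j \<subseteq> I (i + j))"

definition good_filtration :: "('a, 'b) ring_scheme \<Rightarrow> (nat \<Rightarrow> 'a set) \<Rightarrow> bool" where
  "good_filtration A I \<longleftrightarrow>
     filtration A I \<and> (\<exists>N. \<forall>n\<ge>N. I (Suc n) = I 1 \<cdot>\<^bsub>A\<^esub> I n)"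

definition num_gens :: "('a, 'b) ring_scheme \<Rightarrow> 'a set \<Rightarrow> 'a set \<Rightarrow> enat" where
  "num_gens A m K = module_length A (ideal_quotient A K (m \<cdot>\<^bsub>A\<^esub> K))"

text \<open>
  The fiber cone $\bigoplus_n I_n/\mathfrak{m}I_n$.  Its elements are the finitely supported
  sequences of cosets $f_n \in I_n/\mathfrak{m}I_n$, where $\mathfrak{m}I_n$ is the zero of the
  degree \<open>n\<close> part.  In the product, \<open>rcoset_mult\<close> sends $x + \mathfrak{m}I_i$ and
  $y + \mathfrak{m}I_{n-i}$ to $xy + \mathfrak{m}I_n$.
\<close>

definition fiber_component ::
    "('a, 'b) ring_scheme \<Rightarrow> 'a set \<Rightarrow> (nat \<Rightarrow> 'a set) \<Rightarrow> nat \<Rightarrow> ('a, 'a set) module" where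
  "fiber_component A m I n = ideal_quotient A (I n) (m \<cdot>\<^bsub>A\<^esub> I n)"

definition fiber_cone ::
    "('a, 'b) ring_scheme \<Rightarrow> 'a set \<Rightarrow> (nat \<Rightarrow> 'a set) \<Rightarrow> (nat \<Rightarrow> 'a set) ring" where
  "fiber_cone A m I =
     \<lparr> carrier = {f. (\<forall>n. f n \<in> carrier (fiber_component A m I n)) \<and>
                     finite {n. f n \<noteq> \<zero>\<^bsub>fiber_component A m I n\<^esub>}},
       monoid.mult = (\<lambda>f g n. \<Oplus>\<^bsub>fiber_component A m I n\<^esub>i\<in>{..n}.
                 rcoset_mult A (m \<cdot>\<^bsub>A\<^esub> I n) (f i) (g (n - i))),
       one = (\<lambda>n. if n = 0 then (m \<cdot>\<^bsub>A\<^esub> I 0) +>\<^bsub>A\<^esub> \<one>\<^bsub>A\<^esub> else \<zero>\<^bsub>fiber_component A m I n\<^esub>),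
       zero = (\<lambda>n. \<zero>\<^bsub>fiber_component A m I n\<^esub>),
       add = (\<lambda>f g n. f n \<oplus>\<^bsub>fiber_component A m I n\<^esub> g n) \<rparr>"

text \<open>The image $a^o$ of $a \in I_1$ in degree 1 of the fiber cone.\<close>

definition initial_form ::
    "('a, 'b) ring_scheme \<Rightarrow> 'a set \<Rightarrow> (nat \<Rightarrow> 'a set) \<Rightarrow> 'a \<Rightarrow> (nat \<Rightarrow> 'a set)" where
  "initial_form A m I a =
     (\<lambda>n. if n = 1 then (m \<cdot>\<^bsub>A\<^esub> I 1) +>\<^bsub>A\<^esub> a else \<zero>\<^bsub>fiber_component A m I n\<^esub>)"

definition reduction :: "('a, 'b) ring_scheme \<Rightarrow> (nat \<Rightarrow> 'a set) \<Rightarrow> 'a set \<Rightarrow> bool" where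
  "reduction A I J \<longleftrightarrow>
     ideal J A \<and> J \<subseteq> I 1 \<and> (\<exists>N. \<forall>n\<ge>N. J \<cdot>\<^bsub>A\<^esub> I n = I (Suc n))"

definition minimal_reduction :: "('a, 'b) ring_scheme \<Rightarrow> (nat \<Rightarrow> 'a set) \<Rightarrow> 'a set \<Rightarrow> bool" where
  "minimal_reduction A I J \<longleftrightarrow>
     reduction A I J \<and> (\<forall>K. reduction A I K \<and> K \<subseteq> J \<longrightarrow> K = J)"

text \<open>
  The indices range over all integers, with $I_n = A$ for $n \le 0$.  Every $n \le 0$ belongs
  to the set, which is bounded above when \<open>J\<close> is a reduction, so the supremum is an integer
  $\ge 0$.
\<close>

definition reduction_number_wrt ::
    "('a, 'b) ring_scheme \<Rightarrow> (nat \<Rightarrow> 'a set) \<Rightarrow> 'a set \<Rightarrow> int" where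
  "reduction_number_wrt A I J =
     (let I' = (\<lambda>n :: int. if n \<le> 0 then carrier A else I (nat n))
      in Sup {n :: int. I' n \<noteq> J \<cdot>\<^bsub>A\<^esub> I' (n - 1)})"

text \<open>
  The infimum is a minimum, being taken over a set of integers that is bounded below by 0
  and nonempty as soon as minimal reductions exist.
\<close>

definition reduction_number :: "('a, 'b) ring_scheme \<Rightarrow> (nat \<Rightarrow> 'a set) \<Rightarrow> int" where
  "reduction_number A I = Inf {reduction_number_wrt A I J | J. minimal_reduction A I J}"

end

(* Minimal reductions (a) are principal because F has dimension one, and a is a nonzerodivisor of
   A because I_1 contains one.  Conditions (2) to (5) say that multiplication by a, from
   I_n / m I_n to I_{n+1} / m I_{n+1}, is injective in certain degrees n.  It is automatically
   injective for n = 0, and for n >= r_(a), where I_{n+1} = a I_n; choosing a with r_(a) = r, the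
   range 1 <= n <= r - 1 therefore suffices.  Injectivity passes from a to any other minimal
   reduction (b), since a^q lies in b I_{q-1} for large q.  For (5) one counts lengths along
   multiplication by a.

   If a^o is a nonzerodivisor of F, it provides depth one at the irrelevant maximal ideal, and any
   other maximal ideal contains an element with a unit in degree zero, which is a nonzerodivisor.
   Conversely, if F is Cohen-Macaulay, the localization at the irrelevant ideal has a nonzerodivisor
   f/s in its maximal ideal, and some power of f is a multiple of a^o.

   The existence of principal reductions avoids dimension theory of graded rings.  Dimension at most
   one gives relations x^k (y^l (1 + y b) + x c) = 0 in F, whose homogeneous components bound
   the Hilbert function; then products of linear forms in two generators x, y of a reduction become
   dependent, and a generic combination of x and y can replace both of them. *)

theory Submission
  imports Defs "HOL-Algebra.UnivPoly"
begin

text \<open>Conditions (2) to (5) quantify over minimal reductions and would hold vacuously without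
  one, while (1) would not; hence the effort spent on the existence of a principal reduction. The
  dependence of forms that it needs is linear algebra over the residue field, carried out with
  strict chains of ideals of \<open>A\<close> between \<open>m \<cdot> I n\<close> and
  \<open>I n\<close>; the same chains compute the lengths in (5). There the two sides differ by the
  length of the kernel of multiplication by \<open>a\<close> in degree \<open>n - 1\<close>, so (5)
  runs up to \<open>r\<close> where (3) and (4) stop at \<open>r - 1\<close>, and its case
  \<open>n = 1\<close> is automatic.

  From (1) to (2), the dimension of \<open>F\<close> does not by itself bound the dimension at the
  irrelevant ideal from below; it is at least one there because \<open>a^o\<close> is not nilpotent,
  by Nakayama. The nonzerodivisor obtained need not be homogeneous, which is why a power of it is
  compared with \<open>a^o\<close> component by component. Nothing is lost in this localization,
  since elements outside the irrelevant ideal are nonzerodivisors of \<open>F\<close>.\<close>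

no_notation Sum_Type.Plus (infixr \<open><+>\<close> 65)

subsection \<open>Prime ideals avoiding a multiplicative set\<close>

text \<open>\<open>S\<close> is an arbitrary set: for multiplicative \<open>S\<close> the maximal
  element turns out prime, for \<open>S = {\<one>}\<close> it is a maximal ideal, so one use of
  Zorn's lemma serves both.\<close>

lemma (in cring) exists_ideal_maximal_disjoint:
  assumes "ideal J R" "J \<inter> S = {}"
  obtains P where "ideal P R" "J \<subseteq> P" "P \<inter> S = {}"
    "\<And>Q. ideal Q R \<Longrightarrow> P \<subseteq> Q \<Longrightarrow> Q \<inter> S = {} \<Longrightarrow> Q = P"
proof -
  let ?A = "{Q. ideal Q R \<and> J \<subseteq> Q \<and> Q \<inter> S = {}}"
  have "\<exists>M\<in>?A. \<forall>X\<in>?A. M \<subseteq> X \<longrightarrow> X = M"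
  proof (rule subset_Zorn_nonempty)
    show "?A \<noteq> {}" using assms by blast
  next
    fix C assume C: "C \<noteq> {}" "subset.chain ?A C"
    then have "subset.chain {Q. ideal Q R} C"
      unfolding pred_on.chain_def by blast
    then have "ideal (\<Union>C) R" using chain_Union_is_ideal[of C] C(1) by simp
    moreover have "J \<subseteq> \<Union>C" "\<Union>C \<inter> S = {}"
      using C unfolding pred_on.chain_def by blast+
    ultimately show "\<Union>C \<in> ?A" by simp
  qed
  then obtain M where M: "M \<in> ?A" "\<forall>X\<in>?A. M \<subseteq> X \<longrightarrow> X = M" by (rule bexE)
  show thesis
  proof (rule that[of M])
    show "ideal M R" "J \<subseteq> M" "M \<inter> S = {}" using M(1) by simp_all
    show "Q = M" if "ideal Q R" "M \<subseteq> Q" "Q \<inter> S = {}" for Q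
      using bspec[OF M(2), of Q] M(1) that by auto
  qed
qed

lemma (in cring) mem_add_PIdl:
  assumes "ideal P R" "a \<in> carrier R"
  shows "x \<in> P <+> PIdl a \<longleftrightarrow> (\<exists>p\<in>P. \<exists>r\<in>carrier R. x = p \<oplus> r \<otimes> a)"
  unfolding set_add_def' cgenideal_def by blast

lemma (in cring) ideal_add_PIdl:
  assumes "ideal P R" "a \<in> carrier R"
  shows "ideal (P <+> PIdl a) R" "P \<subseteq> P <+> PIdl a" "a \<in> P <+> PIdl a"
proof -
  interpret P: ideal P R by fact
  show "ideal (P <+> PIdl a) R" using assms by (simp add: add_ideals cgenideal_ideal)
  show "P \<subseteq> P <+> PIdl a"
  proof
    fix x assume "x \<in> P"
    moreover from this have "x = x \<oplus> \<zero> \<otimes> a" using assms(2) by (simp add: P.Icarr)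
    ultimately show "x \<in> P <+> PIdl a" using assms(2) mem_add_PIdl[OF assms] by blast
  qed
  have "a = \<zero> \<oplus> \<one> \<otimes> a" using assms(2) by simp
  then show "a \<in> P <+> PIdl a" using mem_add_PIdl[OF assms, of a] P.zero_closed by blast
qed

lemma (in ring) add_ideals_upper:
  fixes J K :: "'a set"
  assumes "ideal J R" "ideal K R"
  shows "J \<subseteq> J <+> K" "K \<subseteq> J <+> K"
proof -
  have "J \<union> K \<subseteq> carrier R" using ideal.Icarr[OF assms(1)] ideal.Icarr[OF assms(2)] by blast
  from genideal_self[OF this] show "J \<subseteq> J <+> K" "K \<subseteq> J <+> K"
    unfolding union_genideal[OF assms] by simp_all
qed

text \<open>Maximality makes \<open>P <+> PIdl a\<close> and \<open>P <+> PIdl b\<close> meet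
  \<open>S\<close> when \<open>a\<close> and \<open>b\<close> lie outside \<open>P\<close>; the
  product of the two witnesses lies in \<open>S\<close>, and also in \<open>P\<close> once
  \<open>a \<otimes> b\<close> does.\<close>

lemma (in cring) exists_prime_disjoint:
  assumes J: "ideal J R" "J \<inter> S = {}"
    and S: "\<one> \<in> S" "\<And>s t. s \<in> S \<Longrightarrow> t \<in> S \<Longrightarrow> s \<otimes> t \<in> S"
  obtains P where "primeideal P R" "J \<subseteq> P" "P \<inter> S = {}"
proof -
  obtain P where P: "ideal P R" "J \<subseteq> P" "P \<inter> S = {}"
    and max: "\<And>Q. ideal Q R \<Longrightarrow> P \<subseteq> Q \<Longrightarrow> Q \<inter> S = {} \<Longrightarrow> Q = P"
    using exists_ideal_maximal_disjoint[OF J] by metis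
  interpret P: ideal P R by fact
  have meets: "\<exists>p\<in>P. \<exists>r\<in>carrier R. p \<oplus> r \<otimes> a \<in> S" if a: "a \<in> carrier R" "a \<notin> P" for a
  proof -
    have "P <+> PIdl a \<noteq> P" using ideal_add_PIdl(3)[OF P(1) a(1)] a(2) by blast
    then have "(P <+> PIdl a) \<inter> S \<noteq> {}"
      using max ideal_add_PIdl[OF P(1) a(1)] by blast
    then show ?thesis by (auto simp: mem_add_PIdl[OF P(1) a(1)])
  qed
  have "primeideal P R"
  proof (rule primeidealI)
    show "carrier R \<noteq> P" using P(3) S(1) by blast
  next
    fix a b assume ab: "a \<in> carrier R" "b \<in> carrier R" "a \<otimes> b \<in> P"
    show "a \<in> P \<or> b \<in> P"
    proof (rule ccontr)
      assume "\<not> (a \<in> P \<or> b \<in> P)"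
      then obtain p r q s where pq: "p \<in> P" "q \<in> P" "r \<in> carrier R" "s \<in> carrier R"
        "p \<oplus> r \<otimes> a \<in> S" "q \<oplus> s \<otimes> b \<in> S"
        using meets ab by metis
      have pc: "p \<in> carrier R" "q \<in> carrier R" using pq P.Icarr by auto
      have "(p \<oplus> r \<otimes> a) \<otimes> (q \<oplus> s \<otimes> b)
          = p \<otimes> (q \<oplus> s \<otimes> b) \<oplus> (r \<otimes> a) \<otimes> q \<oplus> (r \<otimes> s) \<otimes> (a \<otimes> b)"
        using pc pq ab by algebra
      moreover have "\<dots> \<in> P"
        using P.I_r_closed[OF pq(1), of "q \<oplus> s \<otimes> b"] P.I_l_closed[OF pq(2), of "r \<otimes> a"]
          P.I_l_closed[OF ab(3), of "r \<otimes> s"] pc pq ab by auto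
      ultimately show False using S(2)[OF pq(5,6)] P(3) by auto
    qed
  qed (use P is_cring in auto)
  with P that show thesis by blast
qed

lemma (in cring) exists_maximalideal:
  assumes "ideal J R" "J \<noteq> carrier R"
  obtains M where "maximalideal M R" "J \<subseteq> M"
proof -
  have "J \<inter> {\<one>} = {}" using assms ideal.one_imp_carrier by blast
  then obtain P where P: "ideal P R" "J \<subseteq> P" "P \<inter> {\<one>} = {}"
    and max: "\<And>Q. ideal Q R \<Longrightarrow> P \<subseteq> Q \<Longrightarrow> Q \<inter> {\<one>} = {} \<Longrightarrow> Q = P"
    using exists_ideal_maximal_disjoint[OF assms(1)] by metis
  have "maximalideal P R"
  proof (rule maximalidealI)
    show "carrier R \<noteq> P" using P(3) by blast
    show "Q = P \<or> Q = carrier R" if "ideal Q R" "P \<subseteq> Q" "Q \<subseteq> carrier R" for Q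
      using max[OF that(1,2)] ideal.one_imp_carrier[OF that(1)] by blast
  qed fact
  with P that show thesis by blast
qed

lemma (in cring) exists_prime_not_containing:
  assumes J: "ideal J R" and x: "x \<in> carrier R" and pow: "\<And>n::nat. x [^] n \<notin> J"
  obtains P where "primeideal P R" "J \<subseteq> P" "x \<notin> P"
proof -
  let ?S = "range (\<lambda>n::nat. x [^] n)"
  have "s \<otimes> t \<in> ?S" if "s \<in> ?S" "t \<in> ?S" for s t
    using that x by (auto simp: nat_pow_mult)
  moreover have "\<one> \<in> ?S" using x by (metis nat_pow_0 rangeI)
  moreover have "J \<inter> ?S = {}" using pow by blast
  ultimately obtain P where P: "primeideal P R" "J \<subseteq> P" "P \<inter> ?S = {}"
    using exists_prime_disjoint[OF J] by metis
  have "x \<in> ?S" using x by (metis nat_pow_eone rangeI)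
  with P that show thesis by blast
qed

lemma (in cring) local_ring_nonunit:
  assumes "local_ring R m" "x \<in> carrier R" "x \<notin> m"
  shows "x \<in> Units R"
proof -
  have "PIdl x = carrier R"
  proof (rule ccontr)
    assume "PIdl x \<noteq> carrier R"
    then obtain M where "maximalideal M R" "PIdl x \<subseteq> M"
      using exists_maximalideal[OF cgenideal_ideal[OF assms(2)]] by blast
    then show False using assms cgenideal_self unfolding local_ring_def by blast
  qed
  then have "\<one> \<in> PIdl x" by simp
  then obtain y where "y \<in> carrier R" "\<one> = y \<otimes> x" unfolding cgenideal_def by blast
  then show ?thesis unfolding Units_def using assms m_comm by auto
qed

locale local_cring = maximalideal m R + cring R for m and R (structure) +
  assumes loc_R: "local_ring R m"
begin

text \<open>The form in which locality is used later: elements outside \<open>m\<close> are units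
  and cancel from memberships in ideals.\<close>

lemma unit_mult_mem:
  assumes "ideal J R" "u \<in> carrier R" "u \<notin> m" "x \<in> carrier R" "u \<otimes> x \<in> J"
  shows "x \<in> J"
proof -
  have u: "u \<in> Units R" using local_ring_nonunit[OF loc_R] assms by blast
  then have "x = inv u \<otimes> (u \<otimes> x)" using assms by (simp add: m_assoc[symmetric])
  then show ?thesis using ideal.I_l_closed[OF assms(1,5), of "inv u"] u by simp
qed

end

subsection \<open>Krull dimension and depth\<close>

lemma krull_dim_geI:
  assumes "\<And>i. i \<le> n \<Longrightarrow> primeideal (P i) R" "\<And>i. i < n \<Longrightarrow> P i \<subset> P (Suc i)"
  shows "enat n \<le> krull_dim R"
  unfolding krull_dim_def by (rule Sup_upper) (use assms in blast)

lemma krull_dim_ge_1: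
  assumes "primeideal P R" "primeideal Q R" "P \<subset> Q"
  shows "1 \<le> krull_dim R"
proof -
  have "enat 1 \<le> krull_dim R"
    by (rule krull_dim_geI[of _ "\<lambda>i. if i = 0 then P else Q"]) (use assms in auto)
  then show ?thesis by (simp add: one_enat_def)
qed

lemma krull_dim_le_1D:
  assumes "krull_dim R \<le> 1" "primeideal P0 R" "primeideal P1 R" "primeideal P2 R"
    "P0 \<subset> P1" "P1 \<subset> P2"
  shows False
proof -
  have "enat 2 \<le> krull_dim R"
    by (rule krull_dim_geI[of _ "\<lambda>i. if i = 0 then P0 else if i = 1 then P1 else P2"])
      (use assms in \<open>auto simp: less_2_cases_iff\<close>)
  then have "enat 2 \<le> 1" using assms(1) order_trans by blast
  then show False by (simp add: one_enat_def)
qed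

lemma krull_dim_le_1I:
  assumes "\<And>P0 P1 P2. primeideal P0 R \<Longrightarrow> primeideal P1 R \<Longrightarrow> primeideal P2 R \<Longrightarrow>
    P0 \<subset> P1 \<Longrightarrow> P1 \<subset> P2 \<Longrightarrow> False"
  shows "krull_dim R \<le> 1"
  unfolding krull_dim_def
proof (rule Sup_least, clarify)
  fix n and P :: "nat \<Rightarrow> 'a set"
  assume P: "\<forall>i\<le>n. primeideal (P i) R" "\<forall>i<n. P i \<subset> P (Suc i)"
  have "n \<le> 1"
  proof (rule ccontr)
    assume "\<not> n \<le> 1"
    then show False
      using assms[of "P 0" "P 1" "P 2"] P by (auto simp: numeral_2_eq_2)
  qed
  then show "enat n \<le> 1" by (simp add: one_enat_def)
qed

section \<open>Nonzerodivisors and regular sequences\<close>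

lemma (in cring) nonzerodivisorD:
  assumes "nonzerodivisor R x"
  shows "x \<in> carrier R" "\<And>y. y \<in> carrier R \<Longrightarrow> x \<otimes> y = \<zero> \<Longrightarrow> y = \<zero>"
  using assms unfolding nonzerodivisor_def by auto

lemma (in cring) nonzerodivisor_cancel:
  assumes "nonzerodivisor R a" "x \<in> carrier R" "y \<in> carrier R" "a \<otimes> x = a \<otimes> y"
  shows "x = y"
proof -
  note a = nonzerodivisorD[OF assms(1)]
  have "a \<otimes> (x \<ominus> y) = a \<otimes> x \<ominus> a \<otimes> y" using a(1) assms(2,3) by algebra
  then have "a \<otimes> (x \<ominus> y) = \<zero>" using assms a(1) by (simp add: r_right_minus_eq)
  then have "x \<ominus> y = \<zero>" using a(2)[of "x \<ominus> y"] assms by simp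
  then show ?thesis using assms by (simp add: r_right_minus_eq)
qed

lemma (in cring) nonzerodivisor_pow:
  assumes "nonzerodivisor R x"
  shows "nonzerodivisor R (x [^] (n::nat))"
proof (induct n)
  case 0 show ?case unfolding nonzerodivisor_def by simp
next
  case (Suc n)
  note x = nonzerodivisorD[OF assms]
  show ?case unfolding nonzerodivisor_def
  proof (intro conjI ballI impI)
    show "x [^] Suc n \<in> carrier R" using x by simp
    fix y assume y: "y \<in> carrier R" "x [^] Suc n \<otimes> y = \<zero>"
    then have "x [^] n \<otimes> (x \<otimes> y) = \<zero>" using x by (simp add: m_assoc)
    then have "x \<otimes> y = \<zero>" using nonzerodivisorD(2)[OF Suc] x(1) y(1) by blast
    then show "y = \<zero>" using x(2) y(1) by blast
  qed
qed

lemma (in cring) genideal_empty: "Idl {} = {\<zero>}"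
proof
  show "Idl {} \<subseteq> {\<zero>}" using zeroideal by (rule genideal_minimal) simp
  have "additive_subgroup (Idl {}) R" using genideal_ideal[of "{}"] by (simp add: ideal_def)
  then show "{\<zero>} \<subseteq> Idl {}" by (simp add: additive_subgroup.zero_closed)
qed

lemma (in ideal) rcos_eq_iff:
  assumes "x \<in> carrier R" "y \<in> carrier R"
  shows "I +> x = I +> y \<longleftrightarrow> x \<ominus> y \<in> I"
  using quotient_eq_iff_same_a_r_cos[OF is_ideal assms] by blast

lemma (in ideal) rcos_eq_self_iff:
  assumes "x \<in> carrier R"
  shows "I +> x = I \<longleftrightarrow> x \<in> I"
  using assms a_rcos_const a_rcos_self by blast

lemma (in ideal) nonzerodivisor_quot_iff:
  assumes "cring R" "x \<in> carrier R"
  shows "nonzerodivisor (R Quot I) (I +> x) \<longleftrightarrow>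
    (\<forall>y\<in>carrier R. x \<otimes> y \<in> I \<longrightarrow> y \<in> I)"
proof -
  have "carrier (R Quot I) = {I +> y | y. y \<in> carrier R}"
    unfolding FactRing_def A_RCOSETS_def' by auto
  moreover have "monoid.mult (R Quot I) = rcoset_mult R I" "zero (R Quot I) = I"
    unfolding FactRing_def by simp_all
  ultimately have "nonzerodivisor (R Quot I) (I +> x) \<longleftrightarrow>
    (\<forall>y\<in>carrier R. rcoset_mult R I (I +> x) (I +> y) = I \<longrightarrow> I +> y = I)"
    unfolding nonzerodivisor_def using assms(2) by auto
  then show ?thesis using assms(2) by (simp add: rcoset_mult_add rcos_eq_self_iff)
qed

text \<open>The nonzerodivisor \<open>x\<close> gives depth at least one, and dimension one because
  a prime avoiding its powers lies strictly below \<open>m\<close>. A regular sequence starting with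
  \<open>u\<close>, \<open>v\<close> would give primes \<open>P' \<subset> P \<subset> m\<close>:
  \<open>P\<close> contains \<open>u\<close> and avoids the powers of \<open>v\<close>, and
  \<open>P'\<close> lies inside \<open>P\<close> and misses \<open>u\<close>.\<close>

lemma (in cring) depth_eq_krull_dim:
  assumes loc: "local_ring R m" and dim: "krull_dim R \<le> 1"
    and x: "x \<in> m" "nonzerodivisor R x"
  shows "depth R m = krull_dim R"
proof -
  have mmax: "maximalideal m R" and uniq: "\<And>M. maximalideal M R \<Longrightarrow> M = m"
    using loc unfolding local_ring_def by auto
  have mprime: "primeideal m R" using mmax by (rule maximalideal_prime)
  interpret m: maximalideal m R by fact
  have sub: "P \<subseteq> m" if P: "primeideal P R" for P
  proof -
    have "P \<noteq> carrier R" using primeideal.I_notcarr[OF P] by blast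
    then show ?thesis
      using exists_maximalideal[of P] primeideal.axioms(1)[OF P] uniq by metis
  qed
  have one: "\<one> \<noteq> \<zero>" using m.I_notcarr m.zero_closed m.one_imp_carrier by auto
  note xnz = nonzerodivisorD[OF x(2)]
  have "x [^] (n::nat) \<notin> {\<zero>}" for n
    using nonzerodivisorD[OF nonzerodivisor_pow[OF x(2), of n]] one by force
  then obtain Q where Q: "primeideal Q R" "x \<notin> Q"
    using exists_prime_not_containing[OF zeroideal xnz(1)] by blast
  have "Q \<subset> m" using sub Q x by blast
  then have kd: "krull_dim R = 1"
    using krull_dim_ge_1[OF Q(1) mprime] dim by simp
  have regx: "regular_sequence R [x]"
    unfolding regular_sequence_def
  proof (intro conjI allI impI)
    show "set [x] \<subseteq> carrier R" using xnz by simp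
    show "Idl (set [x]) \<noteq> carrier R"
      using genideal_minimal[OF m.is_ideal, of "{x}"] x m.I_notcarr m.a_subset by auto
    fix i assume "i < length [x]"
    then have "i = 0" by simp
    then show "nonzerodivisor (R Quot Idl (set (take i [x]))) ((Idl (set (take i [x]))) +> [x] ! i)"
      using ideal.nonzerodivisor_quot_iff[OF zeroideal is_cring xnz(1)] xnz
      by (simp add: genideal_empty)
  qed
  have depth_ge: "1 \<le> depth R m"
    unfolding depth_def by (rule Sup_upper) (use regx x in \<open>force simp: one_enat_def\<close>)
  have len: "length xs \<le> 1" if xs: "set xs \<subseteq> m" "regular_sequence R xs" for xs
  proof (rule ccontr)
    assume "\<not> length xs \<le> 1"
    then obtain u v ws where uv: "xs = u # v # ws"
      by (cases xs; cases "tl xs") auto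
    have uvm: "u \<in> m" "v \<in> m" using xs uv by auto
    have uvc: "u \<in> carrier R" "v \<in> carrier R" using uvm m.Icarr by auto
    have reg: "\<And>i. i < length xs \<Longrightarrow>
      nonzerodivisor (R Quot (Idl (set (take i xs)))) ((Idl (set (take i xs))) +> (xs ! i))"
      using xs(2) unfolding regular_sequence_def by blast
    have "nonzerodivisor (R Quot {\<zero>}) ({\<zero>} +> u)"
      using reg[of 0] uv by (simp add: genideal_empty)
    then have u: "\<And>y. y \<in> carrier R \<Longrightarrow> u \<otimes> y = \<zero> \<Longrightarrow> y = \<zero>"
      using ideal.nonzerodivisor_quot_iff[OF zeroideal is_cring uvc(1)] by simp
    interpret U: ideal "PIdl u" R using uvc by (simp add: cgenideal_ideal)
    have "nonzerodivisor (R Quot (PIdl u)) (PIdl u +> v)"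
      using reg[of 1] uv uvc by (simp add: cgenideal_eq_genideal)
    then have v: "\<And>y. y \<in> carrier R \<Longrightarrow> v \<otimes> y \<in> PIdl u \<Longrightarrow> y \<in> PIdl u"
      using U.nonzerodivisor_quot_iff[OF is_cring uvc(2)] by simp
    have vpow: "y \<in> PIdl u" if "v [^] (n::nat) \<otimes> y \<in> PIdl u" "y \<in> carrier R" for n y
      using that
    proof (induct n arbitrary: y)
      case 0 then show ?case by simp
    next
      case (Suc n)
      then have "v [^] n \<otimes> (v \<otimes> y) \<in> PIdl u" using uvc by (simp add: m_assoc)
      then have "v \<otimes> y \<in> PIdl u" using Suc.hyps Suc.prems(2) uvc by blast
      then show ?case using v Suc.prems(2) by blast
    qed
    have "v [^] (n::nat) \<notin> PIdl u" for n
    proof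
      assume "v [^] n \<in> PIdl u"
      then have "\<one> \<in> PIdl u" using vpow[of n \<one>] uvc by simp
      then have "\<one> \<in> m" using cgenideal_minimal[OF m.is_ideal uvm(1)] by blast
      then show False using m.one_imp_carrier m.I_notcarr by simp
    qed
    then obtain P where P: "primeideal P R" "PIdl u \<subseteq> P" "v \<notin> P"
      using exists_prime_not_containing[OF U.is_ideal uvc(2)] by metis
    interpret P: primeideal P R by fact
    have Pm: "P \<subset> m" using sub P uvm by blast
    have uP: "u \<in> P" using P(2) cgenideal_self[OF uvc(1)] by blast
    \<comment> \<open>A prime disjoint from this set is contained in \<open>P\<close> (exponent 0)
      and misses \<open>u\<close> (\<open>s = \<one>\<close>, exponent 1). The zero ideal avoids the
      set because \<open>u\<close> is a nonzerodivisor.\<close>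
    let ?S = "{s \<otimes> u [^] (n::nat) | s n. s \<in> carrier R - P}"
    have one_P: "\<one> \<in> carrier R - P" using P.I_notcarr P.one_imp_carrier by auto
    have S1: "s \<otimes> u [^] (n::nat) \<in> ?S" if "s \<in> carrier R - P" for s n using that by blast
    have upow: "y = \<zero>" if "y \<otimes> u [^] (n::nat) = \<zero>" "y \<in> carrier R" for n y
      using that
    proof (induct n arbitrary: y)
      case 0 then show ?case by simp
    next
      case (Suc n)
      moreover have "y \<otimes> u [^] Suc n = u \<otimes> y \<otimes> u [^] n"
        using uvc Suc.prems(2) by (simp add: m_ac)
      ultimately have "u \<otimes> y \<otimes> u [^] n = \<zero>" by simp
      then have "u \<otimes> y = \<zero>" using Suc.hyps Suc.prems(2) uvc by blast
      then show ?case using u Suc.prems(2) by blast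
    qed
    have S0: "{\<zero>} \<inter> ?S = {}" using upow P.zero_closed by force
    have S_one: "\<one> \<in> ?S" using S1[OF one_P, of 0] by simp
    have S_mult: "s \<otimes> t \<in> ?S" if st_mem: "s \<in> ?S" "t \<in> ?S" for s t
    proof -
      obtain s' n t' k where st: "s = s' \<otimes> u [^] (n::nat)" "t = t' \<otimes> u [^] (k::nat)"
        "s' \<in> carrier R - P" "t' \<in> carrier R - P" using st_mem by blast
      have "s \<otimes> t = (s' \<otimes> t') \<otimes> u [^] (n + k)"
      proof -
        have "s' \<in> carrier R" "t' \<in> carrier R" using st by auto
        moreover have "u [^] n \<in> carrier R" "u [^] k \<in> carrier R" using uvc by auto
        ultimately show ?thesis
          unfolding st nat_pow_mult[OF uvc(1), symmetric] by algebra
      qed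
      moreover have "s' \<otimes> t' \<in> carrier R - P" using st P.I_prime[of s' t'] by auto
      ultimately show ?thesis using S1 by simp
    qed
    obtain P' where P': "primeideal P' R" "P' \<inter> ?S = {}"
      by (rule exists_prime_disjoint[OF zeroideal S0 S_one S_mult])
    have "P' \<subseteq> P"
    proof
      fix s assume s: "s \<in> P'"
      then have sc: "s \<in> carrier R" using P' primeideal.axioms(1) ideal.Icarr by metis
      show "s \<in> P" using S1[of s 0] s sc P' by auto
    qed
    moreover have "u \<notin> P'" using S1[OF one_P, of 1] uvc P'(2) by auto
    ultimately have "P' \<subset> P" using uP by blast
    then show False using krull_dim_le_1D[OF dim P'(1) P(1) mprime _ Pm] by blast
  qed
  have "depth R m \<le> 1"
    unfolding depth_def using len by (auto intro!: Sup_least simp: one_enat_def)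
  with depth_ge kd show ?thesis by simp
qed

subsection \<open>Localization\<close>

locale multiplicative_subset = cring R for R (structure) +
  fixes S
  assumes S_carrier: "S \<subseteq> carrier R"
    and one_in_S: "\<one> \<in> S"
    and mult_in_S: "\<And>s t. s \<in> S \<Longrightarrow> t \<in> S \<Longrightarrow> s \<otimes> t \<in> S"
begin

abbreviation "fr \<equiv> fraction R S"
abbreviation "L \<equiv> localization R S"

lemma S_closed: "s \<in> S \<Longrightarrow> s \<in> carrier R"
  using S_carrier by blast

lemma frac_mem:
  "(b, t) \<in> fr a s \<longleftrightarrow> b \<in> carrier R \<and> t \<in> S \<and> (\<exists>u\<in>S. u \<otimes> (a \<otimes> t \<ominus> b \<otimes> s) = \<zero>)"
  unfolding fraction_def by simp

lemma frac_self: "a \<in> carrier R \<Longrightarrow> s \<in> S \<Longrightarrow> (a, s) \<in> fr a s"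
  unfolding frac_mem using one_in_S S_closed by (auto intro!: bexI[of _ "\<one>"] simp: r_right_minus_eq)

lemma frac_mem_sym:
  assumes "a \<in> carrier R" "s \<in> S" "(b, t) \<in> fr a s"
  shows "(a, s) \<in> fr b t"
proof -
  obtain u where u: "u \<in> S" "u \<otimes> (a \<otimes> t \<ominus> b \<otimes> s) = \<zero>" and bt: "b \<in> carrier R" "t \<in> S"
    using assms(3) frac_mem by auto
  have c: "u \<in> carrier R" "s \<in> carrier R" "t \<in> carrier R" using u bt assms S_closed by auto
  have "u \<otimes> (b \<otimes> s \<ominus> a \<otimes> t) = \<ominus> (u \<otimes> (a \<otimes> t \<ominus> b \<otimes> s))" using c bt assms by algebra
  also have "\<dots> = \<zero>" using u by simp
  finally show ?thesis using u(1) assms frac_mem by blast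
qed

text \<open>The multipliers \<open>u\<close> and \<open>v\<close> kill the two differences; the
  further factor \<open>t\<close> in the witness clears the denominator of the middle
  fraction.\<close>

lemma frac_mem_trans:
  assumes "a \<in> carrier R" "s \<in> S" "(b, t) \<in> fr a s" "(c, w) \<in> fr b t"
  shows "(c, w) \<in> fr a s"
proof -
  obtain u where u: "u \<in> S" "u \<otimes> (a \<otimes> t \<ominus> b \<otimes> s) = \<zero>" and bt: "b \<in> carrier R" "t \<in> S"
    using assms(3) frac_mem by auto
  obtain v where v: "v \<in> S" "v \<otimes> (b \<otimes> w \<ominus> c \<otimes> t) = \<zero>" and cw: "c \<in> carrier R" "w \<in> S"
    using assms(4) frac_mem by auto
  have cc: "u \<in> carrier R" "s \<in> carrier R" "t \<in> carrier R" "v \<in> carrier R" "w \<in> carrier R"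
    using u v bt cw assms S_closed by auto
  have "(u \<otimes> v \<otimes> t) \<otimes> (a \<otimes> w \<ominus> c \<otimes> s)
      = (v \<otimes> w) \<otimes> (u \<otimes> (a \<otimes> t \<ominus> b \<otimes> s)) \<oplus> (u \<otimes> s) \<otimes> (v \<otimes> (b \<otimes> w \<ominus> c \<otimes> t))"
    using cc bt cw assms by algebra
  also have "\<dots> = \<zero>" unfolding u(2) v(2) using cc by simp
  finally have "(u \<otimes> v \<otimes> t) \<otimes> (a \<otimes> w \<ominus> c \<otimes> s) = \<zero>" .
  moreover have "u \<otimes> v \<otimes> t \<in> S" using u v bt mult_in_S by blast
  ultimately show ?thesis using cw frac_mem by blast
qed

lemma frac_eq_of_mem:
  assumes "a \<in> carrier R" "s \<in> S" "(b, t) \<in> fr a s"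
  shows "fr b t = fr a s"
proof -
  have bt: "b \<in> carrier R" "t \<in> S" using assms frac_mem by auto
  have sym: "(a, s) \<in> fr b t" using frac_mem_sym assms by blast
  show ?thesis
    using frac_mem_trans[OF assms] frac_mem_trans[OF bt sym] by auto
qed

lemma frac_eq_iff:
  assumes "a \<in> carrier R" "b \<in> carrier R" "s \<in> S" "t \<in> S"
  shows "fr a s = fr b t \<longleftrightarrow> (\<exists>u\<in>S. u \<otimes> (a \<otimes> t \<ominus> b \<otimes> s) = \<zero>)"
  using frac_eq_of_mem[of a s b t] frac_self[of b t] frac_mem[of b t a s] assms by auto

lemma frac_eqI:
  assumes "a \<in> carrier R" "b \<in> carrier R" "s \<in> S" "t \<in> S" "a \<otimes> t = b \<otimes> s"
  shows "fr a s = fr b t"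
proof -
  have "\<one> \<otimes> (a \<otimes> t \<ominus> b \<otimes> s) = \<zero>"
    using assms S_closed by (simp add: r_right_minus_eq)
  then show ?thesis using frac_eq_iff[OF assms(1-4)] one_in_S by blast
qed

text \<open>Collapses the union over representatives in the product of \<open>localization\<close>
  to a single class; \<open>frac_add_cong\<close> does the same for the sum.\<close>

lemma frac_mult_cong:
  assumes "a \<in> carrier R" "s \<in> S" "b \<in> carrier R" "t \<in> S"
    "(a', s') \<in> fr a s" "(b', t') \<in> fr b t"
  shows "fr (a' \<otimes> b') (s' \<otimes> t') = fr (a \<otimes> b) (s \<otimes> t)"
proof -
  obtain u where u: "u \<in> S" "u \<otimes> (a \<otimes> s' \<ominus> a' \<otimes> s) = \<zero>" and a': "a' \<in> carrier R" "s' \<in> S"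
    using assms(5) frac_mem by auto
  obtain v where v: "v \<in> S" "v \<otimes> (b \<otimes> t' \<ominus> b' \<otimes> t) = \<zero>" and b': "b' \<in> carrier R" "t' \<in> S"
    using assms(6) frac_mem by auto
  have c: "u \<in> carrier R" "s \<in> carrier R" "t \<in> carrier R" "v \<in> carrier R"
    "s' \<in> carrier R" "t' \<in> carrier R" using u v a' b' assms S_closed by auto
  have "(u \<otimes> v) \<otimes> ((a \<otimes> b) \<otimes> (s' \<otimes> t') \<ominus> (a' \<otimes> b') \<otimes> (s \<otimes> t))
     = (v \<otimes> b \<otimes> t') \<otimes> (u \<otimes> (a \<otimes> s' \<ominus> a' \<otimes> s)) \<oplus> (u \<otimes> a' \<otimes> s) \<otimes> (v \<otimes> (b \<otimes> t' \<ominus> b' \<otimes> t))"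
    using c a' b' assms(1,3) by algebra
  also have "\<dots> = \<zero>" unfolding u(2) v(2) using c a' b' assms by simp
  finally have "\<exists>w\<in>S. w \<otimes> ((a \<otimes> b) \<otimes> (s' \<otimes> t') \<ominus> (a' \<otimes> b') \<otimes> (s \<otimes> t)) = \<zero>"
    using mult_in_S u v by blast
  then show ?thesis
    using frac_eq_iff[of "a \<otimes> b" "a' \<otimes> b'" "s \<otimes> t" "s' \<otimes> t'"] assms a' b' mult_in_S by simp
qed

lemma frac_add_cong:
  assumes "a \<in> carrier R" "s \<in> S" "b \<in> carrier R" "t \<in> S"
    "(a', s') \<in> fr a s" "(b', t') \<in> fr b t"
  shows "fr (a' \<otimes> t' \<oplus> b' \<otimes> s') (s' \<otimes> t') = fr (a \<otimes> t \<oplus> b \<otimes> s) (s \<otimes> t)"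
proof -
  obtain u where u: "u \<in> S" "u \<otimes> (a \<otimes> s' \<ominus> a' \<otimes> s) = \<zero>" and a': "a' \<in> carrier R" "s' \<in> S"
    using assms(5) frac_mem by auto
  obtain v where v: "v \<in> S" "v \<otimes> (b \<otimes> t' \<ominus> b' \<otimes> t) = \<zero>" and b': "b' \<in> carrier R" "t' \<in> S"
    using assms(6) frac_mem by auto
  have c: "u \<in> carrier R" "s \<in> carrier R" "t \<in> carrier R" "v \<in> carrier R"
    "s' \<in> carrier R" "t' \<in> carrier R" using u v a' b' assms S_closed by auto
  have "(u \<otimes> v) \<otimes> ((a \<otimes> t \<oplus> b \<otimes> s) \<otimes> (s' \<otimes> t') \<ominus> (a' \<otimes> t' \<oplus> b' \<otimes> s') \<otimes> (s \<otimes> t))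
     = (v \<otimes> t \<otimes> t') \<otimes> (u \<otimes> (a \<otimes> s' \<ominus> a' \<otimes> s)) \<oplus> (u \<otimes> s \<otimes> s') \<otimes> (v \<otimes> (b \<otimes> t' \<ominus> b' \<otimes> t))"
    using c a' b' assms(1,3) by algebra
  also have "\<dots> = \<zero>" unfolding u(2) v(2) using c a' b' assms by simp
  finally have "\<exists>w\<in>S. w \<otimes> ((a \<otimes> t \<oplus> b \<otimes> s) \<otimes> (s' \<otimes> t') \<ominus> (a' \<otimes> t' \<oplus> b' \<otimes> s') \<otimes> (s \<otimes> t)) = \<zero>"
    using mult_in_S u v by blast
  then show ?thesis
    using frac_eq_iff[of "a \<otimes> t \<oplus> b \<otimes> s" "a' \<otimes> t' \<oplus> b' \<otimes> s'" "s \<otimes> t" "s' \<otimes> t'"]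
      assms a' b' c mult_in_S by simp
qed

lemma carrier_L: "carrier L = {fr a s | a s. a \<in> carrier R \<and> s \<in> S}"
  unfolding localization_def by simp

lemma frac_closed [simp]: "a \<in> carrier R \<Longrightarrow> s \<in> S \<Longrightarrow> fr a s \<in> carrier L"
  unfolding carrier_L by blast

lemma L_elem:
  assumes "x \<in> carrier L"
  obtains a s where "a \<in> carrier R" "s \<in> S" "x = fr a s"
  using assms unfolding carrier_L by blast

lemma L_zero: "\<zero>\<^bsub>L\<^esub> = fr \<zero> \<one>" and L_one: "\<one>\<^bsub>L\<^esub> = fr \<one> \<one>"
  unfolding localization_def by simp_all

lemma L_mult:
  assumes "a \<in> carrier R" "s \<in> S" "b \<in> carrier R" "t \<in> S"
  shows "fr a s \<otimes>\<^bsub>L\<^esub> fr b t = fr (a \<otimes> b) (s \<otimes> t)"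
proof -
  have "fr a s \<otimes>\<^bsub>L\<^esub> fr b t
    = (\<Union>(a', s')\<in>fr a s. \<Union>(b', t')\<in>fr b t. fr (a' \<otimes> b') (s' \<otimes> t'))"
    unfolding localization_def by simp
  also have "\<dots> = (\<Union>p\<in>fr a s. \<Union>q\<in>fr b t. fr (a \<otimes> b) (s \<otimes> t))"
    by (intro SUP_cong refl) (auto simp: frac_mult_cong[OF assms])
  also have "\<dots> = fr (a \<otimes> b) (s \<otimes> t)"
    using frac_self assms by blast
  finally show ?thesis .
qed

lemma L_add:
  assumes "a \<in> carrier R" "s \<in> S" "b \<in> carrier R" "t \<in> S"
  shows "fr a s \<oplus>\<^bsub>L\<^esub> fr b t = fr (a \<otimes> t \<oplus> b \<otimes> s) (s \<otimes> t)"
proof -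
  have "fr a s \<oplus>\<^bsub>L\<^esub> fr b t
    = (\<Union>(a', s')\<in>fr a s. \<Union>(b', t')\<in>fr b t. fr (a' \<otimes> t' \<oplus> b' \<otimes> s') (s' \<otimes> t'))"
    unfolding localization_def by simp
  also have "\<dots> = (\<Union>p\<in>fr a s. \<Union>q\<in>fr b t. fr (a \<otimes> t \<oplus> b \<otimes> s) (s \<otimes> t))"
    by (intro SUP_cong refl) (auto simp: frac_add_cong[OF assms])
  also have "\<dots> = fr (a \<otimes> t \<oplus> b \<otimes> s) (s \<otimes> t)"
    using frac_self assms by blast
  finally show ?thesis .
qed

lemma L_cring: "cring L"
proof (rule cringI)
  note [simp] = L_mult L_add mult_in_S one_in_S S_closed
  show "abelian_group L"
  proof (rule abelian_groupI)
    show "x \<oplus>\<^bsub>L\<^esub> y \<in> carrier L" if "x \<in> carrier L" "y \<in> carrier L" for x y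
      using that by (elim L_elem) simp
    show "\<zero>\<^bsub>L\<^esub> \<in> carrier L" by (simp add: L_zero)
    show "x \<oplus>\<^bsub>L\<^esub> y \<oplus>\<^bsub>L\<^esub> z = x \<oplus>\<^bsub>L\<^esub> (y \<oplus>\<^bsub>L\<^esub> z)"
      if xyz: "x \<in> carrier L" "y \<in> carrier L" "z \<in> carrier L" for x y z
    proof -
      obtain a s b t c w where e: "a \<in> carrier R" "s \<in> S" "x = fr a s"
        "b \<in> carrier R" "t \<in> S" "y = fr b t" "c \<in> carrier R" "w \<in> S" "z = fr c w"
        using xyz by (elim L_elem) blast
      have 1: "s \<otimes> t \<otimes> w = s \<otimes> (t \<otimes> w)" using e by (simp add: m_assoc)
      have 2: "(a \<otimes> t \<oplus> b \<otimes> s) \<otimes> w \<oplus> c \<otimes> (s \<otimes> t) = a \<otimes> (t \<otimes> w) \<oplus> (b \<otimes> w \<oplus> c \<otimes> t) \<otimes> s"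
        using e(1,4,7) e(2,5,8)[THEN S_closed] by algebra
      show ?thesis using e 1 2 by simp
    qed
    show "x \<oplus>\<^bsub>L\<^esub> y = y \<oplus>\<^bsub>L\<^esub> x" if xy: "x \<in> carrier L" "y \<in> carrier L" for x y
    proof -
      obtain a s b t where e: "a \<in> carrier R" "s \<in> S" "x = fr a s"
        "b \<in> carrier R" "t \<in> S" "y = fr b t"
        using xy by (elim L_elem) blast
      then show ?thesis by (simp add: a_comm m_comm)
    qed
    show "\<zero>\<^bsub>L\<^esub> \<oplus>\<^bsub>L\<^esub> x = x" if x: "x \<in> carrier L" for x
      using x by (elim L_elem) (simp add: L_zero)
    show "\<exists>y\<in>carrier L. y \<oplus>\<^bsub>L\<^esub> x = \<zero>\<^bsub>L\<^esub>" if x: "x \<in> carrier L" for x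
    proof -
      obtain a s where e: "a \<in> carrier R" "s \<in> S" "x = fr a s"
        using x by (elim L_elem) blast
      have "(\<ominus> a \<otimes> s \<oplus> a \<otimes> s) \<otimes> \<one> = \<zero> \<otimes> (s \<otimes> s)"
        using e(1) S_closed[OF e(2)] by algebra
      then have "fr (\<ominus> a) s \<oplus>\<^bsub>L\<^esub> x = \<zero>\<^bsub>L\<^esub>"
        using e by (simp add: L_zero) (rule frac_eqI; simp)
      then show ?thesis using e by (intro bexI[of _ "fr (\<ominus> a) s"]) simp_all
    qed
  qed
  show "comm_monoid L"
  proof (rule comm_monoidI)
    show "x \<otimes>\<^bsub>L\<^esub> y \<in> carrier L" if "x \<in> carrier L" "y \<in> carrier L" for x y
      using that by (elim L_elem) simp
    show "\<one>\<^bsub>L\<^esub> \<in> carrier L" by (simp add: L_one)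
    show "x \<otimes>\<^bsub>L\<^esub> y \<otimes>\<^bsub>L\<^esub> z = x \<otimes>\<^bsub>L\<^esub> (y \<otimes>\<^bsub>L\<^esub> z)"
      if "x \<in> carrier L" "y \<in> carrier L" "z \<in> carrier L" for x y z
      using that by (elim L_elem) (simp add: m_assoc)
    show "\<one>\<^bsub>L\<^esub> \<otimes>\<^bsub>L\<^esub> x = x" if x: "x \<in> carrier L" for x
      using x by (elim L_elem) (simp add: L_one)
    show "x \<otimes>\<^bsub>L\<^esub> y = y \<otimes>\<^bsub>L\<^esub> x" if "x \<in> carrier L" "y \<in> carrier L" for x y
      using that by (elim L_elem) (simp add: m_comm)
  qed
  show "(x \<oplus>\<^bsub>L\<^esub> y) \<otimes>\<^bsub>L\<^esub> z = x \<otimes>\<^bsub>L\<^esub> z \<oplus>\<^bsub>L\<^esub> y \<otimes>\<^bsub>L\<^esub> z"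
    if xyz: "x \<in> carrier L" "y \<in> carrier L" "z \<in> carrier L" for x y z
  proof -
    obtain a s b t c w where e: "a \<in> carrier R" "s \<in> S" "x = fr a s"
      "b \<in> carrier R" "t \<in> S" "y = fr b t" "c \<in> carrier R" "w \<in> S" "z = fr c w"
      using xyz by (elim L_elem) blast
    have "(a \<otimes> t \<oplus> b \<otimes> s) \<otimes> c \<otimes> (s \<otimes> w \<otimes> (t \<otimes> w))
        = (a \<otimes> c \<otimes> (t \<otimes> w) \<oplus> b \<otimes> c \<otimes> (s \<otimes> w)) \<otimes> (s \<otimes> t \<otimes> w)"
      using e(1,4,7) e(2,5,8)[THEN S_closed] by algebra
    then have "fr ((a \<otimes> t \<oplus> b \<otimes> s) \<otimes> c) (s \<otimes> t \<otimes> w)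
      = fr (a \<otimes> c \<otimes> (t \<otimes> w) \<oplus> b \<otimes> c \<otimes> (s \<otimes> w)) (s \<otimes> w \<otimes> (t \<otimes> w))"
      using e by (intro frac_eqI) simp_all
    then show ?thesis using e by simp
  qed
qed

sublocale L: cring L by (rule L_cring)

lemma frac_hom: "ring_hom_cring R L (\<lambda>x. fr x \<one>)"
proof (rule UnivPoly.ring_hom_cringI[OF is_cring L_cring])
  show "(\<lambda>x. fr x \<one>) \<in> ring_hom R L"
    by (rule ring_hom_memI) (simp_all add: L_mult L_add L_one one_in_S)
qed

lemma frac_split:
  assumes "a \<in> carrier R" "s \<in> S"
  shows "fr a s = fr \<one> s \<otimes>\<^bsub>L\<^esub> fr a \<one>" "fr a \<one> = fr s \<one> \<otimes>\<^bsub>L\<^esub> fr a s"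
  using assms one_in_S mult_in_S S_closed
  by (simp_all add: L_mult) (rule frac_eqI; simp add: m_comm)

lemma frac_eq_zero_iff:
  assumes "a \<in> carrier R" "s \<in> S"
  shows "fr a s = \<zero>\<^bsub>L\<^esub> \<longleftrightarrow> (\<exists>u\<in>S. u \<otimes> a = \<zero>)"
proof -
  have "a \<otimes> \<one> \<ominus> \<zero> \<otimes> s = a" using assms S_closed[OF assms(2)] by algebra
  then show ?thesis unfolding L_zero using assms one_in_S by (simp add: frac_eq_iff)
qed

text \<open>The fractions \<open>fr a s\<close> and \<open>fr a \<one>\<close> are multiples of each
  other, so denominators do not affect membership in an ideal.\<close>

lemma frac_mem_ideal_iff:
  assumes "ideal Q L" "a \<in> carrier R" "s \<in> S"
  shows "fr a s \<in> Q \<longleftrightarrow> fr a \<one> \<in> Q"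
  using frac_split[OF assms(2,3)] ideal.I_l_closed[OF assms(1)] frac_closed one_in_S
    S_closed[OF assms(3)] assms one_closed by metis

section \<open>Contraction of ideals from the localization\<close>

definition contraction where "contraction Q = {x \<in> carrier R. fr x \<one> \<in> Q}"

lemma contraction_ideal:
  assumes "ideal Q L" shows "ideal (contraction Q) R"
proof -
  interpret ring_hom_cring R L "\<lambda>x. fr x \<one>" by (rule frac_hom)
  interpret Q: ideal Q L by fact
  show ?thesis unfolding contraction_def
  proof (rule idealI[OF ring_axioms])
    show "subgroup {x \<in> carrier R. fr x \<one> \<in> Q} (add_monoid R)"
      by (rule add.subgroupI) (auto simp: one_in_S intro!: exI[of _ "\<zero>"])
    show "x \<otimes> a \<in> {x \<in> carrier R. fr x \<one> \<in> Q}"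
      "a \<otimes> x \<in> {x \<in> carrier R. fr x \<one> \<in> Q}"
      if "a \<in> {x \<in> carrier R. fr x \<one> \<in> Q}" "x \<in> carrier R" for a x
      using that by (auto simp: Q.I_l_closed Q.I_r_closed)
  qed
qed

text \<open>A fraction lies in an ideal of \<open>L\<close> exactly when its numerator lies in the
  contraction, so an ideal of \<open>L\<close> is determined by its contraction.\<close>

lemma contraction_mono_strict:
  assumes "ideal P L" "ideal Q L" "P \<subset> Q"
  shows "contraction P \<subset> contraction Q"
proof -
  obtain x where x: "x \<in> Q" "x \<notin> P" using assms by blast
  then obtain a s where a: "a \<in> carrier R" "s \<in> S" "x = fr a s"
    using L_elem ideal.Icarr[OF assms(2)] by metis
  have "a \<in> contraction Q" "a \<notin> contraction P"
    using x a frac_mem_ideal_iff assms unfolding contraction_def by auto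
  moreover have "contraction P \<subseteq> contraction Q" using assms(3) unfolding contraction_def by auto
  ultimately show ?thesis by blast
qed

lemma contraction_prime:
  assumes "primeideal Q L" shows "primeideal (contraction Q) R"
proof (rule primeidealI)
  interpret Q: primeideal Q L by fact
  show "ideal (contraction Q) R" using contraction_ideal Q.is_ideal by blast
  show "cring R" by (rule is_cring)
  have "\<one>\<^bsub>L\<^esub> \<notin> Q" using Q.I_notcarr Q.one_imp_carrier by blast
  then show "carrier R \<noteq> contraction Q" unfolding contraction_def L_one by force
  show "a \<in> contraction Q \<or> b \<in> contraction Q"
    if ab: "a \<in> carrier R" "b \<in> carrier R" "a \<otimes> b \<in> contraction Q" for a b
    using Q.I_prime[of "fr a \<one>" "fr b \<one>"] ab one_in_S
    unfolding contraction_def by (simp add: L_mult)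
qed

lemma krull_dim_L_le_1:
  assumes "krull_dim R \<le> 1" shows "krull_dim L \<le> 1"
proof (rule krull_dim_le_1I)
  fix P0 P1 P2 assume P: "primeideal P0 L" "primeideal P1 L" "primeideal P2 L" "P0 \<subset> P1" "P1 \<subset> P2"
  note i = P(1-3)[THEN primeideal.axioms(1)]
  show False
    using krull_dim_le_1D[OF assms P(1-3)[THEN contraction_prime]]
      contraction_mono_strict[OF i(1,2) P(4)] contraction_mono_strict[OF i(2,3) P(5)] by blast
qed

text \<open>Generators of the contraction of \<open>Q\<close> generate \<open>Q\<close> after
  passing to fractions, since every element of \<open>Q\<close> has its numerator in the
  contraction.\<close>

lemma L_noetherian:
  assumes "noetherian_ring R" shows "noetherian_ring L"
proof (rule L.noetherian_ringI)
  fix Q assume Q: "ideal Q L"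
  interpret Q: ideal Q L by fact
  obtain G where G: "G \<subseteq> carrier R" "finite G" "contraction Q = Idl G"
    using noetherian_ring.finetely_gen[OF assms contraction_ideal[OF Q]] by blast
  let ?G = "(\<lambda>x. fr x \<one>) ` G"
  have Gc: "?G \<subseteq> carrier L" using G one_in_S by auto
  have GQ: "?G \<subseteq> Q" using genideal_self[OF G(1)] G(3) unfolding contraction_def by auto
  have idl: "ideal (Idl\<^bsub>L\<^esub> ?G) L" using Gc by (rule L.genideal_ideal)
  have "G \<subseteq> contraction (Idl\<^bsub>L\<^esub> ?G)"
    using L.genideal_self[OF Gc] G(1) unfolding contraction_def by auto
  then have sub: "contraction Q \<subseteq> contraction (Idl\<^bsub>L\<^esub> ?G)"
    using genideal_minimal[OF contraction_ideal[OF idl]] G(3) by simp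
  have "Q \<subseteq> Idl\<^bsub>L\<^esub> ?G"
  proof
    fix x assume x: "x \<in> Q"
    then obtain a s where a: "a \<in> carrier R" "s \<in> S" "x = fr a s"
      using L_elem Q.Icarr by metis
    then have "a \<in> contraction Q" using x frac_mem_ideal_iff[OF Q] unfolding contraction_def by simp
    then show "x \<in> Idl\<^bsub>L\<^esub> ?G"
      using sub a frac_mem_ideal_iff[OF idl] unfolding contraction_def by auto
  qed
  moreover have "Idl\<^bsub>L\<^esub> ?G \<subseteq> Q" using L.genideal_minimal[OF Q GQ] .
  ultimately show "\<exists>A\<subseteq>carrier L. finite A \<and> Q = Idl\<^bsub>L\<^esub> A"
    using Gc G(2) by blast
qed

lemma nonzerodivisor_frac:
  assumes "nonzerodivisor R x" shows "nonzerodivisor L (fr x \<one>)"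
  unfolding nonzerodivisor_def
proof (intro conjI ballI impI)
  note x = nonzerodivisorD[OF assms]
  show "fr x \<one> \<in> carrier L" using x one_in_S by simp
  fix y assume y: "y \<in> carrier L" "fr x \<one> \<otimes>\<^bsub>L\<^esub> y = \<zero>\<^bsub>L\<^esub>"
  then obtain a s where a: "a \<in> carrier R" "s \<in> S" "y = fr a s" using L_elem by metis
  then have "fr (x \<otimes> a) s = \<zero>\<^bsub>L\<^esub>" using y x one_in_S S_closed by (simp add: L_mult)
  then obtain u where u: "u \<in> S" "u \<otimes> (x \<otimes> a) = \<zero>" using frac_eq_zero_iff a x by auto
  have "x \<otimes> (u \<otimes> a) = u \<otimes> (x \<otimes> a)" using u a x S_closed by (simp add: m_lcomm)
  then have "u \<otimes> a = \<zero>" using u x(2)[of "u \<otimes> a"] a S_closed by simp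
  then show "y = \<zero>\<^bsub>L\<^esub>" using frac_eq_zero_iff a u by auto
qed

end

lemma (in cring) local_ringI:
  assumes M: "ideal M R" "\<one> \<notin> M" and units: "\<And>x. x \<in> carrier R \<Longrightarrow> x \<notin> M \<Longrightarrow> x \<in> Units R"
  shows "local_ring R M"
proof -
  interpret M: ideal M R by fact
  have sub: "J \<subseteq> M" if J: "ideal J R" "J \<noteq> carrier R" for J
  proof (rule ccontr)
    assume "\<not> J \<subseteq> M"
    then obtain x where x: "x \<in> J" "x \<notin> M" by blast
    interpret J: ideal J R by fact
    have "x \<in> Units R" using x units J.Icarr by blast
    then have "inv x \<otimes> x = \<one>" "inv x \<in> carrier R" by simp_all
    then have "\<one> \<in> J" using J.I_l_closed[OF x(1)] by metis
    then show False using J.one_imp_carrier J(2) by blast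
  qed
  have "maximalideal M R"
    by (rule maximalidealI) (use M sub in blast)+
  moreover have "N = M" if N: "maximalideal N R" for N
  proof -
    have "N \<subseteq> M" using sub maximalideal.axioms(1)[OF N] maximalideal.I_notcarr[OF N] by blast
    then show ?thesis using maximalideal.I_maximal[OF N M(1)] M M.a_subset by blast
  qed
  ultimately show ?thesis unfolding local_ring_def using is_cring by blast
qed

section \<open>Localization at a prime ideal\<close>

locale prime_complement = primeideal M R for M and R (structure)
begin

sublocale multiplicative_subset R "carrier R - M"
  by unfold_locales (use I_notcarr one_imp_carrier I_prime in auto)

definition max_frac where
  "max_frac = {fr x s | x s. x \<in> M \<and> s \<in> carrier R - M}"

text \<open>Independence of the representative needs primality:
  \<open>u \<otimes> (a \<otimes> t)\<close> lies in \<open>M\<close> while \<open>u\<close> and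
  \<open>t\<close> do not.\<close>

lemma frac_mem_max_frac_iff:
  assumes "a \<in> carrier R" "s \<in> carrier R - M"
  shows "fr a s \<in> max_frac \<longleftrightarrow> a \<in> M"
proof
  assume "fr a s \<in> max_frac"
  then obtain x t where x: "x \<in> M" "t \<in> carrier R - M" "fr a s = fr x t"
    unfolding max_frac_def by blast
  then obtain u where u: "u \<in> carrier R - M" "u \<otimes> (a \<otimes> t \<ominus> x \<otimes> s) = \<zero>"
    using frac_eq_iff[of a x s t] assms Icarr by auto
  have c: "x \<in> carrier R" "t \<in> carrier R" "u \<in> carrier R" "s \<in> carrier R" using x u assms Icarr by auto
  have "u \<otimes> (a \<otimes> t) = u \<otimes> (a \<otimes> t \<ominus> x \<otimes> s) \<oplus> (u \<otimes> s) \<otimes> x" using c assms(1) by algebra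
  also have "\<dots> \<in> M" unfolding u(2) using x c by (simp add: I_l_closed)
  finally show "a \<in> M" using I_prime[of u "a \<otimes> t"] I_prime[of a t] u x c assms by auto
qed (use assms in \<open>auto simp: max_frac_def\<close>)

lemma max_frac_ideal: "ideal max_frac L"
proof (rule idealI)
  interpret h: ring_hom_cring R L "\<lambda>x. fr x \<one>" by (rule frac_hom)
  show "ring L" by (rule L.ring_axioms)
  have mem: "x \<in> max_frac \<longleftrightarrow> (\<exists>a s. a \<in> M \<and> s \<in> carrier R - M \<and> x = fr a s)" for x
    unfolding max_frac_def by blast
  have sub: "max_frac \<subseteq> carrier L" unfolding max_frac_def by (auto simp: Icarr)
  have mult: "x \<otimes>\<^bsub>L\<^esub> y \<in> max_frac" if xy: "x \<in> carrier L" "y \<in> max_frac" for x y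
  proof -
    obtain a s where a: "a \<in> carrier R" "s \<in> carrier R - M" "x = fr a s"
      using xy(1) by (rule L_elem)
    obtain b t where b: "b \<in> M" "t \<in> carrier R - M" "y = fr b t" using xy mem by blast
    have "x \<otimes>\<^bsub>L\<^esub> y = fr (a \<otimes> b) (s \<otimes> t)" unfolding a b by (rule L_mult) (use a b Icarr in auto)
    moreover have "a \<otimes> b \<in> M" using a b I_l_closed by blast
    moreover have "s \<otimes> t \<in> carrier R - M" using a b mult_in_S[of s t] by blast
    ultimately show ?thesis unfolding max_frac_def by blast
  qed
  show "subgroup max_frac (add_monoid L)"
  proof (rule L.add.subgroupI)
    show "max_frac \<subseteq> carrier L" by (rule sub)
    show "max_frac \<noteq> {}" using frac_mem_max_frac_iff[of \<zero> \<one>] one_in_S by auto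
    show "\<ominus>\<^bsub>L\<^esub> x \<in> max_frac" if "x \<in> max_frac" for x
    proof -
      have xc: "x \<in> carrier L" using that sub by blast
      have "\<ominus>\<^bsub>L\<^esub> x = (\<ominus>\<^bsub>L\<^esub> \<one>\<^bsub>L\<^esub>) \<otimes>\<^bsub>L\<^esub> x" using L.l_minus[OF L.one_closed xc] L.l_one[OF xc] by simp
      moreover have "\<ominus>\<^bsub>L\<^esub> \<one>\<^bsub>L\<^esub> \<in> carrier L" by (intro L.a_inv_closed L.one_closed)
      ultimately show ?thesis using mult[OF _ that] by metis
    qed
    show "x \<oplus>\<^bsub>L\<^esub> y \<in> max_frac" if xy: "x \<in> max_frac" "y \<in> max_frac" for x y
    proof -
      obtain a s where a: "a \<in> M" "s \<in> carrier R - M" "x = fr a s" using xy mem by blast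
      obtain b t where b: "b \<in> M" "t \<in> carrier R - M" "y = fr b t" using xy mem by blast
      have "x \<oplus>\<^bsub>L\<^esub> y = fr (a \<otimes> t \<oplus> b \<otimes> s) (s \<otimes> t)"
        unfolding a b by (rule L_add) (use a b Icarr in auto)
      moreover have "a \<otimes> t \<oplus> b \<otimes> s \<in> M" using a b by (simp add: I_r_closed)
      moreover have "s \<otimes> t \<in> carrier R - M" using a b mult_in_S[of s t] by blast
      ultimately show ?thesis unfolding max_frac_def by blast
    qed
  qed
  show "x \<otimes>\<^bsub>L\<^esub> a \<in> max_frac" "a \<otimes>\<^bsub>L\<^esub> x \<in> max_frac"
    if "a \<in> max_frac" "x \<in> carrier L" for a x
    using mult[OF that(2,1)] L.m_comm[of x a] that sub by auto
qed

lemma local_ring_L: "local_ring L max_frac"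
proof (rule L.local_ringI[OF max_frac_ideal])
  have one: "\<one> \<in> carrier R - M" by (rule one_in_S)
  then show "\<one>\<^bsub>L\<^esub> \<notin> max_frac" unfolding L_one using frac_mem_max_frac_iff[of "\<one>" "\<one>"] by simp
  fix x assume x: "x \<in> carrier L" "x \<notin> max_frac"
  then obtain a s where a: "a \<in> carrier R" "s \<in> carrier R - M" "x = fr a s" using L_elem by metis
  then have a': "a \<in> carrier R - M" using x frac_mem_max_frac_iff by blast
  have "x \<otimes>\<^bsub>L\<^esub> fr s a = \<one>\<^bsub>L\<^esub>"
  proof -
    have "x \<otimes>\<^bsub>L\<^esub> fr s a = fr (a \<otimes> s) (s \<otimes> a)"
      unfolding a(3) by (rule L_mult) (use a a' in auto)
    also have "\<dots> = fr \<one> \<one>"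
      by (rule frac_eqI) (use a a' one mult_in_S[of s a] in \<open>auto simp: m_comm\<close>)
    finally show ?thesis unfolding L_one .
  qed
  moreover have "fr s a \<in> carrier L" using a a' by simp
  ultimately have "fr s a \<in> carrier L" "x \<otimes>\<^bsub>L\<^esub> fr s a = \<one>\<^bsub>L\<^esub>" "fr s a \<otimes>\<^bsub>L\<^esub> x = \<one>\<^bsub>L\<^esub>"
    using L.m_comm[OF x(1)] by simp_all
  then show "x \<in> Units L" unfolding Units_def using x(1) by blast
qed

end

subsection \<open>Quotients of ideals as modules\<close>

text \<open>Extends a multiplication from \<open>K\<close> into \<open>K'\<close> to the products
  with \<open>J\<close>. With \<open>J = m\<close> it shows that multiplication by
  \<open>I i\<close> carries \<open>m \<cdot> I j\<close> into
  \<open>m \<cdot> I (i + j)\<close>.\<close>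

lemma (in cring) ideal_prod_lmult:
  assumes "ideal J R" "ideal K R" "x \<in> carrier R" "y \<in> J \<cdot> K" "\<And>z. z \<in> K \<Longrightarrow> x \<otimes> z \<in> K'"
  shows "x \<otimes> y \<in> J \<cdot> K'"
  using assms(4)
proof (induct y rule: ideal_prod.induct)
  case (prod i j)
  have "x \<otimes> (i \<otimes> j) = i \<otimes> (x \<otimes> j)"
    using prod assms(1-3) by (simp add: m_lcomm ideal.Icarr)
  then show ?case using prod assms(5) by (simp add: ideal_prod.prod)
next
  case (sum s1 s2)
  have "s1 \<in> carrier R" "s2 \<in> carrier R" using sum ideal_prod_in_carrier assms(1,2) by blast+
  then show ?case using sum assms(3) by (simp add: r_distr ideal_prod.sum)
qed

lemma (in cring) ideal_prod_mono: "K \<subseteq> K' \<Longrightarrow> J \<cdot> K \<subseteq> J \<cdot> K'"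
proof
  fix x assume K: "K \<subseteq> K'" and x: "x \<in> J \<cdot> K"
  from x show "x \<in> J \<cdot> K'" using K by (induct rule: ideal_prod.induct) (auto intro: ideal_prod.intros)
qed

lemma (in cring) PIdl_prod_eq:
  assumes "ideal K R" "a \<in> carrier R"
  shows "(PIdl a) \<cdot> K = {a \<otimes> k | k. k \<in> K}"
proof
  interpret K: ideal K R by fact
  show "(PIdl a) \<cdot> K \<subseteq> {a \<otimes> k | k. k \<in> K}"
  proof
    fix x assume "x \<in> (PIdl a) \<cdot> K"
    then show "x \<in> {a \<otimes> k | k. k \<in> K}"
    proof (induct rule: ideal_prod.induct)
      case (prod i j)
      then obtain c where c: "c \<in> carrier R" "i = c \<otimes> a" unfolding cgenideal_def by blast
      have "i \<otimes> j = a \<otimes> (c \<otimes> j)" using c prod(2) assms(2) K.Icarr by (simp add: m_ac)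
      then show ?case using K.I_l_closed[OF prod(2) c(1)] by blast
    next
      case (sum s1 s2)
      then obtain k l where "s1 = a \<otimes> k" "s2 = a \<otimes> l" "k \<in> K" "l \<in> K" by blast
      moreover from this have "s1 \<oplus> s2 = a \<otimes> (k \<oplus> l)" using assms(2) K.Icarr by (simp add: r_distr)
      ultimately show ?case using K.a_closed by blast
    qed
  qed
  show "{a \<otimes> k | k. k \<in> K} \<subseteq> (PIdl a) \<cdot> K"
    using cgenideal_self[OF assms(2)] ideal_prod.prod[of a "PIdl a" _ K R] by blast
qed

lemma (in ideal) finsum_mem:
  assumes "finite X" "\<And>i. i \<in> X \<Longrightarrow> f i \<in> I"
  shows "finsum R f X \<in> I"
  using assms
proof (induct X rule: finite_induct)
  case (insert i X)
  then have "finsum R f (insert i X) = f i \<oplus> finsum R f X"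
    by (intro finsum_insert) (auto simp: Icarr)
  then show ?case using insert by simp
qed simp

text \<open>Covers both the graded components of the fiber cone and the quotient whose length occurs
  in condition (5).\<close>

locale ideal_pair = cring R + N: ideal N R + K: ideal K R for N and K and R (structure) +
  assumes K_sub_N: "K \<subseteq> N"
begin

abbreviation "Q \<equiv> ideal_quotient R N K"

lemma Q_carrier: "carrier Q = {K +> x | x. x \<in> N}"
  unfolding ideal_quotient_def by simp

lemma Q_zero: "\<zero>\<^bsub>Q\<^esub> = K"
  unfolding ideal_quotient_def by simp

lemma Q_add: "x \<in> N \<Longrightarrow> y \<in> N \<Longrightarrow> (K +> x) \<oplus>\<^bsub>Q\<^esub> (K +> y) = K +> (x \<oplus> y)"
  unfolding ideal_quotient_def by (simp add: K.a_rcos_sum N.Icarr)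

lemma rcos_eq_zero_iff: "x \<in> N \<Longrightarrow> K +> x = K \<longleftrightarrow> x \<in> K"
  using K.rcos_eq_self_iff N.Icarr by blast

lemma Q_smult:
  assumes "a \<in> carrier R" "x \<in> N"
  shows "a \<odot>\<^bsub>Q\<^esub> (K +> x) = K +> (a \<otimes> x)"
proof -
  have x: "x \<in> carrier R" using assms N.Icarr by blast
  have "K +> (a \<otimes> y) = K +> (a \<otimes> x)" if y: "y \<in> K +> x" for y
  proof -
    obtain k where k: "k \<in> K" "y = k \<oplus> x" using y unfolding a_r_coset_def' by blast
    have kc: "k \<in> carrier R" using k K.Icarr by blast
    have "a \<otimes> y \<ominus> a \<otimes> x = a \<otimes> k" unfolding k(2) using kc x assms(1) by algebra
    then have "a \<otimes> y \<ominus> a \<otimes> x \<in> K" using k assms(1) K.I_l_closed by simp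
    then show ?thesis using K.rcos_eq_iff[of "a \<otimes> y" "a \<otimes> x"] k kc x assms(1) by simp
  qed
  moreover have "x \<in> K +> x" using x K.a_rcos_self by blast
  ultimately have "(\<Union>y\<in>K +> x. K +> (a \<otimes> y)) = K +> (a \<otimes> x)"
    by (metis (no_types, lifting) SUP_eq_const empty_iff)
  then show ?thesis unfolding ideal_quotient_def by simp
qed

lemma Q_module: "module R Q"
proof (rule moduleI[OF is_cring])
  show "abelian_group Q"
  proof (rule abelian_groupI)
    show "\<exists>y\<in>carrier Q. y \<oplus>\<^bsub>Q\<^esub> x = \<zero>\<^bsub>Q\<^esub>" if xQ: "x \<in> carrier Q" for x
    proof -
      obtain z where z: "z \<in> N" "x = K +> z" using xQ unfolding Q_carrier by blast
      then have "(K +> \<ominus> z) \<oplus>\<^bsub>Q\<^esub> x = K +> (\<ominus> z \<oplus> z)" by (simp add: Q_add)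
      also have "\<dots> = \<zero>\<^bsub>Q\<^esub>" using z N.Icarr K.rcos_eq_self_iff[of \<zero>] by (simp add: Q_zero l_neg)
      finally show ?thesis using z unfolding Q_carrier by blast
    qed
    show "\<zero>\<^bsub>Q\<^esub> \<in> carrier Q"
      unfolding Q_carrier Q_zero mem_Collect_eq
      using rcos_eq_zero_iff[OF N.zero_closed] K.zero_closed N.zero_closed by metis
    show "\<zero>\<^bsub>Q\<^esub> \<oplus>\<^bsub>Q\<^esub> x = x" if xQ: "x \<in> carrier Q" for x
    proof -
      obtain z where z: "z \<in> N" "x = K +> z" using xQ unfolding Q_carrier by blast
      have "\<zero>\<^bsub>Q\<^esub> = K +> \<zero>" unfolding Q_zero using rcos_eq_zero_iff[of \<zero>] by simp
      then show ?thesis using z N.Icarr by (simp add: Q_add)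
    qed
    show "x \<oplus>\<^bsub>Q\<^esub> y \<in> carrier Q" if "x \<in> carrier Q" "y \<in> carrier Q" for x y
      using that N.a_closed unfolding Q_carrier by (auto simp: Q_add)
    show "x \<oplus>\<^bsub>Q\<^esub> y \<oplus>\<^bsub>Q\<^esub> z = x \<oplus>\<^bsub>Q\<^esub> (y \<oplus>\<^bsub>Q\<^esub> z)"
      if "x \<in> carrier Q" "y \<in> carrier Q" "z \<in> carrier Q" for x y z
      using that unfolding Q_carrier by (auto simp: Q_add N.Icarr a_assoc)
    show "x \<oplus>\<^bsub>Q\<^esub> y = y \<oplus>\<^bsub>Q\<^esub> x" if xy: "x \<in> carrier Q" "y \<in> carrier Q" for x y
    proof -
      obtain u v where "u \<in> N" "v \<in> N" "x = K +> u" "y = K +> v" using xy unfolding Q_carrier by blast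
      then show ?thesis using a_comm[of u v] by (simp add: Q_add N.Icarr)
    qed
  qed
  show "(a \<oplus> b) \<odot>\<^bsub>Q\<^esub> x = a \<odot>\<^bsub>Q\<^esub> x \<oplus>\<^bsub>Q\<^esub> b \<odot>\<^bsub>Q\<^esub> x"
    if "a \<in> carrier R" "b \<in> carrier R" "x \<in> carrier Q" for a b x
    using that by (auto simp: Q_carrier Q_smult Q_add N.Icarr N.I_l_closed l_distr)
  show "a \<odot>\<^bsub>Q\<^esub> (x \<oplus>\<^bsub>Q\<^esub> y) = a \<odot>\<^bsub>Q\<^esub> x \<oplus>\<^bsub>Q\<^esub> a \<odot>\<^bsub>Q\<^esub> y"
    if "a \<in> carrier R" "x \<in> carrier Q" "y \<in> carrier Q" for a x y
    using that by (auto simp: Q_carrier Q_smult Q_add N.Icarr N.I_l_closed r_distr)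
  show "(a \<otimes> b) \<odot>\<^bsub>Q\<^esub> x = a \<odot>\<^bsub>Q\<^esub> (b \<odot>\<^bsub>Q\<^esub> x)"
    if "a \<in> carrier R" "b \<in> carrier R" "x \<in> carrier Q" for a b x
    using that by (auto simp: Q_carrier Q_smult N.Icarr N.I_l_closed m_assoc)
qed (auto simp: Q_carrier Q_smult N.Icarr N.I_l_closed)

sublocale Q: module R Q by (rule Q_module)

lemma Q_finsum:
  assumes "finite X" "\<And>i. i \<in> X \<Longrightarrow> f i \<in> N"
  shows "finsum Q (\<lambda>i. K +> f i) X = K +> finsum R f X"
  using assms
proof (induct X rule: finite_induct)
  case empty
  then show ?case using rcos_eq_zero_iff[of \<zero>] by (simp add: Q_zero)
next
  case (insert i X)
  have "finsum R f (insert i X) = f i \<oplus> finsum R f X"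
    using insert by (intro finsum_insert) (auto simp: N.Icarr)
  moreover have "finsum Q (\<lambda>i. K +> f i) (insert i X) = (K +> f i) \<oplus>\<^bsub>Q\<^esub> finsum Q (\<lambda>i. K +> f i) X"
    using insert by (intro Q.finsum_insert) (auto simp: Q_carrier)
  ultimately show ?case using insert N.finsum_mem[of X f] by (simp add: Q_add)
qed

end

text \<open>Applied with \<open>X\<close> the Rees algebra and \<open>S\<close> the fiber cone: the
  ring axioms are inherited along \<open>h\<close>, so none of them has to be verified on
  convolutions of cosets.\<close>

lemma cring_of_surj:
  assumes "cring R" and X: "X \<subseteq> carrier R" "\<zero>\<^bsub>R\<^esub> \<in> X" "\<one>\<^bsub>R\<^esub> \<in> X"
    "\<And>x. x \<in> X \<Longrightarrow> \<ominus>\<^bsub>R\<^esub> x \<in> X"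
    "\<And>x y. x \<in> X \<Longrightarrow> y \<in> X \<Longrightarrow> x \<oplus>\<^bsub>R\<^esub> y \<in> X"
    "\<And>x y. x \<in> X \<Longrightarrow> y \<in> X \<Longrightarrow> x \<otimes>\<^bsub>R\<^esub> y \<in> X"
    and h: "h ` X = carrier S" "h \<zero>\<^bsub>R\<^esub> = \<zero>\<^bsub>S\<^esub>" "h \<one>\<^bsub>R\<^esub> = \<one>\<^bsub>S\<^esub>"
    "\<And>x y. x \<in> X \<Longrightarrow> y \<in> X \<Longrightarrow> h (x \<oplus>\<^bsub>R\<^esub> y) = h x \<oplus>\<^bsub>S\<^esub> h y"
    "\<And>x y. x \<in> X \<Longrightarrow> y \<in> X \<Longrightarrow> h (x \<otimes>\<^bsub>R\<^esub> y) = h x \<otimes>\<^bsub>S\<^esub> h y"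
  shows "cring S"
proof -
  interpret R: cring R by fact
  have c: "x \<in> carrier R" if "x \<in> X" for x using that X by blast
  have S: "x \<in> carrier S \<longleftrightarrow> (\<exists>y\<in>X. x = h y)" for x using h(1) by blast
  note hom = h(4,5)[symmetric]
  show ?thesis
  proof (rule cringI)
    show "abelian_group S"
    proof (rule abelian_groupI)
      fix x assume "x \<in> carrier S"
      then obtain y where y: "y \<in> X" "x = h y" using S by blast
      have "h (\<ominus>\<^bsub>R\<^esub> y) \<oplus>\<^bsub>S\<^esub> x = \<zero>\<^bsub>S\<^esub>"
        using y X by (simp add: hom R.l_neg c h(2))
      then show "\<exists>y\<in>carrier S. y \<oplus>\<^bsub>S\<^esub> x = \<zero>\<^bsub>S\<^esub>" using S X(4) y by blast
    next
      show "\<zero>\<^bsub>S\<^esub> \<in> carrier S" unfolding S using X(2) h(2) by metis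
      show "x \<oplus>\<^bsub>S\<^esub> y = y \<oplus>\<^bsub>S\<^esub> x" if "x \<in> carrier S" "y \<in> carrier S" for x y
        using that R.a_comm[OF c c] unfolding S by (metis h(4))
    qed (auto simp: S hom h(2)[symmetric] X c R.a_assoc)
    show "comm_monoid S"
    proof (rule comm_monoidI)
      show "\<one>\<^bsub>S\<^esub> \<in> carrier S" unfolding S using X(3) h(3) by metis
      show "x \<otimes>\<^bsub>S\<^esub> y = y \<otimes>\<^bsub>S\<^esub> x" if "x \<in> carrier S" "y \<in> carrier S" for x y
        using that R.m_comm[OF c c] unfolding S by (metis h(5))
    qed (auto simp: S hom h(3)[symmetric] X c R.m_assoc)
  qed (auto simp: S hom X c R.l_distr)
qed

subsection \<open>The fiber cone\<close>

locale local_filtration = cring A for A (structure) + fixes m :: "'a set" and I :: "nat \<Rightarrow> 'a set"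
  assumes loc: "local_ring A m" and filt: "filtration A I"
begin

sublocale m: local_cring m A
  using loc is_cring unfolding local_ring_def
  by (intro local_cring.intro local_cring_axioms.intro) (simp_all add: local_ring_def)

lemma I_ideal: "ideal (I n) A"
  using filt unfolding filtration_def by blast

sublocale I: ideal "I n" A for n by (rule I_ideal)

lemma I_0: "I 0 = carrier A"
  using filt unfolding filtration_def by blast

lemma I_antimono: "n \<le> k \<Longrightarrow> I k \<subseteq> I n"
  by (rule lift_Suc_antimono_le[of I]) (use filt in \<open>auto simp: filtration_def\<close>)

lemma I_mult: "x \<in> I i \<Longrightarrow> y \<in> I j \<Longrightarrow> x \<otimes> y \<in> I (i + j)"
  using filt ideal_prod.prod[of x "I i" y "I j" A] unfolding filtration_def by blast

lemma I_pow: "x \<in> I i \<Longrightarrow> x [^] (n::nat) \<in> I (n * i)"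
proof (induct n)
  case (Suc n) then show ?case using I_mult[of "x [^] n" "n * i" x i] by (simp add: add.commute)
qed (simp add: I_0)

lemma unit_iff: "x \<in> carrier A \<Longrightarrow> x \<in> Units A \<longleftrightarrow> x \<notin> m"
proof
  assume "x \<in> carrier A" "x \<in> Units A"
  then have "inv x \<otimes> x = \<one>" "inv x \<in> carrier A" by simp_all
  then show "x \<notin> m" using m.I_l_closed[of x "inv x"] m.one_imp_carrier m.I_notcarr by auto
qed (use local_ring_nonunit[OF loc] in blast)

abbreviation "M n \<equiv> m \<cdot> I n"

lemma M_ideal: "ideal (M n) A"
  by (intro ideal_prod_is_ideal m.is_ideal I_ideal)

sublocale M: ideal "M n" A for n by (rule M_ideal)

lemma M_sub_I: "M n \<subseteq> I n"
  using ideal_prod_inter[OF m.is_ideal I_ideal] by blast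

lemma M_0: "M 0 = m"
  unfolding I_0 using ideal_prod_one m.is_ideal by blast

lemma M_mult: "x \<in> I i \<Longrightarrow> y \<in> M j \<Longrightarrow> x \<otimes> y \<in> M (i + j)"
  using ideal_prod_lmult[OF m.is_ideal I_ideal[of j] _ _ I_mult] I.Icarr by blast

lemma M_mult': "y \<in> M j \<Longrightarrow> x \<in> I i \<Longrightarrow> y \<otimes> x \<in> M (j + i)"
  using M_mult[of x i y j] by (simp add: m_comm M.Icarr I.Icarr add.commute)

sublocale comp: ideal_pair "I n" "M n" A for n
  by unfold_locales (rule M_sub_I)

abbreviation "F \<equiv> fiber_cone A m I"

lemma F_component: "fiber_component A m I n = ideal_quotient A (I n) (M n)"
  unfolding fiber_component_def by simp

sublocale U: UP_cring A "UP A" by unfold_locales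

text \<open>The Rees algebra, as a set of polynomials over \<open>A\<close>; its elements serve as
  representatives of the elements of the fiber cone.\<close>

definition "rees = {p \<in> carrier (UP A). \<forall>n. coeff (UP A) p n \<in> I n}"

text \<open>The reduction map from the Rees algebra onto the fiber cone.\<close>

definition "form p = (\<lambda>n. M n +> coeff (UP A) p n)"

lemma rees_carrier: "p \<in> rees \<Longrightarrow> p \<in> carrier (UP A)"
  unfolding rees_def by simp

lemma rees_coeff: "p \<in> rees \<Longrightarrow> coeff (UP A) p n \<in> I n"
  unfolding rees_def by simp

lemma rees_closed:
  "\<zero>\<^bsub>UP A\<^esub> \<in> rees" "\<one>\<^bsub>UP A\<^esub> \<in> rees"
  "p \<in> rees \<Longrightarrow> \<ominus>\<^bsub>UP A\<^esub> p \<in> rees"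
  "p \<in> rees \<Longrightarrow> q \<in> rees \<Longrightarrow> p \<oplus>\<^bsub>UP A\<^esub> q \<in> rees"
  "p \<in> rees \<Longrightarrow> q \<in> rees \<Longrightarrow> p \<otimes>\<^bsub>UP A\<^esub> q \<in> rees"
proof -
  show "p \<otimes>\<^bsub>UP A\<^esub> q \<in> rees" if "p \<in> rees" "q \<in> rees"
  proof -
    have "coeff (UP A) p i \<otimes> coeff (UP A) q (n - i) \<in> I n" if "i \<le> n" for i n
      using I_mult[OF rees_coeff rees_coeff, of p q i "n - i"] \<open>p \<in> rees\<close> \<open>q \<in> rees\<close> that by simp
    then show ?thesis using that by (auto simp: rees_def intro!: I.finsum_mem)
  qed
qed (auto simp: rees_def I_0)

lemma rees_monom: "a \<in> I n \<Longrightarrow> monom (UP A) a n \<in> rees"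
  unfolding rees_def by (auto simp: I.Icarr)

lemma rees_pow: "p \<in> rees \<Longrightarrow> p [^]\<^bsub>UP A\<^esub> (n::nat) \<in> rees"
  by (induct n) (simp_all add: rees_closed)

lemma coeff_monom_mult_if:
  assumes "c \<in> carrier A" "p \<in> carrier (UP A)"
  shows "coeff (UP A) (monom (UP A) c k \<otimes>\<^bsub>UP A\<^esub> p) n
    = (if k \<le> n then c \<otimes> coeff (UP A) p (n - k) else \<zero>)"
proof (cases "k \<le> n")
  case True
  then show ?thesis using U.coeff_monom_mult[OF assms, of k "n - k"] by simp
next
  case False
  have "(\<Oplus>i\<in>{..n}. (if k = i then c else \<zero>) \<otimes> coeff (UP A) p (n - i)) = (\<Oplus>i\<in>{..n}. \<zero>)"
    by (rule finsum_cong') (use False assms in auto)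
  then show ?thesis using False assms by simp
qed

lemma form_add:
  assumes "p \<in> rees" "q \<in> rees" shows "form (p \<oplus>\<^bsub>UP A\<^esub> q) = form p \<oplus>\<^bsub>F\<^esub> form q"
proof
  fix n
  show "form (p \<oplus>\<^bsub>UP A\<^esub> q) n = (form p \<oplus>\<^bsub>F\<^esub> form q) n"
    unfolding form_def fiber_cone_def F_component
    using assms by (simp add: comp.Q_add rees_coeff rees_carrier)
qed

lemma form_mult:
  assumes "p \<in> rees" "q \<in> rees" shows "form (p \<otimes>\<^bsub>UP A\<^esub> q) = form p \<otimes>\<^bsub>F\<^esub> form q"
proof
  fix n
  let ?p = "coeff (UP A) p" and ?q = "coeff (UP A) q"
  have mem: "?p i \<otimes> ?q (n - i) \<in> I n" if "i \<le> n" for i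
    using I_mult[OF rees_coeff rees_coeff, of p q i "n - i"] assms that by simp
  \<comment> \<open>\<open>rcoset_mult\<close> is a union over all pairs of representatives. It is a
    single coset because a change of representatives alters the product by
    \<open>k \<otimes> y \<oplus> k \<otimes> l \<oplus> x \<otimes> l\<close>, each term of which
    lies in \<open>M n\<close>.\<close>
  have rc: "rcoset_mult A (M n) (M i +> x) (M (n - i) +> y) = M n +> (x \<otimes> y)"
    if i: "i \<le> n" and xy: "x \<in> I i" "y \<in> I (n - i)" for i x y
  proof -
    have eq: "M n +> (x' \<otimes> y') = M n +> (x \<otimes> y)" if x'y': "x' \<in> M i +> x" "y' \<in> M (n - i) +> y" for x' y'
    proof -
      obtain k where k: "k \<in> M i" "x' = k \<oplus> x" using x'y' unfolding a_r_coset_def' by blast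
      obtain l where l: "l \<in> M (n - i)" "y' = l \<oplus> y" using x'y' unfolding a_r_coset_def' by blast
      have c: "x \<in> carrier A" "y \<in> carrier A" "k \<in> carrier A" "l \<in> carrier A"
        using xy k l I.Icarr M.Icarr by blast+
      have "k \<otimes> y \<in> M n" "k \<otimes> l \<in> M n" "x \<otimes> l \<in> M n"
        using M_mult'[OF k(1) xy(2)] M_mult[OF xy(1) l(1)] M_mult'[OF k(1), of l "n - i"] l M_sub_I i by auto
      moreover have "x' \<otimes> y' \<ominus> x \<otimes> y = k \<otimes> y \<oplus> k \<otimes> l \<oplus> x \<otimes> l"
        unfolding k l using c by algebra
      ultimately have "x' \<otimes> y' \<ominus> x \<otimes> y \<in> M n" by simp
      then show ?thesis using M.rcos_eq_iff[of "x' \<otimes> y'" "x \<otimes> y" n] c k l by simp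
    qed
    have "x \<in> M i +> x" "y \<in> M (n - i) +> y" using xy M.a_rcos_self I.Icarr by blast+
    then have ne: "M i +> x \<noteq> {}" "M (n - i) +> y \<noteq> {}" by blast+
    show ?thesis unfolding rcoset_mult_def
      by (intro SUP_eq_const ne eq)
  qed
  have "(form p \<otimes>\<^bsub>F\<^esub> form q) n
     = (\<Oplus>\<^bsub>ideal_quotient A (I n) (M n)\<^esub>i\<in>{..n}. rcoset_mult A (M n) (form p i) (form q (n - i)))"
    unfolding fiber_cone_def F_component by simp
  also have "\<dots> = (\<Oplus>\<^bsub>ideal_quotient A (I n) (M n)\<^esub>i\<in>{..n}. M n +> (?p i \<otimes> ?q (n - i)))"
    by (rule comp.Q.finsum_cong')
      (use mem rc rees_coeff assms in \<open>auto simp: form_def comp.Q_carrier\<close>)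
  also have "\<dots> = M n +> (\<Oplus>i\<in>{..n}. ?p i \<otimes> ?q (n - i))"
    by (rule comp.Q_finsum) (use mem in auto)
  finally show "form (p \<otimes>\<^bsub>UP A\<^esub> q) n = (form p \<otimes>\<^bsub>F\<^esub> form q) n"
    unfolding form_def using assms by (simp add: rees_carrier)
qed

lemma F_zero: "\<zero>\<^bsub>F\<^esub> = (\<lambda>n. M n)"
  unfolding fiber_cone_def F_component by (simp add: comp.Q_zero)

lemma M_rcos_zero: "M n +> \<zero> = M n"
  using M.rcos_eq_self_iff[of \<zero>] by simp

lemma form_zero: "form \<zero>\<^bsub>UP A\<^esub> = \<zero>\<^bsub>F\<^esub>"
  unfolding form_def F_zero by (simp add: M_rcos_zero)

lemma form_one: "form \<one>\<^bsub>UP A\<^esub> = \<one>\<^bsub>F\<^esub>"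
proof
  fix n show "form \<one>\<^bsub>UP A\<^esub> n = \<one>\<^bsub>F\<^esub> n"
    unfolding form_def fiber_cone_def F_component by (simp add: M_rcos_zero comp.Q_zero)
qed

lemma form_image: "form ` rees = carrier F"
proof
  have fin: "finite {n. form p n \<noteq> M n}" if p: "p \<in> rees" for p
  proof -
    have "form p n = M n" if "deg A p < n" for n
      unfolding form_def using U.deg_aboveD[OF that rees_carrier[OF p]] M_rcos_zero by simp
    then have "{n. form p n \<noteq> M n} \<subseteq> {..deg A p}" using not_le by blast
    then show ?thesis using finite_subset by blast
  qed
  then show "form ` rees \<subseteq> carrier F"
    unfolding fiber_cone_def F_component
    by (auto simp: comp.Q_carrier comp.Q_zero form_def dest: rees_coeff)
  show "carrier F \<subseteq> form ` rees"
  proof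
    fix f assume "f \<in> carrier F"
    then have f: "\<And>n. \<exists>x\<in>I n. f n = M n +> x" "finite {n. f n \<noteq> M n}"
      unfolding fiber_cone_def F_component by (auto simp: comp.Q_carrier comp.Q_zero)
    \<comment> \<open>Zero components receive the representative \<open>\<zero>\<close>, so that the
      chosen coefficients have finite support and form a polynomial.\<close>
    have "\<exists>x\<in>I n. f n = M n +> x \<and> (f n = M n \<longrightarrow> x = \<zero>)" for n
    proof (cases "f n = M n")
      case True then show ?thesis using M_rcos_zero I.zero_closed by metis
    next
      case False then show ?thesis using f(1)[of n] by blast
    qed
    then obtain c where c: "\<And>n. c n \<in> I n" "\<And>n. f n = M n +> c n" "\<And>n. f n = M n \<Longrightarrow> c n = \<zero>"
      by metis
    obtain b where b: "\<And>n. f n \<noteq> M n \<Longrightarrow> n \<le> b"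
      using f(2) finite_nat_set_iff_bounded_le by auto
    have "c \<in> up A"
    proof (rule mem_upI)
      show "c n \<in> carrier A" for n using c(1) I.Icarr by blast
      show "\<exists>n. bound \<zero> n c" using b c(3) by (intro exI[of _ b] bound.intro) (meson not_le)
    qed
    then have cc: "c \<in> carrier (UP A)" "\<And>n. coeff (UP A) c n = c n" unfolding UP_def by simp_all
    then have "c \<in> rees" unfolding rees_def using c by simp
    moreover have "f = form c" unfolding form_def using cc c by auto
    ultimately show "f \<in> form ` rees" by blast
  qed
qed

lemma form_closed [simp]: "p \<in> rees \<Longrightarrow> form p \<in> carrier F"
  using form_image by blast

lemma F_elem:
  assumes "f \<in> carrier F" obtains p where "p \<in> rees" "f = form p"
  using assms form_image by blast

lemma F_cring: "cring F"
proof (rule cring_of_surj[where h = form and X = rees, OF U.P.is_cring])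
  show "rees \<subseteq> carrier (UP A)" unfolding rees_def by blast
qed (simp_all add: rees_closed form_image form_zero form_one form_add form_mult)

sublocale F: cring F by (rule F_cring)

lemma form_eq_zero_iff:
  assumes "p \<in> rees"
  shows "form p = \<zero>\<^bsub>F\<^esub> \<longleftrightarrow> (\<forall>n. coeff (UP A) p n \<in> M n)"
  unfolding F_zero form_def fun_eq_iff using assms rees_coeff comp.rcos_eq_zero_iff by simp

lemma form_minus:
  assumes "p \<in> rees" shows "form (\<ominus>\<^bsub>UP A\<^esub> p) = \<ominus>\<^bsub>F\<^esub> form p"
proof -
  have "form (\<ominus>\<^bsub>UP A\<^esub> p) \<oplus>\<^bsub>F\<^esub> form p = \<zero>\<^bsub>F\<^esub>"
    using assms by (simp add: form_add[symmetric] rees_closed rees_carrier U.P.l_neg form_zero)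
  then show ?thesis using F.minus_equality assms rees_closed by simp
qed

lemma form_pow:
  assumes "p \<in> rees" shows "form (p [^]\<^bsub>UP A\<^esub> n) = form p [^]\<^bsub>F\<^esub> (n::nat)"
  by (induct n) (simp_all add: assms form_one form_mult rees_pow)

lemma initial_form_eq:
  assumes "a \<in> I 1" shows "initial_form A m I a = form (monom (UP A) a 1)"
proof
  fix n
  have "a \<in> carrier A" using assms I.Icarr by blast
  then show "initial_form A m I a n = form (monom (UP A) a 1) n"
    unfolding initial_form_def form_def F_component by (simp add: M_rcos_zero comp.Q_zero)
qed

text \<open>Induction on the degree: modulo \<open>M n\<close>, the coefficient of the product in
  degree \<open>n\<close> is the unit \<open>coeff (UP A) p 0\<close> times that of
  \<open>q\<close>, the other terms involving lower coefficients of \<open>q\<close>. Hence elements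
  outside the irrelevant ideal are nonzerodivisors.\<close>

lemma form_mult_eq_zero:
  assumes p: "p \<in> rees" "coeff (UP A) p 0 \<notin> m" and q: "q \<in> rees"
    and zero: "form p \<otimes>\<^bsub>F\<^esub> form q = \<zero>\<^bsub>F\<^esub>"
  shows "form q = \<zero>\<^bsub>F\<^esub>"
proof -
  let ?p = "coeff (UP A) p" and ?q = "coeff (UP A) q"
  have c: "?p i \<in> carrier A" "?q i \<in> carrier A" for i using p q rees_carrier by auto
  have "?q n \<in> M n" for n
  proof (induct n rule: less_induct)
    case (less n)
    have "?p i \<otimes> ?q (n - i) \<in> M n" if "i \<in> {0<..n}" for i
      using M_mult[OF rees_coeff[OF p(1)] less[of "n - i"], of i] that by simp
    then have rest: "(\<Oplus>i\<in>{0<..n}. ?p i \<otimes> ?q (n - i)) \<in> M n" by (intro M.finsum_mem) auto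
    have "{..n} = insert 0 {0<..n}" by auto
    then have "coeff (UP A) (p \<otimes>\<^bsub>UP A\<^esub> q) n = (\<Oplus>i\<in>insert 0 {0<..n}. ?p i \<otimes> ?q (n - i))"
      using p q by (simp add: rees_carrier)
    also have "\<dots> = ?p 0 \<otimes> ?q n \<oplus> (\<Oplus>i\<in>{0<..n}. ?p i \<otimes> ?q (n - i))"
      using c by (subst finsum_insert) auto
    finally have eq: "coeff (UP A) (p \<otimes>\<^bsub>UP A\<^esub> q) n = ?p 0 \<otimes> ?q n \<oplus> (\<Oplus>i\<in>{0<..n}. ?p i \<otimes> ?q (n - i))" .
    have "coeff (UP A) (p \<otimes>\<^bsub>UP A\<^esub> q) n \<in> M n"
      using form_eq_zero_iff[OF rees_closed(5)[OF p(1) q]] form_mult[OF p(1) q] zero by simp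
    moreover have "?p 0 \<otimes> ?q n = coeff (UP A) (p \<otimes>\<^bsub>UP A\<^esub> q) n \<ominus> (\<Oplus>i\<in>{0<..n}. ?p i \<otimes> ?q (n - i))"
      unfolding eq using c M.Icarr[OF rest] by (simp add: a_minus_def a_assoc r_neg)
    ultimately have "?p 0 \<otimes> ?q n \<in> M n" using rest unfolding a_minus_def by simp
    then show ?case using m.unit_mult_mem[OF M_ideal c(1) p(2) c(2)] by blast
  qed
  then show ?thesis using form_eq_zero_iff[OF q] by blast
qed

text \<open>The irrelevant ideal of the fiber cone: since \<open>M 0 = m\<close>, its elements are
  those whose component in degree 0 vanishes.\<close>

definition "irr = form ` {p \<in> rees. coeff (UP A) p 0 \<in> m}"

lemma form_mem_irr_iff:
  assumes "p \<in> rees" shows "form p \<in> irr \<longleftrightarrow> coeff (UP A) p 0 \<in> m"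
proof
  assume "form p \<in> irr"
  then obtain q where q: "q \<in> rees" "coeff (UP A) q 0 \<in> m" "form p = form q" unfolding irr_def by blast
  then have "m +> coeff (UP A) p 0 = m +> coeff (UP A) q 0"
    unfolding form_def fun_eq_iff using M_0 by metis
  moreover have "m +> coeff (UP A) q 0 = m"
    using q m.rcos_eq_self_iff m.Icarr by blast
  ultimately show "coeff (UP A) p 0 \<in> m"
    using m.rcos_eq_self_iff assms rees_carrier by simp
qed (use assms in \<open>auto simp: irr_def\<close>)

lemma irr_ideal: "ideal irr F"
proof (rule idealI[OF F.ring_axioms])
  have mult: "x \<otimes>\<^bsub>F\<^esub> a \<in> irr" if xa: "a \<in> irr" "x \<in> carrier F" for a x
  proof -
    obtain p where p: "p \<in> rees" "coeff (UP A) p 0 \<in> m" "a = form p" using xa unfolding irr_def by blast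
    obtain q where q: "q \<in> rees" "x = form q" using xa F_elem by metis
    have "coeff (UP A) q 0 \<otimes> coeff (UP A) p 0 \<in> m" using p q rees_carrier by (intro m.I_l_closed) auto
    then have "coeff (UP A) (q \<otimes>\<^bsub>UP A\<^esub> p) 0 \<in> m" using p q by (simp add: rees_carrier)
    then show ?thesis using p q form_mem_irr_iff[of "q \<otimes>\<^bsub>UP A\<^esub> p"] by (simp add: form_mult rees_closed)
  qed
  have irr_sub: "irr \<subseteq> carrier F" unfolding irr_def by auto
  show "x \<otimes>\<^bsub>F\<^esub> a \<in> irr" "a \<otimes>\<^bsub>F\<^esub> x \<in> irr" if "a \<in> irr" "x \<in> carrier F" for a x
    using mult[OF that] F.m_comm[of a x] that irr_sub by auto
  show "subgroup irr (add_monoid F)"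
  proof (rule F.add.subgroupI)
    show "irr \<subseteq> carrier F" by fact
    have "form \<zero>\<^bsub>UP A\<^esub> \<in> irr" using form_mem_irr_iff[of "\<zero>\<^bsub>UP A\<^esub>"] rees_closed by simp
    then show "irr \<noteq> {}" by blast
    show "\<ominus>\<^bsub>F\<^esub> x \<in> irr" if x: "x \<in> irr" for x
    proof -
      obtain p where p: "p \<in> rees" "coeff (UP A) p 0 \<in> m" "x = form p" using x unfolding irr_def by blast
      then show ?thesis using form_mem_irr_iff[of "\<ominus>\<^bsub>UP A\<^esub> p"]
        by (simp add: rees_closed form_minus rees_carrier)
    qed
    show "x \<oplus>\<^bsub>F\<^esub> y \<in> irr" if xy: "x \<in> irr" "y \<in> irr" for x y
    proof -
      obtain p where p: "p \<in> rees" "coeff (UP A) p 0 \<in> m" "x = form p" using xy unfolding irr_def by blast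
      obtain q where q: "q \<in> rees" "coeff (UP A) q 0 \<in> m" "y = form q" using xy unfolding irr_def by blast
      show ?thesis using p q form_mem_irr_iff[of "p \<oplus>\<^bsub>UP A\<^esub> q"]
        by (simp add: rees_closed form_add rees_carrier)
    qed
  qed
qed

lemma irr_maximalideal: "maximalideal irr F"
proof (rule maximalidealI[OF irr_ideal])
  interpret irr: ideal irr F by (rule irr_ideal)
  have "\<one> \<notin> m" using m.one_imp_carrier m.I_notcarr by blast
  then have "\<one>\<^bsub>F\<^esub> \<notin> irr"
    using form_mem_irr_iff[of "\<one>\<^bsub>UP A\<^esub>"] rees_closed by (simp add: form_one)
  then show "carrier F \<noteq> irr" by blast
  fix J assume J: "ideal J F" "irr \<subseteq> J" "J \<subseteq> carrier F"
  interpret J: ideal J F by fact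
  show "J = irr \<or> J = carrier F"
  proof (rule disjCI)
    assume "J \<noteq> carrier F"
    have "J \<subseteq> irr"
    proof
      fix x assume x: "x \<in> J"
      then obtain p where p: "p \<in> rees" "x = form p" using F_elem J.Icarr by metis
      show "x \<in> irr"
      proof (rule ccontr)
        assume "x \<notin> irr"
        then have u: "coeff (UP A) p 0 \<notin> m" using p form_mem_irr_iff by blast
        let ?u = "coeff (UP A) p 0"
        have uc: "?u \<in> carrier A" using p rees_carrier by simp
        have uu: "?u \<in> Units A" using u uc unit_iff by blast
        have ic: "inv ?u \<in> carrier A" "inv ?u \<otimes> ?u = \<one>" using uu by auto
        let ?v = "monom (UP A) (inv ?u) 0"
        have v: "?v \<in> rees" using ic I_0 by (intro rees_monom) auto
        \<comment> \<open>Dividing by the unit in degree 0 and subtracting one gives an element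
          without component in degree 0. It lies in \<open>irr\<close>, hence in \<open>J\<close>,
          and so \<open>J\<close> contains one.\<close>
        have w: "(?v \<otimes>\<^bsub>UP A\<^esub> p) \<oplus>\<^bsub>UP A\<^esub> (\<ominus>\<^bsub>UP A\<^esub> \<one>\<^bsub>UP A\<^esub>) \<in> rees" (is "?w \<in> rees")
          using v p by (simp add: rees_closed)
        have "coeff (UP A) ?w 0 = inv ?u \<otimes> ?u \<oplus> (\<ominus> \<one>)"
          using coeff_monom_mult_if[OF ic(1) rees_carrier[OF p(1)], of 0 0]
            rees_carrier[OF v] rees_carrier[OF p(1)]
          by (simp del: U.coeff_mult)
        then have "coeff (UP A) ?w 0 \<in> m" using ic by (simp add: r_neg)
        then have wJ: "form ?w \<in> J" using form_mem_irr_iff[OF w] J(2) by blast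
        have vJ: "form (?v \<otimes>\<^bsub>UP A\<^esub> p) \<in> J" using x p v by (simp add: form_mult J.I_l_closed)
        have vp: "?v \<otimes>\<^bsub>UP A\<^esub> p \<in> rees" using v p by (simp add: rees_closed)
        have "form ?w = form (?v \<otimes>\<^bsub>UP A\<^esub> p) \<oplus>\<^bsub>F\<^esub> (\<ominus>\<^bsub>F\<^esub> \<one>\<^bsub>F\<^esub>)"
          using vp by (simp only: form_add rees_closed form_minus form_one)
        then have "\<one>\<^bsub>F\<^esub> = form (?v \<otimes>\<^bsub>UP A\<^esub> p) \<oplus>\<^bsub>F\<^esub> (\<ominus>\<^bsub>F\<^esub> form ?w)"
          using F.one_closed form_closed[OF vp] form_closed[OF w]
          by (simp add: F.minus_add F.minus_minus F.r_neg2)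
        also have "\<dots> \<in> J" using wJ vJ by (intro J.a_closed J.a_inv_closed)
        finally show False using J.one_imp_carrier \<open>J \<noteq> carrier F\<close> by blast
      qed
    qed
    then show "J = irr" using J(2) by blast
  qed
qed

end

subsection \<open>Chains of ideals and length\<close>

text \<open>A chain with \<open>n\<close> strict steps that ends exactly at \<open>T\<close> but
  starts at any ideal containing \<open>K\<close>. Leaving the bottom free makes it easy to enlarge
  the top and to concatenate chains; \<open>module_length_eq\<close> recovers the length of the
  quotient.\<close>

inductive ideal_chain :: "('a, 'b) ring_scheme \<Rightarrow> 'a set \<Rightarrow> 'a set \<Rightarrow> nat \<Rightarrow> bool" for R K where
  base: "ideal T R \<Longrightarrow> K \<subseteq> T \<Longrightarrow> ideal_chain R K T 0"
| step: "ideal_chain R K T n \<Longrightarrow> T \<subset> T' \<Longrightarrow> ideal T' R \<Longrightarrow> ideal_chain R K T' (Suc n)"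

lemma ideal_chain_ideal: "ideal_chain R K T n \<Longrightarrow> ideal T R \<and> K \<subseteq> T"
  by (induct rule: ideal_chain.induct) auto

lemma ideal_chain_mono:
  assumes "ideal_chain R K T n" "T \<subseteq> T'" "ideal T' R"
  shows "ideal_chain R K T' n"
  using assms(1)
proof cases
  case base
  then show ?thesis using ideal_chain.base[of T' R K] assms by auto
next
  case (step T0 k)
  then show ?thesis using ideal_chain.step[of R K T0 k T'] assms by auto
qed

lemma ideal_chain_concat:
  assumes "ideal_chain R L N b" "ideal_chain R K L a"
  shows "ideal_chain R K N (a + b)"
  using assms(1)
proof (induct rule: ideal_chain.induct)
  case (base T) then show ?case using ideal_chain_mono assms(2) by auto
next
  case (step T n T') then show ?case using ideal_chain.step[of R K T "a + n" T'] by simp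
qed

lemma ideal_chain_fun:
  assumes "ideal_chain R K T n"
  shows "\<exists>L. (\<forall>i\<le>n. ideal (L i) R \<and> K \<subseteq> L i \<and> L i \<subseteq> T) \<and> (\<forall>i<n. L i \<subset> L (Suc i)) \<and> L n = T"
  using assms
proof (induct rule: ideal_chain.induct)
  case (base T)
  then show ?case by (intro exI[of _ "\<lambda>_. T"]) auto
next
  case (step T n T')
  then obtain L where L: "\<forall>i\<le>n. ideal (L i) R \<and> K \<subseteq> L i \<and> L i \<subseteq> T"
    "\<forall>i<n. L i \<subset> L (Suc i)" "L n = T" by blast
  have K: "K \<subseteq> T'" using L(1,3) step(3) by blast
  show ?case
  proof (intro exI[of _ "L(Suc n := T')"] conjI allI impI)
    fix i
    show "ideal ((L(Suc n := T')) i) R" "K \<subseteq> (L(Suc n := T')) i" "(L(Suc n := T')) i \<subseteq> T'"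
      if "i \<le> Suc n"
    proof -
      have "i = Suc n \<or> i \<le> n" using that by auto
      moreover have "L i \<subseteq> T'" if "i \<le> n" using L(1) step(3) that by blast
      ultimately show "ideal ((L(Suc n := T')) i) R" "K \<subseteq> (L(Suc n := T')) i"
        "(L(Suc n := T')) i \<subseteq> T'" using L(1) step(4) K by auto
    qed
    show "(L(Suc n := T')) i \<subset> (L(Suc n := T')) (Suc i)" if "i < Suc n"
      using L(2,3) step(3) that by (cases "i = n") auto
  qed simp
qed

lemma fun_ideal_chain:
  assumes "\<forall>i\<le>n. ideal (L i) R \<and> K \<subseteq> L i" "\<forall>i<n. L i \<subset> L (Suc i)"
  shows "ideal_chain R K (L n) n"
  using assms
proof (induct n)
  case 0 then show ?case by (auto intro: ideal_chain.base)
next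
  case (Suc n) then show ?case by (intro ideal_chain.step[of R K "L n"]) auto
qed

context cring
begin

lemma ideal_modular:
  fixes X X' L :: "'a set"
  assumes X: "ideal X R" "ideal X' R" "ideal L R" "X \<subseteq> X'"
    and eq: "X' \<inter> L \<subseteq> X" "X' \<subseteq> X <+> L"
  shows "X' \<subseteq> X"
proof
  interpret X: ideal X R by fact
  interpret X': ideal X' R by fact
  interpret L: ideal L R by fact
  fix x assume x: "x \<in> X'"
  then obtain y l where yl: "y \<in> X" "l \<in> L" "x = y \<oplus> l" using eq(2) unfolding set_add_def' by blast
  have c: "y \<in> carrier R" "l \<in> carrier R" using yl X.Icarr L.Icarr by auto
  have "l = x \<oplus> \<ominus> y" unfolding yl(3) using c by algebra
  moreover have "x \<oplus> \<ominus> y \<in> X'" using x yl X(4) by auto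
  ultimately have "l \<in> X" using eq(1) yl by auto
  then show "x \<in> X" using yl by simp
qed

text \<open>By the modular law in \<open>ideal_modular\<close>, each strict step of the chain stays
  strict after intersecting with \<open>L\<close> or after adding \<open>L\<close>; \<open>a\<close>
  and \<open>b\<close> count steps of these two kinds.\<close>

lemma ideal_chain_split:
  assumes "ideal_chain R K N n" "ideal L R" "K \<subseteq> L"
  shows "\<exists>a b. n \<le> a + b \<and> ideal_chain R K (N \<inter> L) a \<and> ideal_chain R L (N <+> L) b"
  using assms(1)
proof (induct rule: ideal_chain.induct)
  case (base T)
  have "L \<subseteq> T <+> L" by (rule add_ideals_upper[OF base(1) assms(2)])
  then show ?case
    using base assms i_intersect[of T L] add_ideals[of T L]
    by (intro exI[of _ "0::nat"]) (auto intro!: ideal_chain.base)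
next
  case (step T n T')
  then obtain a b where ab: "n \<le> a + b" "ideal_chain R K (T \<inter> L) a" "ideal_chain R L (T <+> L) b"
    by blast
  have T: "ideal T R" using ideal_chain_ideal step(1) by blast
  have i: "ideal (T' \<inter> L) R" "ideal (T' <+> L) R"
    using step assms i_intersect[of T' L] add_ideals[of T' L] by auto
  have sub: "T \<inter> L \<subseteq> T' \<inter> L" "T <+> L \<subseteq> T' <+> L" using step(3) unfolding set_add_def' by blast+
  show ?case
  proof (cases "T \<inter> L = T' \<inter> L")
    case False
    then have "ideal_chain R K (T' \<inter> L) (Suc a)" using ideal_chain.step[OF ab(2)] sub i by blast
    moreover have "ideal_chain R L (T' <+> L) b" using ideal_chain_mono[OF ab(3)] sub i by blast
    ultimately show ?thesis using ab(1) by (metis Suc_le_mono add_Suc)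
  next
    case True
    have "T' \<subseteq> T' <+> L" by (rule add_ideals_upper[OF step(4) assms(2)])
    then have "T <+> L \<noteq> T' <+> L" using ideal_modular[OF T step(4) assms(2)] True step(3) by blast
    then have "ideal_chain R L (T' <+> L) (Suc b)" using ideal_chain.step[OF ab(3)] sub i by blast
    moreover have "ideal_chain R K (T' \<inter> L) a" using ideal_chain_mono[OF ab(2)] sub i by blast
    ultimately show ?thesis using ab(1) by (metis Suc_le_mono add_Suc_right)
  qed
qed

end

definition ideal_length :: "('a, 'b) ring_scheme \<Rightarrow> 'a set \<Rightarrow> 'a set \<Rightarrow> enat" where
  "ideal_length R K N = Sup {enat n | n. ideal_chain R K N n}"

lemma ideal_length_ge: "ideal_chain R K N n \<Longrightarrow> enat n \<le> ideal_length R K N"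
  unfolding ideal_length_def by (rule Sup_upper) blast

lemma ideal_length_leI: "(\<And>n. ideal_chain R K N n \<Longrightarrow> n \<le> b) \<Longrightarrow> ideal_length R K N \<le> enat b"
  unfolding ideal_length_def by (rule Sup_least) auto

text \<open>A strictly monotone map on the ideals between the bounds carries chains to chains, which
  compares lengths without any homomorphism of modules.\<close>

lemma ideal_length_le_of_map:
  assumes N': "ideal N' R'"
    and f: "\<And>T. ideal T R \<Longrightarrow> K \<subseteq> T \<Longrightarrow> T \<subseteq> N \<Longrightarrow> ideal (f T) R' \<and> K' \<subseteq> f T \<and> f T \<subseteq> N'"
    and strict: "\<And>T T'. ideal T R \<Longrightarrow> ideal T' R \<Longrightarrow> K \<subseteq> T \<Longrightarrow> T \<subset> T' \<Longrightarrow> T' \<subseteq> N \<Longrightarrow> f T \<subset> f T'"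
  shows "ideal_length R K N \<le> ideal_length R' K' N'"
  unfolding ideal_length_def[of R]
proof (rule Sup_least, clarify)
  fix n assume ch: "ideal_chain R K N n"
  obtain L where L: "\<forall>i\<le>n. ideal (L i) R \<and> K \<subseteq> L i \<and> L i \<subseteq> N"
    "\<forall>i<n. L i \<subset> L (Suc i)" "L n = N"
    using ideal_chain_fun[OF ch] by (elim exE conjE) (rule that; assumption)
  have "\<forall>i\<le>n. ideal (f (L i)) R' \<and> K' \<subseteq> f (L i)" using L(1) f by blast
  moreover have "\<forall>i<n. f (L i) \<subset> f (L (Suc i))"
  proof (intro allI impI)
    fix i assume i: "i < n"
    then have "i \<le> n" "Suc i \<le> n" by simp_all
    then show "f (L i) \<subset> f (L (Suc i))" using strict[of "L i" "L (Suc i)"] L i by blast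
  qed
  ultimately have "ideal_chain R' K' (f (L n)) n" by (rule fun_ideal_chain)
  moreover have "f (L n) \<subseteq> N'" using f L by blast
  ultimately show "enat n \<le> ideal_length R' K' N'"
    using ideal_length_ge ideal_chain_mono N' by blast
qed

lemma ideal_length_attained:
  assumes "ideal_length R K N \<noteq> \<infinity>" "ideal N R" "K \<subseteq> N"
  obtains n where "ideal_length R K N = enat n" "ideal_chain R K N n"
proof -
  obtain l where l: "ideal_length R K N = enat l" using assms(1) by auto
  let ?S = "{n. ideal_chain R K N n}"
  have bd: "n \<le> l" if "n \<in> ?S" for n using ideal_length_ge[of R K N n] l that by simp
  then have fin: "finite ?S" using finite_nat_set_iff_bounded_le by blast
  have ne: "?S \<noteq> {}" using ideal_chain.base[OF assms(2,3)] by blast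
  have mem: "Max ?S \<in> ?S" using Max_in[OF fin ne] .
  then have "ideal_length R K N \<le> enat (Max ?S)" using fin by (intro ideal_length_leI) simp
  then have "ideal_length R K N = enat (Max ?S)" using ideal_length_ge[of R K N "Max ?S"] mem by (intro order_antisym) simp_all
  then show thesis using that mem by blast
qed

text \<open>One inequality comes from splitting a chain at \<open>L\<close>, the other from
  concatenating chains of maximal length, which exist when the lengths are finite.\<close>

lemma (in cring) ideal_length_additive:
  assumes "ideal K R" "ideal L R" "ideal N R" "K \<subseteq> L" "L \<subseteq> N"
  shows "ideal_length R K N = ideal_length R K L + ideal_length R L N"
proof (rule order_antisym)
  interpret N: ideal N R by fact
  have "enat n \<le> ideal_length R K L + ideal_length R L N" if n: "ideal_chain R K N n" for n
  proof -
    obtain a b where ab: "n \<le> a + b" "ideal_chain R K (N \<inter> L) a" "ideal_chain R L (N <+> L) b"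
      using ideal_chain_split[OF n assms(2,4)] by blast
    have "N <+> L \<subseteq> N" using assms(5) unfolding set_add_def' by auto
    then have "ideal_chain R L N b" using ideal_chain_mono[OF ab(3)] assms by blast
    moreover have "ideal_chain R K L a" using ab(2) assms(5) by (simp add: Int_absorb1)
    ultimately have "enat a + enat b \<le> ideal_length R K L + ideal_length R L N"
      by (intro add_mono ideal_length_ge)
    moreover have "enat n \<le> enat a + enat b" using ab(1) by simp
    ultimately show ?thesis by (rule order_trans[rotated])
  qed
  then show "ideal_length R K N \<le> ideal_length R K L + ideal_length R L N"
    unfolding ideal_length_def[of R K N] by (intro Sup_least) auto
  show "ideal_length R K L + ideal_length R L N \<le> ideal_length R K N"
  proof (cases "ideal_length R K N = \<infinity>")
    case False
    have "ideal_length R K L \<le> ideal_length R K N"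
      unfolding ideal_length_def[of R K L]
      by (intro Sup_least) (auto intro: ideal_length_ge ideal_chain_mono[OF _ assms(5,3)])
    moreover have "ideal_length R L N \<le> ideal_length R K N"
      unfolding ideal_length_def[of R L N]
    proof (intro Sup_least, clarify)
      fix n assume "ideal_chain R L N n"
      then have "ideal_chain R K N (0 + n)"
        using ideal_chain_concat ideal_chain.base[OF assms(2,4)] by metis
      then show "enat n \<le> ideal_length R K N" using ideal_length_ge by simp
    qed
    ultimately have fin: "ideal_length R K L \<noteq> \<infinity>" "ideal_length R L N \<noteq> \<infinity>"
      using False by (metis enat_ord_simps(5))+
    obtain a where a: "ideal_length R K L = enat a" "ideal_chain R K L a"
      using ideal_length_attained[OF fin(1) assms(2,4)] by blast
    obtain b where b: "ideal_length R L N = enat b" "ideal_chain R L N b"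
      using ideal_length_attained[OF fin(2) assms(3,5)] by blast
    show ?thesis
      using ideal_length_ge[OF ideal_chain_concat[OF b(2) a(2)]] a(1) b(1) by simp
  qed simp
qed

text \<open>Submodules of the quotient correspond to ideals between \<open>K\<close> and
  \<open>N\<close>. Strict monotonicity of \<open>up\<close> and \<open>down\<close> suffices to
  carry chains in both directions.\<close>

lemma (in ideal_pair) module_length_eq: "module_length R Q = ideal_length R K N"
proof -
  define up where "up H = {x \<in> N. K +> x \<in> H}" for H
  define down where "down T = {K +> x | x. x \<in> T}" for T
  have up: "ideal (up H) R \<and> K \<subseteq> up H \<and> up H \<subseteq> N" if H: "submodule H R Q" for H
  proof -
    note E = Q.submoduleE[OF H]
    have z: "K \<in> H"
      using subgroup.one_closed[OF submodule.axioms(1)[OF H]] by (simp add: Q_zero)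
    have "ideal (up H) R"
    proof (rule idealI[OF ring_axioms])
      have neg: "\<ominus> x \<in> up H" if "x \<in> up H" for x
      proof -
        have "K +> \<ominus> x = (\<ominus> \<one>) \<odot>\<^bsub>Q\<^esub> (K +> x)"
          using that Q_smult[of "\<ominus> \<one>" x] unfolding up_def by (simp add: l_minus N.Icarr)
        moreover have "(\<ominus> \<one>) \<odot>\<^bsub>Q\<^esub> (K +> x) \<in> H" using that E(4) unfolding up_def by simp
        ultimately show ?thesis using that unfolding up_def by simp
      qed
      show "subgroup (up H) (add_monoid R)"
      proof (rule add.subgroupI)
        show "up H \<subseteq> carrier R" unfolding up_def using N.Icarr by blast
        have "\<zero> \<in> up H" unfolding up_def using z rcos_eq_zero_iff[OF N.zero_closed] by simp
        then show "up H \<noteq> {}" by blast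
        show "x \<oplus> y \<in> up H" if "x \<in> up H" "y \<in> up H" for x y
          using that E(5)[of "K +> x" "K +> y"] unfolding up_def by (simp add: Q_add)
      qed (rule neg)
      show "x \<otimes> a \<in> up H" if "a \<in> up H" "x \<in> carrier R" for a x
        using that E(4)[of x "K +> a"] N.I_l_closed unfolding up_def by (simp add: Q_smult)
      then show "a \<otimes> x \<in> up H" if "a \<in> up H" "x \<in> carrier R" for a x
        using that m_comm[of a x] N.Icarr unfolding up_def by auto
    qed
    moreover have "K \<subseteq> up H"
    proof
      fix x assume "x \<in> K"
      moreover from this have "x \<in> N" using K_sub_N by blast
      ultimately show "x \<in> up H" using z rcos_eq_zero_iff[of x] unfolding up_def by simp
    qed
    ultimately show ?thesis unfolding up_def by blast
  qed
  have up_strict: "up H \<subset> up H'" if H: "submodule H R Q" "submodule H' R Q" "H \<subset> H'" for H H'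
  proof -
    obtain X where X: "X \<in> H'" "X \<notin> H" using H(3) by blast
    then obtain x where x: "x \<in> N" "X = K +> x" using Q.submoduleE(1)[OF H(2)] unfolding Q_carrier by blast
    then have "x \<in> up H'" "x \<notin> up H" using X unfolding up_def by auto
    moreover have "up H \<subseteq> up H'" using H(3) unfolding up_def by blast
    ultimately show ?thesis by blast
  qed
  have down: "submodule (down T) R Q" if T: "ideal T R" "K \<subseteq> T" "T \<subseteq> N" for T
  proof (rule Q.submoduleI)
    interpret T: ideal T R by fact
    show "down T \<subseteq> carrier Q" unfolding down_def Q_carrier using T by blast
    have "K = K +> \<zero>" using rcos_eq_zero_iff[OF N.zero_closed] by simp
    then show "\<zero>\<^bsub>Q\<^esub> \<in> down T" unfolding down_def Q_zero using T.zero_closed by blast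
    have dI: "K +> x \<in> down T" if "x \<in> T" for x using that unfolding down_def by blast
    show sm: "a \<odot>\<^bsub>Q\<^esub> X \<in> down T" if X: "a \<in> carrier R" "X \<in> down T" for a X
    proof -
      obtain x where x: "x \<in> T" "X = K +> x" using X unfolding down_def by blast
      then have "a \<odot>\<^bsub>Q\<^esub> X = K +> (a \<otimes> x)" using Q_smult[of a x] X T by blast
      then show ?thesis using dI[OF T.I_l_closed[OF x(1) X(1)]] by simp
    qed
    show "X \<oplus>\<^bsub>Q\<^esub> Y \<in> down T" if XY: "X \<in> down T" "Y \<in> down T" for X Y
    proof -
      obtain x where x: "x \<in> T" "X = K +> x" using XY unfolding down_def by blast
      obtain y where y: "y \<in> T" "Y = K +> y" using XY unfolding down_def by blast
      have "X \<oplus>\<^bsub>Q\<^esub> Y = K +> (x \<oplus> y)" using Q_add[of x y] x y T by blast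
      then show ?thesis using dI[OF T.a_closed[OF x(1) y(1)]] by simp
    qed
    show "\<ominus>\<^bsub>Q\<^esub> X \<in> down T" if X: "X \<in> down T" for X
    proof -
      have Xc: "X \<in> carrier Q" using X T(3) unfolding down_def Q_carrier by blast
      have "\<ominus>\<^bsub>Q\<^esub> X = (\<ominus> \<one>) \<odot>\<^bsub>Q\<^esub> X" using Q.smult_l_minus[OF one_closed Xc] Xc by simp
      then show ?thesis using sm[OF _ X, of "\<ominus> \<one>"] by simp
    qed
  qed
  have down_strict: "down T \<subset> down T'"
    if T: "ideal T R" "K \<subseteq> T" "T \<subset> T'" "T' \<subseteq> N" for T T'
  proof -
    interpret T: ideal T R by fact
    obtain x where x: "x \<in> T'" "x \<notin> T" using T(3) by blast
    have "K +> x \<notin> down T"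
    proof
      assume "K +> x \<in> down T"
      then obtain y where y: "y \<in> T" "K +> x = K +> y" unfolding down_def by blast
      have c: "x \<in> carrier R" "y \<in> carrier R" using x y T N.Icarr T.Icarr by blast+
      then have "x \<ominus> y \<in> T" using y(2) K.rcos_eq_iff T(2) by blast
      then have "(x \<ominus> y) \<oplus> y \<in> T" using y by simp
      moreover have "(x \<ominus> y) \<oplus> y = x" using c by algebra
      ultimately show False using x by simp
    qed
    moreover have "K +> x \<in> down T'" "down T \<subseteq> down T'" using x T unfolding down_def by blast+
    ultimately show ?thesis by blast
  qed
  have "(\<exists>L. (\<forall>i\<le>n. submodule (L i) R Q) \<and> (\<forall>i<n. L i \<subset> L (Suc i))) \<longleftrightarrow> ideal_chain R K N n" for n
  proof
    assume "\<exists>L. (\<forall>i\<le>n. submodule (L i) R Q) \<and> (\<forall>i<n. L i \<subset> L (Suc i))"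
    then obtain L where L: "\<forall>i\<le>n. submodule (L i) R Q" "\<forall>i<n. L i \<subset> L (Suc i)" by blast
    have "ideal_chain R K (up (L n)) n"
      by (rule fun_ideal_chain[of n "\<lambda>i. up (L i)"]) (use L up up_strict in auto)
    then show "ideal_chain R K N n" using ideal_chain_mono up L N.is_ideal by blast
  next
    assume ch: "ideal_chain R K N n"
    obtain L where L: "\<forall>i\<le>n. ideal (L i) R \<and> K \<subseteq> L i \<and> L i \<subseteq> N"
    "\<forall>i<n. L i \<subset> L (Suc i)" "L n = N"
      using ideal_chain_fun[OF ch] by (elim exE conjE) (rule that; assumption)
    show "\<exists>L. (\<forall>i\<le>n. submodule (L i) R Q) \<and> (\<forall>i<n. L i \<subset> L (Suc i))"
    proof (intro exI[of _ "\<lambda>i. down (L i)"] conjI allI impI)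
      show "submodule (down (L i)) R Q" if "i \<le> n" for i using down L(1) that by blast
      fix i assume i: "i < n"
      then have "i \<le> n" "Suc i \<le> n" by simp_all
      with L i have "ideal (L i) R" "K \<subseteq> L i" "L i \<subset> L (Suc i)" "L (Suc i) \<subseteq> N" by blast+
      then show "down (L i) \<subset> down (L (Suc i))" by (rule down_strict)
    qed
  qed
  then show ?thesis unfolding module_length_def ideal_length_def by simp
qed

subsection \<open>Generators over a local ring\<close>

context cring
begin

lemma colon_ideal:
  assumes "ideal T R" "a \<in> carrier R"
  shows "ideal {z \<in> carrier R. a \<otimes> z \<in> T} R"
proof (rule idealI[OF ring_axioms])
  interpret T: ideal T R by fact
  show "subgroup {z \<in> carrier R. a \<otimes> z \<in> T} (add_monoid R)"
  proof (rule add.subgroupI)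
    show "{z \<in> carrier R. a \<otimes> z \<in> T} \<noteq> {}" using assms(2) T.zero_closed by (metis (mono_tags, lifting) empty_iff mem_Collect_eq r_null zero_closed)
  qed (use assms in \<open>auto simp: r_distr r_minus\<close>)
  have "x \<otimes> z \<in> {z \<in> carrier R. a \<otimes> z \<in> T}"
    if "z \<in> {z \<in> carrier R. a \<otimes> z \<in> T}" "x \<in> carrier R" for z x
    using that assms T.I_l_closed[of "a \<otimes> z" x] by (simp add: m_lcomm)
  then show "x \<otimes> z \<in> {z \<in> carrier R. a \<otimes> z \<in> T}" "z \<otimes> x \<in> {z \<in> carrier R. a \<otimes> z \<in> T}"
    if "z \<in> {z \<in> carrier R. a \<otimes> z \<in> T}" "x \<in> carrier R" for z x
    using that m_comm[of z x] by auto
qed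

text \<open>The elements that \<open>a\<close> multiplies into \<open>T\<close> form an ideal, so
  generators suffice; this replaces expansions into linear combinations.\<close>

lemma Idl_mult_subset:
  assumes "ideal T R" "a \<in> carrier R" "X \<subseteq> carrier R" "\<And>x. x \<in> X \<Longrightarrow> a \<otimes> x \<in> T" "z \<in> Idl X"
  shows "a \<otimes> z \<in> T"
proof -
  have "X \<subseteq> {z \<in> carrier R. a \<otimes> z \<in> T}" using assms by blast
  then have "Idl X \<subseteq> {z \<in> carrier R. a \<otimes> z \<in> T}"
    using genideal_minimal[OF colon_ideal[OF assms(1,2)]] by blast
  then show ?thesis using assms(5) by blast
qed

lemma ideal_prod_subset:
  assumes "ideal T R" "\<And>i j. i \<in> J \<Longrightarrow> j \<in> K \<Longrightarrow> i \<otimes> j \<in> T"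
  shows "J \<cdot> K \<subseteq> T"
proof
  fix x assume "x \<in> J \<cdot> K"
  then show "x \<in> T"
    by (induct rule: ideal_prod.induct)
      (use assms additive_subgroup.a_closed[OF ideal.axioms(1)] in auto)
qed

lemma Idl_prod_Idl_subset:
  assumes "ideal T R" "X \<subseteq> carrier R" "G \<subseteq> carrier R" "\<And>x g. x \<in> X \<Longrightarrow> g \<in> G \<Longrightarrow> x \<otimes> g \<in> T"
  shows "(Idl X) \<cdot> (Idl G) \<subseteq> T"
proof (rule ideal_prod_subset[OF assms(1)])
  fix i j assume ij: "i \<in> Idl X" "j \<in> Idl G"
  have c: "i \<in> carrier R" using ij genideal_ideal[OF assms(2)] ideal.Icarr by metis
  have "i \<otimes> g \<in> T" if g: "g \<in> G" for g
  proof -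
    have gc: "g \<in> carrier R" using g assms(3) by blast
    have "g \<otimes> i \<in> T"
      by (rule Idl_mult_subset[OF assms(1) gc assms(2) _ ij(1)])
        (use assms(2,4) g gc m_comm[of g] in auto)
    then show ?thesis using m_comm[OF gc c] by simp
  qed
  then show "i \<otimes> j \<in> T" using Idl_mult_subset[OF assms(1) c assms(3) _ ij(2)] by blast
qed

lemma Idl_insert_subset:
  assumes "X \<subseteq> carrier R" "u \<in> carrier R"
  shows "Idl (insert u X) \<subseteq> Idl X <+> PIdl u"
proof (rule genideal_minimal)
  note X = genideal_ideal[OF assms(1)]
  show "ideal (Idl X <+> PIdl u) R" "insert u X \<subseteq> Idl X <+> PIdl u"
    using ideal_add_PIdl[OF X assms(2)] genideal_self[OF assms(1)] by auto
qed

end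

section \<open>Linear algebra over the residue field and Nakayama's lemma\<close>

context local_cring
begin

text \<open>As \<open>m\<close> multiplies \<open>u\<close> into \<open>L\<close>, an ideal strictly
  above \<open>L\<close> and inside \<open>L <+> PIdl u\<close> contains
  \<open>c \<otimes> u\<close> for a unit \<open>c\<close>, hence \<open>u\<close> itself; no room
  is left for a second step.\<close>

lemma ideal_chain_cyclic:
  fixes N L :: "'a set"
  assumes L: "ideal L R" "u \<in> carrier R" "\<And>c. c \<in> m \<Longrightarrow> c \<otimes> u \<in> L"
    and N: "N \<subseteq> L <+> PIdl u" and ch: "ideal_chain R L N n"
  shows "n \<le> 1"
proof (rule ccontr)
  assume "\<not> n \<le> 1"
  then obtain k where "n = Suc (Suc k)" by (metis One_nat_def le_SucI le0 not0_implies_Suc order_refl)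
  then have "ideal_chain R L N (Suc (Suc k))" using ch by simp
  then obtain T1 where T1: "ideal_chain R L T1 (Suc k)" "T1 \<subset> N"
    by cases blast+
  from T1(1) obtain T where "ideal_chain R L T k" "T \<subset> T1" "ideal T1 R"
    by cases blast+
  note T = this T1(2)
  have "L \<subset> T1" using ideal_chain_ideal[OF T(1)] T(2) by blast
  then obtain t where t: "t \<in> T1" "t \<notin> L" by blast
  interpret L: ideal L R by fact
  interpret T1: ideal T1 R by fact
  obtain l c where lc: "l \<in> L" "c \<in> carrier R" "t = l \<oplus> c \<otimes> u"
    using t T(4) N mem_add_PIdl[OF L(1,2), of t] by blast
  have cm: "c \<notin> m" using lc t L(3) by auto
  have "c \<otimes> u = t \<oplus> \<ominus> l" unfolding lc(3) using lc L(2) L.Icarr[OF lc(1)] by algebra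
  moreover have "l \<in> T1" using \<open>L \<subset> T1\<close> lc by blast
  ultimately have "c \<otimes> u \<in> T1" using t by simp
  then have "u \<in> T1" using unit_mult_mem[OF T(3) lc(2) cm L(2)] by blast
  then have "L <+> PIdl u \<subseteq> T1"
    using \<open>L \<subset> T1\<close> T1.I_l_closed mem_add_PIdl[OF L(1,2)] T1.a_closed by (auto 0 3)
  then show False using N T(4) by blast
qed

text \<open>The bound on the dimension of a vector space over the residue field by the number of its
  generators. Splitting the chain at the ideal generated without \<open>x\<close> peels off one
  generator, which accounts for at most one step.\<close>

lemma ideal_chain_le_card:
  assumes "finite X" "X \<subseteq> carrier R" "ideal K R" "\<And>c x. c \<in> m \<Longrightarrow> x \<in> X \<Longrightarrow> c \<otimes> x \<in> K"
    and "ideal_chain R K N n" "N \<subseteq> Idl (K \<union> X)"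
  shows "n \<le> card X"
  using assms
proof (induct X arbitrary: N n rule: finite_induct)
  case empty
  then have "N \<subseteq> K" using genideal_minimal[OF empty(2), of K] by auto
  from empty(4) this show ?case
    by cases (auto dest!: ideal_chain_ideal)
next
  case (insert x X)
  have c: "K \<union> X \<subseteq> carrier R" "x \<in> carrier R"
    using insert(4) ideal.Icarr[OF insert(5)] by auto
  let ?L = "Idl (K \<union> X)"
  have L: "ideal ?L R" "K \<subseteq> ?L" using genideal_ideal[OF c(1)] genideal_self[OF c(1)] by auto
  obtain a b where ab: "n \<le> a + b" "ideal_chain R K (N \<inter> ?L) a" "ideal_chain R ?L (N <+> ?L) b"
    using ideal_chain_split[OF insert(7) L] by blast
  have "a \<le> card X" by (rule insert(3)[OF _ insert(5) _ ab(2)]) (use insert in auto)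
  moreover have "b \<le> 1"
  proof (rule ideal_chain_cyclic[OF L(1) c(2) _ _ ab(3)])
    show "c \<otimes> x \<in> ?L" if "c \<in> m" for c using insert(6)[OF that] L by auto
    interpret W: ideal "?L <+> PIdl x" R using ideal_add_PIdl[OF L(1) c(2)] by blast
    have "Idl (insert x (K \<union> X)) \<subseteq> ?L <+> PIdl x" using Idl_insert_subset[OF c] .
    then have "N \<subseteq> ?L <+> PIdl x" using insert(8) by simp
    then show "N <+> ?L \<subseteq> ?L <+> PIdl x"
      using ideal_add_PIdl[OF L(1) c(2)] unfolding set_add_def'[of R N] by auto
  qed
  ultimately show ?case using ab(1) insert by simp
qed

text \<open>Linear dependence: otherwise \<open>K\<close> together with longer and longer initial
  segments of \<open>v\<close> would generate a strict chain with \<open>n + 1\<close> steps, more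
  than the \<open>card X\<close> generators allow.\<close>

lemma exists_dependent:
  assumes X: "finite X" "X \<subseteq> carrier R" "ideal K R" "\<And>c x. c \<in> m \<Longrightarrow> x \<in> X \<Longrightarrow> c \<otimes> x \<in> K"
    and v: "\<And>i. i \<le> n \<Longrightarrow> v i \<in> Idl (K \<union> X)" and n: "card X \<le> n"
  shows "\<exists>i\<le>n. v i \<in> Idl (K \<union> v ` {..<i})"
proof (rule ccontr)
  assume no: "\<not> ?thesis"
  have KX: "K \<union> X \<subseteq> carrier R" using X(2) ideal.Icarr[OF X(3)] by blast
  have vc: "v i \<in> carrier R" if "i \<le> n" for i
    using v[OF that] genideal_ideal[OF KX] ideal.Icarr by metis
  have c: "K \<union> v ` {..<i} \<subseteq> carrier R" if "i \<le> Suc n" for i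
    using vc that ideal.Icarr[OF X(3)] by auto
  have "ideal_chain R K (Idl (K \<union> v ` {..<Suc n})) (Suc n)"
  proof (rule fun_ideal_chain[of "Suc n" "\<lambda>i. Idl (K \<union> v ` {..<i})"]; intro allI impI conjI)
    fix i assume i: "i \<le> Suc n"
    show "ideal (Idl (K \<union> v ` {..<i})) R" using genideal_ideal[OF c[OF i]] .
    show "K \<subseteq> Idl (K \<union> v ` {..<i})" using genideal_self[OF c[OF i]] by blast
  next
    fix i assume i: "i < Suc n"
    have "v i \<in> Idl (K \<union> v ` {..<Suc i})" using genideal_self[OF c[of "Suc i"]] i by auto
    moreover have "v i \<notin> Idl (K \<union> v ` {..<i})" using no i by auto
    moreover have "Idl (K \<union> v ` {..<i}) \<subseteq> Idl (K \<union> v ` {..<Suc i})"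
      by (rule subset_Idl_subset[OF c]) (use i in auto)
    ultimately show "Idl (K \<union> v ` {..<i}) \<subset> Idl (K \<union> v ` {..<Suc i})" by blast
  qed
  moreover have "Idl (K \<union> v ` {..<Suc n}) \<subseteq> Idl (K \<union> X)"
    by (rule genideal_minimal[OF genideal_ideal[OF KX]]) (use v genideal_self[OF KX] in auto)
  ultimately have "Suc n \<le> card X" using ideal_chain_le_card[OF X] by blast
  then show False using n by simp
qed

text \<open>Generators are discarded one at a time: modulo \<open>K <+> Idl X\<close> the extra
  generator satisfies \<open>x = d \<otimes> x\<close> with \<open>d \<in> m\<close>, and
  \<open>\<one> \<ominus> d\<close> is a unit.\<close>

lemma nakayama:
  fixes X N K :: "'a set"
  assumes "finite X" "X \<subseteq> N" "ideal N R" "ideal K R" "N \<subseteq> K <+> Idl X" "N \<subseteq> K <+> m \<cdot> N"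
  shows "N \<subseteq> K"
  using assms(1,2,5)
proof (induct X rule: finite_induct)
  case empty
  have "Idl {} = {\<zero>}" by (rule genideal_empty)
  then show ?case using empty ideal.Icarr[OF assms(4)] unfolding set_add_def' by auto
next
  case (insert x X)
  note add_m = additive_subgroup.a_closed[OF is_additive_subgroup]
  interpret N: ideal N R by fact
  interpret K: ideal K R by fact
  have c: "X \<subseteq> carrier R" "x \<in> carrier R" "x \<in> N" using insert(4) N.Icarr by auto
  interpret X: ideal "Idl X" R using genideal_ideal[OF c(1)] .
  let ?S = "K <+> Idl X"
  interpret S: ideal ?S R by (intro add_ideals K.is_ideal X.is_ideal)
  have N_sub: "\<exists>s\<in>?S. \<exists>d\<in>carrier R. y = s \<oplus> d \<otimes> x" if y: "y \<in> N" for y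
  proof -
    obtain k z where kz: "k \<in> K" "z \<in> Idl (insert x X)" "y = k \<oplus> z"
      using insert(5) y unfolding set_add_def' by blast
    then obtain w d where wd: "w \<in> Idl X" "d \<in> carrier R" "z = w \<oplus> d \<otimes> x"
      using Idl_insert_subset[OF c(1,2)] mem_add_PIdl[OF X.is_ideal c(2), of z] by blast
    have "y = (k \<oplus> w) \<oplus> d \<otimes> x" using kz wd c K.Icarr X.Icarr by (simp add: a_assoc)
    moreover have "k \<oplus> w \<in> ?S" using kz wd unfolding set_add_def' by blast
    ultimately show ?thesis using wd by blast
  qed
  have mN: "\<exists>s\<in>?S. \<exists>d\<in>m. y = s \<oplus> d \<otimes> x" if "y \<in> m \<cdot> N" for y
    using that
  proof (induct rule: ideal_prod.induct)
    case (prod i j)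
    obtain s d where sd: "s \<in> ?S" "d \<in> carrier R" "j = s \<oplus> d \<otimes> x" using N_sub[OF prod(2)] by blast
    have ic: "i \<in> carrier R" using prod Icarr by blast
    have "i \<otimes> j = i \<otimes> s \<oplus> (i \<otimes> d) \<otimes> x" unfolding sd(3)
      using ic sd c S.Icarr by (simp add: r_distr m_assoc)
    moreover have "i \<otimes> s \<in> ?S" "i \<otimes> d \<in> m" using S.I_l_closed[OF sd(1) ic] I_r_closed[OF prod(1) sd(2)] by auto
    ultimately show ?case by blast
  next
    case (sum s1 s2)
    then obtain s d s' d' where sd: "s \<in> ?S" "d \<in> m" "s1 = s \<oplus> d \<otimes> x" "s' \<in> ?S" "d' \<in> m" "s2 = s' \<oplus> d' \<otimes> x"
      by blast
    have cc: "s \<in> carrier R" "s' \<in> carrier R" "d \<in> carrier R" "d' \<in> carrier R"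
      using sd S.Icarr Icarr by blast+
    have "s1 \<oplus> s2 = (s \<oplus> s') \<oplus> (d \<oplus> d') \<otimes> x" unfolding sd(3,6) using cc c(2) by algebra
    moreover have "s \<oplus> s' \<in> ?S" "d \<oplus> d' \<in> m" using S.a_closed[OF sd(1,4)] add_m[OF sd(2,5)] by auto
    ultimately show ?case by blast
  qed
  obtain k y where ky: "k \<in> K" "y \<in> m \<cdot> N" "x = k \<oplus> y" using assms(6) c(3) unfolding set_add_def' by blast
  obtain s d where sd: "s \<in> ?S" "d \<in> m" "y = s \<oplus> d \<otimes> x" using mN[OF ky(2)] by blast
  have cc: "k \<in> carrier R" "s \<in> carrier R" "d \<in> carrier R" using ky sd K.Icarr S.Icarr Icarr by blast+
  have "(\<one> \<ominus> d) \<otimes> x = k \<oplus> s"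
  proof -
    have "(\<one> \<ominus> d) \<otimes> x = x \<ominus> d \<otimes> x" using cc c by algebra
    also have "\<dots> = (k \<oplus> (s \<oplus> d \<otimes> x)) \<ominus> d \<otimes> x" using ky(3) sd(3) by simp
    also have "\<dots> = k \<oplus> s" using cc c by algebra
    finally show ?thesis .
  qed
  moreover have "k \<in> ?S"
  proof -
    have "k = k \<oplus> \<zero>" using cc by simp
    then show ?thesis using ky(1) X.zero_closed unfolding set_add_def' by blast
  qed
  ultimately have S1: "(\<one> \<ominus> d) \<otimes> x \<in> ?S" using S.a_closed sd(1) by simp
  have "\<one> \<ominus> d \<notin> m"
  proof
    assume "\<one> \<ominus> d \<in> m"
    then have "(\<one> \<ominus> d) \<oplus> d \<in> m" using sd(2) add_m by blast
    moreover have "(\<one> \<ominus> d) \<oplus> d = \<one>" using cc by algebra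
    ultimately show False using one_imp_carrier I_notcarr by auto
  qed
  then have "x \<in> ?S" using unit_mult_mem[OF S.is_ideal _ _ c(2) S1] cc by simp
  then have "N \<subseteq> ?S" using N_sub S.a_closed S.I_l_closed by blast
  then show ?case using insert by blast
qed

end

subsection \<open>Rings of dimension at most one\<close>

text \<open>The case \<open>d = 1\<close> of the elementary characterization of Krull dimension \<open>\<le> d\<close>: otherwise
  the multiplicative set of all such elements avoids \<open>0\<close>, and a chain of three primes arises
  from primes avoiding it and its counterpart for \<open>y\<close> alone.\<close>

lemma (in cring) krull_dim_le_1_relation:
  assumes dim: "krull_dim R \<le> 1" and x: "x \<in> carrier R" and y: "y \<in> carrier R"
  shows "\<exists>(k::nat) (l::nat). \<exists>a\<in>carrier R. \<exists>b\<in>carrier R.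
    x [^] k \<otimes> (y [^] l \<otimes> (\<one> \<oplus> y \<otimes> b) \<oplus> x \<otimes> a) = \<zero>"
proof (rule ccontr)
  assume no: "\<not> ?thesis"
  define s where "s k l a b = x [^] (k::nat) \<otimes> (y [^] (l::nat) \<otimes> (\<one> \<oplus> y \<otimes> b) \<oplus> x \<otimes> a)" for k l a b
  define S where "S = {s k l a b | k l a b. a \<in> carrier R \<and> b \<in> carrier R}"
  define T where "T = {y [^] (l::nat) \<otimes> (\<one> \<oplus> y \<otimes> b) | l b. b \<in> carrier R}"
  have SI: "s k l a b \<in> S" if "a \<in> carrier R" "b \<in> carrier R" for k l a b
    unfolding S_def using that by blast
  have TI: "y [^] (l::nat) \<otimes> (\<one> \<oplus> y \<otimes> b) \<in> T" if "b \<in> carrier R" for l b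
    unfolding T_def using that by blast
  have "s k l a b \<noteq> \<zero>" if "a \<in> carrier R" "b \<in> carrier R" for k l a b
    using no that unfolding s_def by blast
  then have "u \<noteq> \<zero>" if "u \<in> S" for u using that unfolding S_def by auto
  then have S0: "{\<zero>} \<inter> S = {}" by blast
  have S1: "\<one> \<in> S" using SI[of \<zero> \<zero> 0 0] x y by (simp add: s_def)
  have Smult: "u \<otimes> v \<in> S" if uv: "u \<in> S" "v \<in> S" for u v
  proof -
    obtain k l a b where u: "a \<in> carrier R" "b \<in> carrier R" "u = s k l a b"
      using uv(1) unfolding S_def by blast
    obtain k' l' a' b' where v: "a' \<in> carrier R" "b' \<in> carrier R" "v = s k' l' a' b'"
      using uv(2) unfolding S_def by blast
    define X X' Y Y' where XY: "X = x [^] k" "X' = x [^] k'" "Y = y [^] l" "Y' = y [^] l'"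
    have c: "X \<in> carrier R" "X' \<in> carrier R" "Y \<in> carrier R" "Y' \<in> carrier R"
      unfolding XY using x y by auto
    \<comment> \<open>The product of two factors \<open>\<one> \<oplus> y \<otimes> b\<close> has
      the same form, with \<open>?b\<close>; all terms with a factor \<open>x\<close> are collected
      in \<open>?a\<close>.\<close>
    let ?b = "b \<oplus> b' \<oplus> y \<otimes> b \<otimes> b'"
    let ?a = "a \<otimes> (Y' \<otimes> (\<one> \<oplus> y \<otimes> b')) \<oplus> Y \<otimes> (\<one> \<oplus> y \<otimes> b) \<otimes> a' \<oplus> x \<otimes> a \<otimes> a'"
    have "(Y \<otimes> (\<one> \<oplus> y \<otimes> b)) \<otimes> (Y' \<otimes> (\<one> \<oplus> y \<otimes> b')) = (Y \<otimes> Y') \<otimes> (\<one> \<oplus> y \<otimes> ?b)"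
      using c y u(2) v(2) by algebra
    moreover have "(X \<otimes> (Z \<oplus> x \<otimes> a)) \<otimes> (X' \<otimes> (Z' \<oplus> x \<otimes> a'))
        = (X \<otimes> X') \<otimes> (Z \<otimes> Z' \<oplus> x \<otimes> (a \<otimes> Z' \<oplus> Z \<otimes> a' \<oplus> x \<otimes> a \<otimes> a'))"
      if "Z \<in> carrier R" "Z' \<in> carrier R" for Z Z'
      using that c x u(1) v(1) by algebra
    ultimately have "u \<otimes> v = (X \<otimes> X') \<otimes> ((Y \<otimes> Y') \<otimes> (\<one> \<oplus> y \<otimes> ?b) \<oplus> x \<otimes> ?a)"
      unfolding u(3) v(3) s_def XY[symmetric] using c y u(2) v(2) by simp
    also have "\<dots> = s (k + k') (l + l') ?a ?b"
      unfolding s_def XY using x y by (simp add: nat_pow_mult)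
    finally show ?thesis using SI[of ?a ?b "k + k'" "l + l'"] c x y u v by simp
  qed
  obtain P0 where P0: "primeideal P0 R" "P0 \<inter> S = {}"
    by (rule exists_prime_disjoint[OF zeroideal S0 S1 Smult])
  interpret P0: primeideal P0 R by fact
  have xP0: "x \<notin> P0" using SI[of \<zero> \<zero> 1 0] P0(2) x y by (auto simp: s_def)
  \<comment> \<open>If \<open>t = p \<oplus> r \<otimes> x\<close> with \<open>p \<in> P0\<close>,
    then subtracting \<open>r \<otimes> x\<close> from \<open>t\<close> gives an element of
    \<open>S\<close> (with \<open>k = 0\<close> and \<open>a = \<ominus> r\<close>) that equals
    \<open>p\<close>.\<close>
  have "t \<notin> P0 <+> PIdl x" if t: "t \<in> T" for t
  proof
    assume "t \<in> P0 <+> PIdl x"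
    then obtain p r where pr: "p \<in> P0" "r \<in> carrier R" "t = p \<oplus> r \<otimes> x"
      using mem_add_PIdl[OF P0.is_ideal x] by blast
    obtain l b where lb: "b \<in> carrier R" "t = y [^] (l::nat) \<otimes> (\<one> \<oplus> y \<otimes> b)"
      using t unfolding T_def by blast
    have tc: "t \<in> carrier R" "p \<in> carrier R" using lb y P0.Icarr pr by auto
    have "s 0 l (\<ominus> r) b = t \<oplus> x \<otimes> (\<ominus> r)" unfolding s_def lb(2)[symmetric] using tc pr x by simp
    also have "\<dots> = (p \<oplus> r \<otimes> x) \<oplus> x \<otimes> (\<ominus> r)" using pr(3) by simp
    also have "\<dots> = p" using tc(2) pr(2) x by algebra
    finally show False using SI[of "\<ominus> r" b 0 l] pr lb P0(2) by auto
  qed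
  then have T0: "(P0 <+> PIdl x) \<inter> T = {}" by blast
  have T1: "\<one> \<in> T" using TI[of \<zero> 0] y by simp
  have Tmult: "u \<otimes> v \<in> T" if uv: "u \<in> T" "v \<in> T" for u v
  proof -
    obtain l b where u: "b \<in> carrier R" "u = y [^] (l::nat) \<otimes> (\<one> \<oplus> y \<otimes> b)" using uv(1) unfolding T_def by blast
    obtain l' b' where v: "b' \<in> carrier R" "v = y [^] (l'::nat) \<otimes> (\<one> \<oplus> y \<otimes> b')" using uv(2) unfolding T_def by blast
    define Y Y' where XY: "Y = y [^] l" "Y' = y [^] l'"
    have c: "Y \<in> carrier R" "Y' \<in> carrier R" unfolding XY using x y by auto
    let ?b = "b \<oplus> b' \<oplus> y \<otimes> b \<otimes> b'"
    have "u \<otimes> v = (Y \<otimes> Y') \<otimes> (\<one> \<oplus> y \<otimes> ?b)"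
      unfolding u(2) v(2) XY[symmetric] using c y u(1) v(1) by algebra
    also have "\<dots> = y [^] (l + l') \<otimes> (\<one> \<oplus> y \<otimes> ?b)" unfolding XY using y by (simp add: nat_pow_mult)
    finally show ?thesis using TI[of ?b "l + l'"] y u v by simp
  qed
  note J = ideal_add_PIdl[OF P0.is_ideal x]
  obtain P1 where P1: "primeideal P1 R" "P0 <+> PIdl x \<subseteq> P1" "P1 \<inter> T = {}"
    by (rule exists_prime_disjoint[OF J(1) T0 T1 Tmult])
  interpret P1: primeideal P1 R by fact
  have yP1: "y \<notin> P1" using TI[of \<zero> 1] P1(3) y by auto
  note K = ideal_add_PIdl[OF P1.is_ideal y]
  have "\<one> \<notin> P1 <+> PIdl y"
  proof
    assume "\<one> \<in> P1 <+> PIdl y"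
    then obtain p r where pr: "p \<in> P1" "r \<in> carrier R" "\<one> = p \<oplus> r \<otimes> y"
      using mem_add_PIdl[OF P1.is_ideal y] by blast
    have pc: "p \<in> carrier R" using pr P1.Icarr by auto
    have "y [^] (0::nat) \<otimes> (\<one> \<oplus> y \<otimes> (\<ominus> r)) = \<one> \<oplus> y \<otimes> (\<ominus> r)" using pr(2) y by simp
    also have "\<dots> = (p \<oplus> r \<otimes> y) \<oplus> y \<otimes> (\<ominus> r)" unfolding pr(3)[symmetric] ..
    also have "\<dots> = p" using pc pr(2) y by algebra
    finally show False using TI[of "\<ominus> r" 0] pr P1(3) by auto
  qed
  then obtain P2 where P2: "maximalideal P2 R" "P1 <+> PIdl y \<subseteq> P2"
    using exists_maximalideal[OF K(1)] one_closed by metis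
  \<comment> \<open>The inclusions \<open>P0 \<subset> P1 \<subset> P2\<close> are strict because of
    \<open>x\<close> and \<open>y\<close>, respectively.\<close>
  show False
    by (rule krull_dim_le_1D[OF dim P0(1) P1(1) maximalideal_prime[OF P2(1)]])
      (use J P1 xP0 K P2 yP1 in blast)+
qed

context local_filtration
begin

text \<open>The relation in \<open>F\<close> need not be homogeneous. Its component in degree
  \<open>k + l\<close> sees only the constant term of \<open>\<one> \<oplus> y \<otimes> b\<close>
  and a single coefficient of the cofactor of \<open>x\<close>, which yields a homogeneous
  relation.\<close>

lemma krull_dim_le_1_filtration_relation:
  assumes dim: "krull_dim F \<le> 1" and x: "x \<in> I 1" and y: "y \<in> I 1"
  shows "\<exists>(k::nat) (l::nat). \<exists>c\<in>I l. x [^] k \<otimes> (y [^] Suc l \<oplus> x \<otimes> c) \<in> M (k + Suc l)"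
proof -
  let ?c = "coeff (UP A)"
  let ?X = "monom (UP A) x 1" and ?Y = "monom (UP A) y 1"
  have xy: "x \<in> carrier A" "y \<in> carrier A" using x y I.Icarr by blast+
  have XY: "?X \<in> rees" "?Y \<in> rees" using x y rees_monom by blast+
  obtain k l a b where r: "a \<in> carrier F" "b \<in> carrier F"
    "form ?X [^]\<^bsub>F\<^esub> (k::nat) \<otimes>\<^bsub>F\<^esub> (form ?Y [^]\<^bsub>F\<^esub> (l::nat) \<otimes>\<^bsub>F\<^esub> (\<one>\<^bsub>F\<^esub> \<oplus>\<^bsub>F\<^esub> form ?Y \<otimes>\<^bsub>F\<^esub> b) \<oplus>\<^bsub>F\<^esub> form ?X \<otimes>\<^bsub>F\<^esub> a) = \<zero>\<^bsub>F\<^esub>"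
    using F.krull_dim_le_1_relation[OF dim form_closed[OF XY(1)] form_closed[OF XY(2)]] by blast
  obtain p q where pq: "p \<in> rees" "a = form p" "q \<in> rees" "b = form q" using r F_elem by metis
  let ?D = "\<one>\<^bsub>UP A\<^esub> \<oplus>\<^bsub>UP A\<^esub> ?Y \<otimes>\<^bsub>UP A\<^esub> q"
  let ?E = "?Y [^]\<^bsub>UP A\<^esub> l \<otimes>\<^bsub>UP A\<^esub> ?D \<oplus>\<^bsub>UP A\<^esub> ?X \<otimes>\<^bsub>UP A\<^esub> p"
  let ?W = "?X [^]\<^bsub>UP A\<^esub> k \<otimes>\<^bsub>UP A\<^esub> ?E"
  have D: "?D \<in> rees" and E: "?E \<in> rees" and W: "?W \<in> rees"
    using XY pq rees_closed rees_pow by metis+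
  have "form ?W = \<zero>\<^bsub>F\<^esub>"
    using r(3) XY pq D E by (simp add: form_mult form_add form_pow form_one rees_closed rees_pow)
  then have mem: "?c ?W (k + l) \<in> M (k + l)" using form_eq_zero_iff[OF W] by blast
  have Xk: "?X [^]\<^bsub>UP A\<^esub> k = monom (UP A) (x [^] k) k" and Yl: "?Y [^]\<^bsub>UP A\<^esub> l = monom (UP A) (y [^] l) l"
    using xy by (simp_all add: U.monom_pow)
  note cm = coeff_monom_mult_if[OF _ rees_carrier]
  have cD: "?c ?D 0 = \<one>"
  proof -
    have "?c ?D 0 = ?c \<one>\<^bsub>UP A\<^esub> 0 \<oplus> ?c (?Y \<otimes>\<^bsub>UP A\<^esub> q) 0"
      using XY pq by (intro U.coeff_add) (simp_all add: rees_carrier)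
    also have "?c (?Y \<otimes>\<^bsub>UP A\<^esub> q) 0 = \<zero>" using cm[OF xy(2) pq(3), of 1 0] by (simp del: U.coeff_mult)
    finally show ?thesis by simp
  qed
  have cE: "?c ?E l = y [^] l \<oplus> (if 1 \<le> l then x \<otimes> ?c p (l - 1) else \<zero>)"
  proof -
    have "?c ?E l = ?c (?Y [^]\<^bsub>UP A\<^esub> l \<otimes>\<^bsub>UP A\<^esub> ?D) l \<oplus> ?c (?X \<otimes>\<^bsub>UP A\<^esub> p) l"
      by (rule U.coeff_add) (use XY pq D rees_closed rees_pow rees_carrier in metis)+
    also have "?c (?Y [^]\<^bsub>UP A\<^esub> l \<otimes>\<^bsub>UP A\<^esub> ?D) l = y [^] l"
      unfolding Yl using cm[OF _ D, of "y [^] l" l l] cD xy by (simp del: U.coeff_mult U.coeff_add)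
    also have "?c (?X \<otimes>\<^bsub>UP A\<^esub> p) l = (if 1 \<le> l then x \<otimes> ?c p (l - 1) else \<zero>)"
      by (rule cm[OF xy(1) pq(1)])
    finally show ?thesis .
  qed
  have "?c ?W (k + l) = x [^] k \<otimes> ?c ?E l"
    unfolding Xk using cm[OF _ E, of "x [^] k" k "k + l"] xy by (simp del: U.coeff_mult U.coeff_add)
  then have rel: "x [^] k \<otimes> (y [^] l \<oplus> (if 1 \<le> l then x \<otimes> ?c p (l - 1) else \<zero>)) \<in> M (k + l)"
    using mem cE by simp
  show ?thesis
  proof (cases l)
    case (Suc l')
    then show ?thesis using rel rees_coeff[OF pq(1), of l'] by auto
  next
    case 0
    \<comment> \<open>With exponent 0 the relation reads \<open>x [^] k \<in> M k\<close>;
      multiplying it by \<open>y\<close> produces the required positive exponent, with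
      \<open>c = \<zero>\<close>.\<close>
    then have "x [^] k \<in> M k" using rel xy by simp
    then have "x [^] k \<otimes> y \<in> M (k + 1)" using M_mult' y by blast
    then have "x [^] k \<otimes> (y [^] Suc 0 \<oplus> x \<otimes> \<zero>) \<in> M (k + Suc 0)" using xy by simp
    then show ?thesis using I.zero_closed by blast
  qed
qed

subsection \<open>Powers of generators of a reduction\<close>

definition "power_prod X e = (\<Otimes>y\<in>X. y [^] (e y :: nat))"

lemma power_prod_mem:
  assumes "finite X" "X \<subseteq> I 1" shows "power_prod X e \<in> I (sum e X)"
  using assms
proof (induct X rule: finite_induct)
  case empty then show ?case by (simp add: power_prod_def I_0)
next
  case (insert x X)
  have "power_prod (insert x X) e = x [^] e x \<otimes> power_prod X e"
    unfolding power_prod_def by (rule finprod_insert) (use insert I.Icarr in auto)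
  moreover have "x [^] e x \<in> I (e x)" using I_pow[of x 1 "e x"] insert by simp
  ultimately show ?case using I_mult insert by simp
qed

lemma power_prod_factor:
  assumes "finite X" "X \<subseteq> I 1" "y \<in> X"
  shows "power_prod X (e(y := e y + k)) = y [^] k \<otimes> power_prod X e"
proof -
  have c: "X \<subseteq> carrier A" using assms I.Icarr by blast
  then have y: "y \<in> carrier A" using assms by blast
  have X: "X = insert y (X - {y})" using assms by blast
  have ins: "power_prod (insert y (X - {y})) e' = y [^] e' y \<otimes> power_prod (X - {y}) e'" for e'
    unfolding power_prod_def by (rule finprod_insert) (use assms c in auto)
  have "power_prod (X - {y}) (e(y := e y + k)) = power_prod (X - {y}) e"
    unfolding power_prod_def by (rule finprod_cong') (use c in auto)
  moreover have "power_prod (X - {y}) e \<in> carrier A"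
    unfolding power_prod_def by (rule finprod_closed) (use c in auto)
  ultimately show ?thesis
    using ins[of e] ins[of "e(y := e y + k)"] X y by (simp add: nat_pow_mult[symmetric] m_ac)
qed

text \<open>Each application of the reduction equation contributes one factor from \<open>X\<close>,
  so \<open>q\<close> applications produce the monomials of degree \<open>q\<close> as multipliers
  of \<open>I N\<close>.\<close>

lemma I_sub_Idl_power_prod:
  assumes X: "finite X" "X \<subseteq> I 1" and red: "\<And>n. n \<ge> N \<Longrightarrow> (Idl X) \<cdot> I n = I (Suc n)"
  shows "I (N + q) \<subseteq> Idl {power_prod X e \<otimes> z | e z. sum e X = q \<and> z \<in> I N}"
proof (induct q)
  let ?G = "\<lambda>q. {power_prod X e \<otimes> z | e z. sum e X = q \<and> z \<in> I N}"
  have Gc: "?G q \<subseteq> carrier A" for q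
  proof clarify
    fix e z assume "z \<in> I N"
    then show "power_prod X e \<otimes> z \<in> carrier A"
      using I.Icarr[OF power_prod_mem[OF X, of e]] I.Icarr by blast
  qed
  have Xc: "X \<subseteq> carrier A" using X I.Icarr by blast
  {
    case 0
    have "z \<in> ?G 0" if z: "z \<in> I N" for z
    proof -
      have "power_prod X (\<lambda>_. 0) = \<one>" unfolding power_prod_def by simp
      then have "z = power_prod X (\<lambda>_. 0) \<otimes> z" using z I.Icarr by simp
      moreover have "sum (\<lambda>_. 0::nat) X = 0" by simp
      ultimately show ?thesis using z by blast
    qed
    then show ?case using genideal_self[OF Gc[of 0]] by auto
  next
    case (Suc q)
    have "I (N + Suc q) = (Idl X) \<cdot> I (N + q)" using red[of "N + q"] by simp
    also have "\<dots> \<subseteq> (Idl X) \<cdot> (Idl (?G q))" using Suc by (rule ideal_prod_mono)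
    also have "\<dots> \<subseteq> Idl (?G (Suc q))"
    proof (rule Idl_prod_Idl_subset[OF genideal_ideal[OF Gc] Xc Gc])
      fix x g assume x: "x \<in> X" and "g \<in> ?G q"
      then obtain e z where g: "g = power_prod X e \<otimes> z" "sum e X = q" "z \<in> I N" by blast
      have "power_prod X e \<in> carrier A" using power_prod_mem[OF X] I.Icarr by blast
      then have "x \<otimes> g = power_prod X (e(x := e x + 1)) \<otimes> z"
        using g x power_prod_factor[OF X x, of e 1] Xc I.Icarr by (auto simp: m_assoc)
      moreover have "sum (e(x := e x + 1)) X = Suc q"
      proof -
        have "sum (e(x := e x + 1)) X = (e x + 1) + sum e (X - {x})"
          using X(1) x by (subst sum.remove[OF X(1) x]) (auto intro: sum.cong)
        then show ?thesis using g(2) sum.remove[OF X(1) x, of e] by simp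
      qed
      ultimately have "x \<otimes> g \<in> ?G (Suc q)" using g(3) by blast
      then show "x \<otimes> g \<in> Idl (?G (Suc q))" using genideal_self[OF Gc] by blast
    qed
    finally show ?case .
  }
qed

text \<open>Pigeonhole: a monomial in the elements of \<open>X\<close> of degree greater than
  \<open>card X * l\<close> has an exponent of at least \<open>l\<close>, so a power
  \<open>y [^] l\<close> splits off.\<close>

lemma I_sub_Idl_powers:
  assumes X: "finite X" "X \<subseteq> I 1" and red: "\<And>n. n \<ge> N \<Longrightarrow> (Idl X) \<cdot> I n = I (Suc n)"
    and n: "n \<ge> N + card X * l + 1"
  shows "I n \<subseteq> Idl {y [^] l \<otimes> z | y z. y \<in> X \<and> z \<in> I (n - l)}"
proof -
  let ?H = "{y [^] l \<otimes> z | y z. y \<in> X \<and> z \<in> I (n - l)}"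
  have Xc: "X \<subseteq> carrier A" using X I.Icarr by blast
  have Hc: "?H \<subseteq> carrier A" using Xc I.Icarr by auto
  obtain q where q: "n = N + q" "q \<ge> card X * l + 1"
    using n by (metis add.assoc add_leD1 le_add_diff_inverse nat_add_left_cancel_le)
  have "{power_prod X e \<otimes> z | e z. sum e X = q \<and> z \<in> I N} \<subseteq> ?H"
  proof clarify
    fix e z assume e: "q = sum e X" and z: "z \<in> I N"
    have "\<exists>y\<in>X. l \<le> e y"
    proof (rule ccontr)
      assume "\<not> (\<exists>y\<in>X. l \<le> e y)"
      then have "sum e X \<le> of_nat (card X) * l" by (intro sum_bounded_above) auto
      then show False using q e by simp
    qed
    then obtain y where y: "y \<in> X" "l \<le> e y" by blast
    define e' where "e' = e(y := e y - l)"
    have ee: "e = e'(y := e' y + l)" unfolding e'_def using y by auto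
    have se: "sum e' X = q - l"
    proof -
      have "sum e' X = (e y - l) + sum e (X - {y})"
        unfolding e'_def by (subst sum.remove[OF X(1) y(1)]) (auto intro: sum.cong)
      then show ?thesis using e y(2) sum.remove[OF X(1) y(1), of e] by simp
    qed
    have lq: "l \<le> q" using e y member_le_sum[of y X e] X(1) by simp
    have pm: "power_prod X e' \<in> I (q - l)" using power_prod_mem[OF X, of e'] se by simp
    have "power_prod X e = y [^] l \<otimes> power_prod X e'" using power_prod_factor[OF X y(1), of e' l] ee by simp
    then have "power_prod X e \<otimes> z = y [^] l \<otimes> (power_prod X e' \<otimes> z)"
      using Xc y pm z I.Icarr by (auto simp: m_assoc)
    moreover have "power_prod X e' \<otimes> z \<in> I (n - l)" using I_mult[OF pm z] q lq by (simp add: add.commute)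
    ultimately show "\<exists>ya za. power_prod X e \<otimes> z = ya [^] l \<otimes> za \<and> ya \<in> X \<and> za \<in> I (n - l)"
      using y(1) by blast
  qed
  then have "Idl {power_prod X e \<otimes> z | e z. sum e X = q \<and> z \<in> I N} \<subseteq> Idl ?H"
    using subset_Idl_subset[OF Hc] by blast
  then show ?thesis using I_sub_Idl_power_prod[OF X red, where N = N and q = q] q(1) by blast
qed

text \<open>Multiplication by \<open>x [^] (k' - k) \<otimes> y [^] (l' - l)\<close> raises both
  exponents, so that finitely many relations can share one pair of exponents.\<close>

lemma filtration_relation_mono:
  assumes x: "x \<in> I 1" and y: "y \<in> I 1"
    and rel: "\<exists>c\<in>I l. x [^] k \<otimes> (y [^] Suc l \<oplus> x \<otimes> c) \<in> M (k + Suc l)"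
    and le: "k \<le> k'" "l \<le> l'"
  shows "\<exists>c\<in>I l'. x [^] k' \<otimes> (y [^] Suc l' \<oplus> x \<otimes> c) \<in> M (k' + Suc l')"
proof -
  obtain c where c: "c \<in> I l" "x [^] k \<otimes> (y [^] Suc l \<oplus> x \<otimes> c) \<in> M (k + Suc l)" using rel by blast
  define U where "U = x [^] (k' - k)"
  define V where "V = y [^] (l' - l)"
  define X where "X = x [^] k"
  define Y where "Y = y [^] Suc l"
  have U: "U \<in> I (k' - k)" and V: "V \<in> I (l' - l)"
    unfolding U_def V_def using I_pow[OF x, of "k' - k"] I_pow[OF y, of "l' - l"] by simp_all
  have xc: "x \<in> carrier A" "y \<in> carrier A" using x y I.Icarr by blast+
  have cc: "c \<in> carrier A" "x \<in> carrier A" "U \<in> carrier A" "V \<in> carrier A" "X \<in> carrier A" "Y \<in> carrier A"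
    using c U V x y I.Icarr unfolding X_def Y_def by (blast intro: nat_pow_closed)+
  have "(X \<otimes> (Y \<oplus> x \<otimes> c)) \<otimes> (U \<otimes> V) \<in> M (k + Suc l + (k' - k + (l' - l)))"
    using M_mult'[OF _ I_mult[OF U V]] c(2) unfolding X_def Y_def by blast
  moreover have "(X \<otimes> (Y \<oplus> x \<otimes> c)) \<otimes> (U \<otimes> V) = (X \<otimes> U) \<otimes> (Y \<otimes> V \<oplus> x \<otimes> (c \<otimes> V))"
    using cc by algebra
  moreover have "X \<otimes> U = x [^] k'" unfolding X_def U_def using xc le by (simp add: nat_pow_mult)
  moreover have "Y \<otimes> V = y [^] Suc l'"
  proof -
    have "Suc l + (l' - l) = Suc l'" using le by simp
    then show ?thesis unfolding Y_def V_def using xc by (simp only: nat_pow_mult)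
  qed
  moreover have "k + Suc l + (k' - k + (l' - l)) = k' + Suc l'" using le by simp
  ultimately have "x [^] k' \<otimes> (y [^] Suc l' \<oplus> x \<otimes> (c \<otimes> V)) \<in> M (k' + Suc l')" by simp
  moreover have "c \<otimes> V \<in> I l'" using I_mult[OF c(1) V] le by simp
  ultimately show ?thesis by blast
qed

lemma filtration_relation_uniform:
  assumes dim: "krull_dim F \<le> 1" and X: "finite X" "X \<subseteq> I 1"
  shows "\<exists>(k::nat) l. \<forall>x\<in>X. \<forall>y\<in>X. \<exists>c\<in>I l. x [^] k \<otimes> (y [^] Suc l \<oplus> x \<otimes> c) \<in> M (k + Suc l)"
proof -
  have "\<forall>p\<in>X \<times> X. \<exists>(k::nat) l. \<exists>c\<in>I l. fst p [^] k \<otimes> (snd p [^] Suc l \<oplus> fst p \<otimes> c) \<in> M (k + Suc l)"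
    using krull_dim_le_1_filtration_relation[OF dim] X by auto
  then obtain kf lf where kl: "\<forall>p\<in>X \<times> X. \<exists>c\<in>I (lf p).
      fst p [^] (kf p :: nat) \<otimes> (snd p [^] Suc (lf p) \<oplus> fst p \<otimes> c) \<in> M (kf p + Suc (lf p))"
    by metis
  have fin: "finite (X \<times> X)" using X by simp
  show ?thesis
  proof (intro exI ballI)
    fix x y assume xy: "x \<in> X" "y \<in> X"
    have "(x, y) \<in> X \<times> X" using xy by simp
    \<comment> \<open>The sums over all pairs serve as common upper bounds of the exponents.\<close>
    then have le: "kf (x, y) \<le> sum kf (X \<times> X)" "lf (x, y) \<le> sum lf (X \<times> X)"
      using member_le_sum[OF _ _ fin] by blast+
    show "\<exists>c\<in>I (sum lf (X \<times> X)). x [^] sum kf (X \<times> X) \<otimes> (y [^] Suc (sum lf (X \<times> X)) \<oplus> x \<otimes> c)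
        \<in> M (sum kf (X \<times> X) + Suc (sum lf (X \<times> X)))"
      by (rule filtration_relation_mono[OF _ _ _ le]) (use xy X kl in auto)
  qed
qed

text \<open>The relations $x^k (y^{l+1} + x c) = 0$ make multiplication by \<open>x\<close> surjective on $x^k F$ in high
  degrees, so the Hilbert function of $x^k F$ is bounded; and in high degrees \<open>F\<close> is the sum of
  the ideals $x^k F$ over the generators \<open>x\<close> of a reduction.\<close>

lemma bounded_generators:
  assumes dim: "krull_dim F \<le> 1" and noeth: "noetherian_ring A"
    and X: "finite X" "X \<subseteq> I 1" and red: "\<And>n. n \<ge> N \<Longrightarrow> (Idl X) \<cdot> I n = I (Suc n)"
  shows "\<exists>g n0. \<forall>n\<ge>n0. \<exists>Y. finite Y \<and> card Y \<le> g \<and> Y \<subseteq> I n \<and> I n \<subseteq> Idl (M n \<union> Y)"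
proof -
  obtain k l where kl: "\<forall>x\<in>X. \<forall>y\<in>X. \<exists>c\<in>I l. x [^] (k::nat) \<otimes> (y [^] Suc l \<oplus> x \<otimes> c) \<in> M (k + Suc l)"
    using filtration_relation_uniform[OF dim X] by blast
  have Xc: "X \<subseteq> carrier A" using X I.Icarr by blast
  \<comment> \<open>For \<open>n \<ge> n1\<close>, \<open>I (Suc n)\<close> is generated by
    multiples of the powers \<open>y [^] Suc l\<close>, to which the relations apply.\<close>
  define n1 where "n1 = N + card X * Suc l + 1"
  obtain Z where Z: "Z \<subseteq> carrier A" "finite Z" "I n1 = Idl Z"
    using noetherian_ring.finetely_gen[OF noeth I_ideal] by blast
  \<comment> \<open>For \<open>n \<ge> n0\<close>, \<open>I n\<close> is generated by multiples of
    the powers \<open>x [^] k\<close>, and the cofactors have degree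
    \<open>n - k \<ge> n1\<close>.\<close>
  define n0 where "n0 = N + card X * k + 1 + n1 + k"
  have shift: "x [^] k \<otimes> z \<in> (PIdl (x [^] Suc k)) \<cdot> I n <+> M (Suc n + k)"
    if x: "x \<in> X" and n: "n \<ge> n1" and z: "z \<in> I (Suc n)" for x n z
  proof -
    have xc: "x \<in> carrier A" using x Xc by blast
    let ?T = "(PIdl (x [^] Suc k)) \<cdot> I n <+> M (Suc n + k)"
    have TI: "ideal ?T A"
      using xc by (intro add_ideals ideal_prod_is_ideal cgenideal_ideal I_ideal M_ideal) auto
    let ?H = "{y [^] Suc l \<otimes> z | y z. y \<in> X \<and> z \<in> I (Suc n - Suc l)}"
    have Hc: "?H \<subseteq> carrier A" using Xc I.Icarr by auto
    have "0 < card X" using x X(1) card_gt_0_iff by blast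
    then have "Suc l \<le> card X * Suc l" using mult_le_mono1[of 1 "card X" "Suc l"] by simp
    also have "\<dots> \<le> n" using n unfolding n1_def by (rule order_trans[rotated]) (simp only: le_add1 le_add2 add.assoc trans_le_add2)
    finally have l_le: "l \<le> n" by simp
    have sub: "I (Suc n) \<subseteq> Idl ?H"
      by (rule I_sub_Idl_powers[OF X red]) (use n n1_def in auto)
    \<comment> \<open>Behind the factor \<open>x [^] k\<close> the relation replaces
      \<open>y [^] Suc l\<close> by \<open>\<ominus> (x \<otimes> c)\<close> up to an element of
      \<open>M (Suc n + k)\<close>; one factor \<open>x\<close> is gained.\<close>
    have gen: "x [^] k \<otimes> h \<in> ?T" if h: "h \<in> ?H" for h
    proof -
      obtain y w where yw: "h = y [^] Suc l \<otimes> w" "y \<in> X" "w \<in> I (n - l)" using h by auto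
      obtain c where c: "c \<in> I l" "x [^] k \<otimes> (y [^] Suc l \<oplus> x \<otimes> c) \<in> M (k + Suc l)"
        using kl x yw by blast
      define XX where "XX = x [^] k"
      define Y where "Y = y [^] Suc l"
      have cc: "w \<in> carrier A" "c \<in> carrier A" "XX \<in> carrier A" "Y \<in> carrier A" "x \<in> carrier A"
        using yw c x Xc I.Icarr unfolding XX_def Y_def by (blast intro: nat_pow_closed)+
      have "\<ominus> (c \<otimes> w) \<in> I n" using I_mult[OF c(1) yw(3)] l_le by simp
      then have 1: "(XX \<otimes> x) \<otimes> (\<ominus> (c \<otimes> w)) \<in> (PIdl (x [^] Suc k)) \<cdot> I n"
        using PIdl_prod_eq[OF I_ideal, of "x [^] Suc k" n] xc unfolding XX_def by auto
      have "(XX \<otimes> (Y \<oplus> x \<otimes> c)) \<otimes> w \<in> M (k + Suc l + (n - l))"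
        using M_mult'[OF c(2) yw(3)] unfolding XX_def Y_def .
      then have 2: "(XX \<otimes> (Y \<oplus> x \<otimes> c)) \<otimes> w \<in> M (Suc n + k)" using l_le by (simp add: add.commute)
      have "x [^] k \<otimes> h = XX \<otimes> (Y \<otimes> w)" unfolding XX_def Y_def yw(1) ..
      also have "\<dots> = (XX \<otimes> x) \<otimes> (\<ominus> (c \<otimes> w)) \<oplus> (XX \<otimes> (Y \<oplus> x \<otimes> c)) \<otimes> w"
        using cc by algebra
      finally show ?thesis using 1 2 unfolding set_add_def' by blast
    qed
    show ?thesis
      by (rule Idl_mult_subset[OF TI nat_pow_closed[OF xc] Hc gen]) (use sub z in blast)+
  qed
  \<comment> \<open>Iterating \<open>shift\<close> trades the degree of \<open>z\<close> for powers
    of \<open>x\<close> until a cofactor in the fixed ideal \<open>I n1\<close> remains. Its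
    generators \<open>Z\<close> give the bound \<open>card X * card Z\<close> in all high
    degrees.\<close>
  have shifts: "\<exists>v\<in>I n1. \<exists>w\<in>M (n1 + j + k). x [^] k \<otimes> z = x [^] (k + j) \<otimes> v \<oplus> w"
    if x: "x \<in> X" and z: "z \<in> I (n1 + j)" for x j z
    using z
  proof (induct j arbitrary: z)
    case 0
    have "x [^] k \<otimes> z = x [^] (k + 0) \<otimes> z \<oplus> \<zero>" using 0 x Xc I.Icarr by auto
    moreover have "z \<in> I n1" using 0 by simp
    ultimately show ?case using M.zero_closed[of "n1 + 0 + k"] by blast
  next
    case (Suc j)
    have xc: "x \<in> carrier A" using x Xc by blast
    obtain u w where uw: "u \<in> (PIdl (x [^] Suc k)) \<cdot> I (n1 + j)" "w \<in> M (Suc (n1 + j) + k)"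
      "x [^] k \<otimes> z = u \<oplus> w"
      using shift[OF x, of "n1 + j" z] Suc(2) unfolding set_add_def' by auto
    obtain z' where z': "z' \<in> I (n1 + j)" "u = x [^] Suc k \<otimes> z'"
      using uw(1) PIdl_prod_eq[OF I_ideal, of "x [^] Suc k" "n1 + j"] xc by auto
    obtain v w' where vw: "v \<in> I n1" "w' \<in> M (n1 + j + k)" "x [^] k \<otimes> z' = x [^] (k + j) \<otimes> v \<oplus> w'"
      using Suc(1)[OF z'(1)] by blast
    define XX where "XX = x [^] k"
    define XJ where "XJ = x [^] (k + j)"
    have XJ': "x [^] (k + Suc j) = x \<otimes> XJ" and XK': "x [^] Suc k = x \<otimes> XX"
      unfolding XJ_def XX_def using xc by (simp_all add: m_comm)
    have cc: "XX \<in> carrier A" "XJ \<in> carrier A" "v \<in> carrier A" "w \<in> carrier A" "w' \<in> carrier A" "z' \<in> carrier A"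
      using xc vw uw z' I.Icarr M.Icarr unfolding XX_def XJ_def by (blast intro: nat_pow_closed)+
    have "x \<otimes> w' \<in> M (1 + (n1 + j + k))" using M_mult vw x X by blast
    then have w'': "x \<otimes> w' \<oplus> w \<in> M (n1 + Suc j + k)" using uw(2) by simp
    have "x [^] k \<otimes> z = x \<otimes> (XX \<otimes> z') \<oplus> w"
      unfolding uw(3) z'(2) XK' using cc xc by (simp add: m_assoc)
    also have "\<dots> = x \<otimes> (XJ \<otimes> v \<oplus> w') \<oplus> w" using vw(3) unfolding XX_def XJ_def by simp
    also have "\<dots> = x [^] (k + Suc j) \<otimes> v \<oplus> (x \<otimes> w' \<oplus> w)" unfolding XJ' using cc xc by algebra
    finally show ?case using vw(1) w'' by blast
  qed
  have "\<exists>Y. finite Y \<and> card Y \<le> card X * card Z \<and> Y \<subseteq> I n \<and> I n \<subseteq> Idl (M n \<union> Y)"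
    if n: "n \<ge> n0" for n
  proof -
    define j where "j = n - k - n1"
    have nj: "n = n1 + j + k" and nk: "n - k = n1 + j" unfolding j_def using n n0_def by auto
    let ?f = "\<lambda>p. fst p [^] (k + j) \<otimes> snd p"
    let ?Y = "?f ` (X \<times> Z)"
    have ZI: "Z \<subseteq> I n1" using genideal_self[OF Z(1)] Z(3) by blast
    have fin: "finite ?Y" using X Z by simp
    have card: "card ?Y \<le> card X * card Z"
      using card_image_le[of "X \<times> Z" ?f] X Z by (simp add: card_cartesian_product)
    have YI: "?Y \<subseteq> I n"
    proof clarify
      fix x z assume xz: "x \<in> X" "z \<in> Z"
      have "x [^] (k + j) \<in> I (k + j)" using I_pow[of x 1 "k + j"] xz X by auto
      then have "x [^] (k + j) \<otimes> z \<in> I (k + j + n1)" using I_mult xz ZI by blast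
      then show "fst (x, z) [^] (k + j) \<otimes> snd (x, z) \<in> I n" unfolding nj by (simp add: add_ac)
    qed
    let ?K = "Idl (M n \<union> ?Y)"
    have MYc: "M n \<union> ?Y \<subseteq> carrier A" using YI I.Icarr M.Icarr by blast
    have KI: "ideal ?K A" using genideal_ideal[OF MYc] .
    note Kself = genideal_self[OF MYc]
    interpret K: ideal ?K A by (rule KI)
    have "I n \<subseteq> Idl {y [^] k \<otimes> z | y z. y \<in> X \<and> z \<in> I (n - k)}"
      by (rule I_sub_Idl_powers[OF X red]) (use n n0_def in auto)
    also have "\<dots> \<subseteq> ?K"
    proof (rule genideal_minimal[OF KI], clarify)
      fix x z assume x: "x \<in> X" and "z \<in> I (n - k)"
      then obtain v w where vw: "v \<in> I n1" "w \<in> M n" "x [^] k \<otimes> z = x [^] (k + j) \<otimes> v \<oplus> w"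
        using shifts[of x z j] nj nk by auto
      have gen: "x [^] (k + j) \<otimes> u \<in> ?K" if u: "u \<in> Z" for u
      proof -
        have "?f (x, u) \<in> ?Y" using x u by (intro imageI) simp
        then show ?thesis using Kself by (simp only: fst_conv snd_conv) blast
      qed
      have "x \<in> carrier A" using x Xc by blast
      then have "x [^] (k + j) \<otimes> v \<in> ?K"
        by (intro Idl_mult_subset[OF KI nat_pow_closed Z(1) gen]) (use vw(1) Z(3) in auto)
      moreover have "w \<in> ?K" using Kself vw(2) by blast
      ultimately show "x [^] k \<otimes> z \<in> ?K" unfolding vw(3) by simp
    qed
    finally show ?thesis using fin card YI by blast
  qed
  then show ?thesis by blast
qed

end

subsection \<open>Principal reductions\<close>

locale noetherian_filtration = local_filtration + noetherian_ring A +
  assumes good: "good_filtration A I"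
    and regular: "\<exists>x\<in>I 1. nonzerodivisor A x"
    and infinite_residue: "infinite (carrier (A Quot m))"
    and dim: "krull_dim F \<le> 1"
begin

section \<open>Consequences of Nakayama's lemma, and products of linear forms\<close>

lemma I_nakayama:
  assumes "ideal K A" "I n \<subseteq> K <+> M n" shows "I n \<subseteq> K"
proof -
  interpret K: ideal K A by fact
  obtain X where X: "X \<subseteq> carrier A" "finite X" "I n = Idl X"
    using finetely_gen[OF I_ideal] by blast
  have sub: "I n \<subseteq> K <+> Idl X"
  proof
    fix x assume x: "x \<in> I n"
    then have "x = \<zero> \<oplus> x" using I.Icarr by simp
    then show "x \<in> K <+> Idl X" using x X(3) K.zero_closed unfolding set_add_def' by blast
  qed
  show ?thesis
    by (rule m.nakayama[OF X(2) _ I_ideal assms(1) sub assms(2)]) (use X genideal_self in auto)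
qed

lemma one_not_zero: "\<one> \<noteq> \<zero>"
  using m.I_notcarr m.zero_closed m.one_imp_carrier by auto

lemma I_nonzero: "\<not> I n \<subseteq> {\<zero>}"
proof
  assume zero: "I n \<subseteq> {\<zero>}"
  obtain x where x: "x \<in> I 1" "nonzerodivisor A x" using regular by blast
  have "x [^] n \<in> I n" using I_pow[OF x(1), of n] by simp
  then have "x [^] n \<otimes> \<one> = \<zero>" using zero x I.Icarr by auto
  then show False
    using nonzerodivisorD(2)[OF nonzerodivisor_pow[OF x(2)], of \<one> n] one_not_zero by blast
qed

lemma I_not_sub_M: "\<not> I n \<subseteq> M n"
proof
  assume "I n \<subseteq> M n"
  then have "I n \<subseteq> {\<zero>} <+> M n" unfolding set_add_def' using M.Icarr by force
  then show False using I_nakayama[OF zeroideal] I_nonzero by blast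
qed

text \<open>The infinite residue field supplies arbitrarily many linear forms in \<open>x\<close>
  and \<open>y\<close> whose coefficients differ pairwise by units.\<close>

lemma distinct_residues:
  obtains e :: "nat \<Rightarrow> 'a" where "\<And>i. e i \<in> carrier A" "\<And>i j. i \<noteq> j \<Longrightarrow> e i \<ominus> e j \<notin> m"
proof -
  obtain f :: "nat \<Rightarrow> 'a set" where f: "inj f" "range f \<subseteq> carrier (A Quot m)"
    using infinite_countable_subset[OF infinite_residue] by blast
  have "\<exists>a\<in>carrier A. f i = m +> a" for i
    using f(2) unfolding FactRing_def A_RCOSETS_def' by auto
  then obtain e where e: "\<And>i. e i \<in> carrier A" "\<And>i. f i = m +> e i" by metis
  have "e i \<ominus> e j \<notin> m" if "i \<noteq> j" for i j
    using m.rcos_eq_iff[OF e(1) e(1)] e(2) f(1) that unfolding inj_def by metis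
  with e(1) that show thesis by blast
qed

text \<open>Expands the product modulo \<open>x\<close>. Later \<open>x\<close> is itself one of the
  linear forms, and the \<open>c j\<close> are differences of residues, so that the coefficient of
  the power of \<open>y\<close> is a unit. For empty \<open>S\<close> the truncated degree
  \<open>card S - 1\<close> is harmless, as \<open>w = \<zero>\<close>.\<close>

lemma prod_linear_forms:
  assumes "finite S" "x \<in> I 1" "y \<in> I 1" "\<And>j. j \<in> S \<Longrightarrow> c j \<in> carrier A"
  shows "\<exists>w\<in>I (card S - 1). (\<Otimes>j\<in>S. x \<oplus> c j \<otimes> y) = (\<Otimes>j\<in>S. c j) \<otimes> y [^] card S \<oplus> x \<otimes> w"
  using assms(1,4)
proof (induct S rule: finite_induct)
  case empty
  show ?case using assms(2) I.Icarr by (intro bexI[of _ \<zero>]) auto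
next
  case (insert i S)
  have xy: "x \<in> carrier A" "y \<in> carrier A" using assms I.Icarr by blast+
  obtain w where w: "w \<in> I (card S - 1)"
    "(\<Otimes>j\<in>S. x \<oplus> c j \<otimes> y) = (\<Otimes>j\<in>S. c j) \<otimes> y [^] card S \<oplus> x \<otimes> w"
    using insert by blast
  define C where "C = (\<Otimes>j\<in>S. c j)"
  define Y where "Y = y [^] card S"
  have cc: "c i \<in> carrier A" "C \<in> carrier A" "Y \<in> carrier A" "w \<in> carrier A"
    using insert xy w I.Icarr unfolding C_def Y_def by (auto intro: finprod_closed)
  have "(\<Otimes>j\<in>insert i S. x \<oplus> c j \<otimes> y) = (x \<oplus> c i \<otimes> y) \<otimes> (\<Otimes>j\<in>S. x \<oplus> c j \<otimes> y)"
    by (rule finprod_insert) (use insert xy in auto)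
  also have "\<dots> = (x \<oplus> c i \<otimes> y) \<otimes> (C \<otimes> Y \<oplus> x \<otimes> w)" unfolding w(2) C_def Y_def ..
  also have "\<dots> = (c i \<otimes> C) \<otimes> (Y \<otimes> y) \<oplus> x \<otimes> (C \<otimes> Y \<oplus> (x \<oplus> c i \<otimes> y) \<otimes> w)"
    using cc xy by algebra
  also have "c i \<otimes> C = (\<Otimes>j\<in>insert i S. c j)"
    unfolding C_def by (rule finprod_insert[symmetric]) (use insert in auto)
  also have "Y \<otimes> y = y [^] card (insert i S)" unfolding Y_def using insert xy by simp
  finally have eq: "(\<Otimes>j\<in>insert i S. x \<oplus> c j \<otimes> y)
    = (\<Otimes>j\<in>insert i S. c j) \<otimes> y [^] card (insert i S) \<oplus> x \<otimes> (C \<otimes> Y \<oplus> (x \<oplus> c i \<otimes> y) \<otimes> w)" .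
  have "Y \<in> I (card S)" unfolding Y_def using I_pow[OF assms(3), of "card S"] by simp
  then have CY: "C \<otimes> Y \<in> I (card S)" using cc I.I_l_closed by blast
  have "x \<oplus> c i \<otimes> y \<in> I 1" using assms cc I.I_l_closed by (intro I.a_closed) auto
  then have "(x \<oplus> c i \<otimes> y) \<otimes> w \<in> I (1 + (card S - 1))" using w(1) by (rule I_mult)
  moreover have "card S \<le> 1 + (card S - 1)" by simp
  ultimately have "(x \<oplus> c i \<otimes> y) \<otimes> w \<in> I (card S)" using I_antimono by blast
  then have "C \<otimes> Y \<oplus> (x \<oplus> c i \<otimes> y) \<otimes> w \<in> I (card (insert i S) - 1)" using insert CY by simp
  then show ?case using eq by blast
qed

lemma prod_linear_forms_mem:
  assumes "finite S" "x \<in> I 1" "y \<in> I 1" "\<And>j. j \<in> S \<Longrightarrow> c j \<in> carrier A"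
  shows "(\<Otimes>j\<in>S. x \<oplus> c j \<otimes> y) \<in> I (card S)"
proof -
  have "\<exists>w\<in>I (card S - 1). (\<Otimes>j\<in>S. x \<oplus> c j \<otimes> y) = (\<Otimes>j\<in>S. c j) \<otimes> y [^] card S \<oplus> x \<otimes> w"
    using assms by (rule prod_linear_forms)
  then obtain w where w: "w \<in> I (card S - 1)"
    "(\<Otimes>j\<in>S. x \<oplus> c j \<otimes> y) = (\<Otimes>j\<in>S. c j) \<otimes> y [^] card S \<oplus> x \<otimes> w"
    by (elim bexE) (rule that; assumption)
  have "y [^] card S \<in> I (card S)" using I_pow[OF assms(3), of "card S"] by simp
  then have "(\<Otimes>j\<in>S. c j) \<otimes> y [^] card S \<in> I (card S)"
    by (rule I.I_l_closed) (use assms(4) in \<open>auto intro: finprod_closed\<close>)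
  moreover have "card S \<le> 1 + (card S - 1)" by simp
  then have "x \<otimes> w \<in> I (card S)" using I_mult[OF assms(2) w(1)] I_antimono by blast
  ultimately show ?thesis unfolding w(2) by simp
qed

lemma prod_not_in_m:
  assumes "finite S" "\<And>j. j \<in> S \<Longrightarrow> c j \<in> carrier A - m"
  shows "(\<Otimes>j\<in>S. c j) \<in> carrier A - m"
  using assms
proof (induct S rule: finite_induct)
  case empty
  then show ?case using m.one_imp_carrier m.I_notcarr by auto
next
  case (insert i S)
  have "(\<Otimes>j\<in>insert i S. c j) = c i \<otimes> (\<Otimes>j\<in>S. c j)"
    by (rule finprod_insert) (use insert in auto)
  moreover have "c i \<in> carrier A - m" "(\<Otimes>j\<in>S. c j) \<in> carrier A - m" using insert by auto
  ultimately show ?case using m.unit_mult_mem[OF m.is_ideal, of "c i" "\<Otimes>j\<in>S. c j"] by auto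
qed

text \<open>With \<open>n\<close> at least the bound on the Hilbert function, the forms
  $L_i = \prod_{j \neq i} (x - e_j y)$ cannot give a strict chain of length \<open>n + 1\<close>, so some
  \<open>L\<^sub>i\<close> depends on its predecessors; modulo $x - e_i y$ the predecessors vanish and \<open>L\<^sub>i\<close> becomes
  a unit times \<open>y\<^sup>n\<close>.  Thus $x - e_i y$ may replace the two generators \<open>x\<close> and \<open>y\<close>.\<close>

lemma reduce_generators:
  assumes X: "finite X" "X \<subseteq> I 1" and red: "\<And>n. n \<ge> N \<Longrightarrow> (Idl X) \<cdot> I n = I (Suc n)"
    and xy: "x \<in> X" "y \<in> X" "x \<noteq> y"
  shows "\<exists>X' N'. finite X' \<and> card X' < card X \<and> X' \<subseteq> I 1 \<and> X' \<subseteq> Idl X \<and>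
    (\<forall>n\<ge>N'. (Idl X') \<cdot> I n = I (Suc n))"
proof -
  have "\<exists>g n0. \<forall>n\<ge>n0. \<exists>Y. finite Y \<and> card Y \<le> g \<and> Y \<subseteq> I n \<and> I n \<subseteq> Idl (M n \<union> Y)"
    by (rule bounded_generators[OF dim noetherian_ring_axioms X red])
  then obtain g n0 where g: "\<forall>n\<ge>n0. \<exists>Y. finite Y \<and> card Y \<le> g \<and> Y \<subseteq> I n \<and> I n \<subseteq> Idl (M n \<union> Y)"
    by (elim exE) (rule that)
  \<comment> \<open>With \<open>n \<ge> g\<close>, the \<open>n + 1\<close> forms
    \<open>L 0\<close>, ..., \<open>L n\<close> outnumber the generators of \<open>I n\<close>
    modulo \<open>M n\<close>. The summand 1 secures \<open>n \<ge> 1\<close>, so that one linear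
    factor can be split off.\<close>
  define n where "n = max n0 g + 1"
  have n_ge: "n \<ge> n0" unfolding n_def by simp
  obtain Y where Y: "finite Y" "card Y \<le> g" "Y \<subseteq> I n" "I n \<subseteq> Idl (M n \<union> Y)"
    using g[rule_format, of n, OF n_ge] by (elim exE conjE) (rule that; assumption)
  obtain e :: "nat \<Rightarrow> 'a" where e: "\<And>i. e i \<in> carrier A" "\<And>i j. i \<noteq> j \<Longrightarrow> e i \<ominus> e j \<notin> m"
    using distinct_residues by blast
  have Xc: "X \<subseteq> carrier A" using X I.Icarr by blast
  have xyI: "x \<in> I 1" "y \<in> I 1" and xyc: "x \<in> carrier A" "y \<in> carrier A" using xy X Xc by auto
  define fac where "fac j = x \<oplus> (\<ominus> e j) \<otimes> y" for j
  define L where "L i = (\<Otimes>j\<in>{..n} - {i}. fac j)" for i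
  have facI: "fac j \<in> I 1" for j
    unfolding fac_def using xyI e I.I_l_closed by (intro I.a_closed) auto
  have facc: "fac j \<in> carrier A" for j using facI I.Icarr by blast
  have prodI: "(\<Otimes>j\<in>S. fac j) \<in> I (card S)" if "finite S" for S
    unfolding fac_def by (rule prod_linear_forms_mem[OF that xyI]) (use e in auto)
  have LI: "L i \<in> I n" if "i \<le> n" for i
    unfolding L_def using prodI[of "{..n} - {i}"] that by simp
  have "\<exists>i\<le>n. L i \<in> Idl (M n \<union> L ` {..<i})"
  proof (rule m.exists_dependent[OF Y(1) _ M_ideal])
    show "Y \<subseteq> carrier A" using Y(3) I.Icarr by blast
    show "c \<otimes> u \<in> M n" if "c \<in> m" "u \<in> Y" for c u using that Y(3) ideal_prod.prod[of c m u "I n" A] by blast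
    show "L i \<in> Idl (M n \<union> Y)" if "i \<le> n" for i using LI[OF that] Y(4) by blast
    show "card Y \<le> n" using Y(2) n_def by simp
  qed
  then obtain i where i: "i \<le> n" "L i \<in> Idl (M n \<union> L ` {..<i})" by blast
  define x' where "x' = fac i"
  have x': "x' \<in> I 1" "x' \<in> carrier A" unfolding x'_def using facI facc by auto
  let ?T = "(PIdl x') \<cdot> I (n - 1) <+> M n"
  have PI: "ideal ((PIdl x') \<cdot> I (n - 1)) A" using x' by (intro ideal_prod_is_ideal cgenideal_ideal I_ideal)
  have TI: "ideal ?T A" by (intro add_ideals PI M_ideal)
  interpret T: ideal ?T A by (rule TI)
  have PT: "(PIdl x') \<cdot> I (n - 1) \<subseteq> ?T" and MT: "M n \<subseteq> ?T"
    by (rule add_ideals_upper[OF PI M_ideal])+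
  have x'T: "x' \<otimes> u \<in> ?T" if "u \<in> I (n - 1)" for u
    using PT PIdl_prod_eq[OF I_ideal x'(2)] that by blast
  \<comment> \<open>Every \<open>L j\<close> with \<open>j \<noteq> i\<close> contains the factor
    \<open>fac i\<close>, which is \<open>x'\<close>.\<close>
  have "L j \<in> ?T" if j: "j < i" for j
  proof -
    have "{..n} - {j} = insert i ({..n} - {j, i})" using i j by auto
    then have "L j = fac i \<otimes> (\<Otimes>k\<in>{..n} - {j, i}. fac k)"
      unfolding L_def by (simp only:) (rule finprod_insert, use facc in auto)
    moreover have "card ({..n} - {j, i}) = n - 1"
      using i j by (subst card_Diff_subset) auto
    then have "(\<Otimes>k\<in>{..n} - {j, i}. fac k) \<in> I (n - 1)" using prodI[of "{..n} - {j, i}"] by simp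
    ultimately show ?thesis using x'T x'_def by simp
  qed
  then have "L ` {..<i} \<subseteq> ?T" by auto
  then have "M n \<union> L ` {..<i} \<subseteq> ?T" using MT by simp
  then have LT: "L i \<in> ?T" by (rule subsetD[OF genideal_minimal[OF TI] i(2)])
  \<comment> \<open>In terms of \<open>x'\<close>, the factor \<open>fac j\<close> becomes
    \<open>x' \<oplus> (e i \<ominus> e j) \<otimes> y\<close>; the coefficients are units for
    \<open>j \<noteq> i\<close>, so \<open>L i\<close> is a unit times \<open>y [^] n\<close> modulo
    \<open>x'\<close>.\<close>
  have "\<exists>w\<in>I (card ({..n} - {i}) - 1). (\<Otimes>j\<in>{..n} - {i}. x' \<oplus> (e i \<ominus> e j) \<otimes> y)
      = (\<Otimes>j\<in>{..n} - {i}. e i \<ominus> e j) \<otimes> y [^] card ({..n} - {i}) \<oplus> x' \<otimes> w"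
    by (rule prod_linear_forms[OF _ x'(1) xyI(2)]) (use e in auto)
  then obtain w where w: "w \<in> I (n - 1)" "(\<Otimes>j\<in>{..n} - {i}. x' \<oplus> (e i \<ominus> e j) \<otimes> y)
      = (\<Otimes>j\<in>{..n} - {i}. e i \<ominus> e j) \<otimes> y [^] n \<oplus> x' \<otimes> w"
    using i by auto
  define C where "C = (\<Otimes>j\<in>{..n} - {i}. e i \<ominus> e j)"
  have C: "C \<in> carrier A - m" unfolding C_def by (rule prod_not_in_m) (use e in auto)
  have fac_eq: "fac j = x' \<oplus> (e i \<ominus> e j) \<otimes> y" for j
    unfolding x'_def fac_def using xyc e(1)[of i] e(1)[of j] by algebra
  have "L i = C \<otimes> y [^] n \<oplus> x' \<otimes> w"
    unfolding L_def w(2)[folded C_def, symmetric] by (simp only: fac_eq[symmetric])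
  moreover have wc: "w \<in> carrier A" using w I.Icarr by blast
  moreover have "C \<otimes> y [^] n = (C \<otimes> y [^] n \<oplus> x' \<otimes> w) \<oplus> \<ominus> (x' \<otimes> w)"
    using C xyc x' wc by (simp add: a_assoc r_neg)
  ultimately have "C \<otimes> y [^] n = L i \<oplus> \<ominus> (x' \<otimes> w)" by simp
  moreover have "L i \<oplus> \<ominus> (x' \<otimes> w) \<in> ?T" by (intro T.a_closed T.a_inv_closed LT x'T w(1))
  ultimately have "C \<otimes> y [^] n \<in> ?T" by simp
  then have ynT: "y [^] n \<in> ?T" using m.unit_mult_mem[OF TI _ _ _ , of C "y [^] n"] C xyc by simp
  then obtain v \<mu> where v: "v \<in> (PIdl x') \<cdot> I (n - 1)" "\<mu> \<in> M n" "y [^] n = v \<oplus> \<mu>"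
    unfolding set_add_def' by blast
  obtain u where "u \<in> I (n - 1)" "v = x' \<otimes> u"
    using v(1) unfolding PIdl_prod_eq[OF I_ideal x'(2)] by blast
  with v have u: "u \<in> I (n - 1)" "\<mu> \<in> M n" "y [^] n = x' \<otimes> u \<oplus> \<mu>" by simp_all
  \<comment> \<open>\<open>X1\<close> has \<open>x'\<close> in place of \<open>x\<close> and still
    generates \<open>Idl X\<close>. \<open>X'\<close> drops the generator \<open>y\<close>, whose
    \<open>n\<close>-th power is a multiple of \<open>x'\<close> modulo \<open>M n\<close>.\<close>
  define X' where "X' = insert x' (X - {x, y})"
  define X1 where "X1 = insert y X'"
  have fin: "finite X'" "finite X1" unfolding X1_def X'_def using X by auto
  have X'I: "X' \<subseteq> I 1" "X1 \<subseteq> I 1" unfolding X1_def X'_def using X x' xyI by auto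
  have X'c: "X' \<subseteq> carrier A" "X1 \<subseteq> carrier A" using X'I I.Icarr by blast+
  interpret J: ideal "Idl X" A using genideal_ideal[OF Xc] .
  interpret J1: ideal "Idl X1" A using genideal_ideal[OF X'c(2)] .
  interpret J': ideal "Idl X'" A using genideal_ideal[OF X'c(1)] .
  note self = genideal_self[OF Xc] genideal_self[OF X'c(1)] genideal_self[OF X'c(2)]
  have "x' \<in> Idl X" unfolding x'_def fac_def
    using self xy e by (intro J.a_closed J.I_l_closed) auto
  then have X'J: "X' \<subseteq> Idl X" unfolding X'_def using self by blast
  then have "X1 \<subseteq> Idl X" unfolding X1_def using self xy by blast
  then have "Idl X1 \<subseteq> Idl X" using genideal_minimal[OF J.is_ideal] by blast
  moreover have "X \<subseteq> Idl X1"
  proof -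
    have "x = x' \<oplus> e i \<otimes> y" unfolding x'_def fac_def using xyc e(1)[of i] by algebra
    moreover have "x' \<in> X1" "y \<in> X1" unfolding X1_def X'_def by auto
    then have "x' \<in> Idl X1" "y \<in> Idl X1" using self(3) by blast+
    then have "x' \<oplus> e i \<otimes> y \<in> Idl X1" using e(1) by (intro J1.a_closed J1.I_l_closed)
    ultimately have "x \<in> Idl X1" by simp
    then show ?thesis using self unfolding X1_def X'_def by blast
  qed
  then have "Idl X \<subseteq> Idl X1" using genideal_minimal[OF J1.is_ideal] by blast
  ultimately have "Idl X1 = Idl X" by blast
  then have red1: "(Idl X1) \<cdot> I k = I (Suc k)" if "k \<ge> N" for k using red that by simp
  have n1: "n \<ge> 1" unfolding n_def by simp
  \<comment> \<open>From this degree on, \<open>I (Suc k)\<close> is generated by multiples of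
    \<open>n\<close>-th powers of elements of \<open>X1\<close>. Those from \<open>X'\<close> keep a
    factor in \<open>X'\<close>, \<open>y [^] n\<close> is rewritten through \<open>x'\<close>, and
    Nakayama's lemma removes the error in \<open>M (Suc k)\<close>.\<close>
  define N' where "N' = N + card X1 * n + 1"
  have "(Idl X') \<cdot> I k = I (Suc k)" if k: "k \<ge> N'" for k
  proof
    have X'sub: "Idl X' \<subseteq> I 1" using genideal_minimal[OF I_ideal X'I(1)] .
    show "(Idl X') \<cdot> I k \<subseteq> I (Suc k)"
      using X'sub I_mult[of _ 1 _ k] by (intro ideal_prod_subset[OF I_ideal]) auto
    let ?K = "(Idl X') \<cdot> I k" and ?s = "Suc k"
    have KI: "ideal ?K A" by (intro ideal_prod_is_ideal J'.is_ideal I_ideal)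
    interpret KM: ideal "?K <+> M ?s" A by (intro add_ideals KI M_ideal)
    have KKM: "?K \<subseteq> ?K <+> M ?s"
      by (rule add_ideals_upper[OF KI M_ideal])
    have "n \<le> k"
    proof -
      have "1 \<le> card X1" using fin X1_def by (simp add: Suc_le_eq card_gt_0_iff)
      then have "n \<le> card X1 * n" by simp
      then show ?thesis using k N'_def by linarith
    qed
    have "I ?s \<subseteq> Idl {w [^] n \<otimes> z | w z. w \<in> X1 \<and> z \<in> I (?s - n)}"
      by (rule I_sub_Idl_powers[OF fin(2) X'I(2) red1]) (use k N'_def in auto)
    also have "\<dots> \<subseteq> ?K <+> M ?s"
    proof (rule genideal_minimal[OF KM.is_ideal], clarify)
      fix v z assume v: "v \<in> X1" and z: "z \<in> I (?s - n)"
      have zc: "z \<in> carrier A" using z I.Icarr by blast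
      show "v [^] n \<otimes> z \<in> ?K <+> M ?s"
      proof (cases "v \<in> X'")
        case True
        have vc: "v \<in> carrier A" "v \<in> I 1" using True X'c X'I by auto
        have "v [^] n = v [^] (n - 1) \<otimes> v" using n1 by (metis Suc_pred' nat_pow_Suc less_le_trans zero_less_one)
        then have eq: "v [^] n \<otimes> z = v \<otimes> (v [^] (n - 1) \<otimes> z)" using vc zc by (simp add: m_ac)
        have "v [^] (n - 1) \<in> I (n - 1)" using I_pow[OF vc(2), of "n - 1"] by simp
        then have "v [^] (n - 1) \<otimes> z \<in> I (n - 1 + (?s - n))" using z by (rule I_mult)
        moreover have "n - 1 + (?s - n) = k" using n1 \<open>n \<le> k\<close> by simp
        ultimately have "v [^] (n - 1) \<otimes> z \<in> I k" by simp
        moreover have "v \<in> Idl X'" using True self by blast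
        ultimately have "v \<otimes> (v [^] (n - 1) \<otimes> z) \<in> ?K" by (intro ideal_prod.prod)
        then show ?thesis unfolding eq using KKM by blast
      next
        case False
        then have vy: "v = y" using v X1_def by blast
        have cc: "u \<in> carrier A" "\<mu> \<in> carrier A" using u I.Icarr M.Icarr by blast+
        have "v [^] n \<otimes> z = x' \<otimes> (u \<otimes> z) \<oplus> \<mu> \<otimes> z" unfolding vy u(3) using cc zc x' by algebra
        moreover have "u \<otimes> z \<in> I (n - 1 + (?s - n))" using u(1) z by (rule I_mult)
        then have "u \<otimes> z \<in> I k" using n1 \<open>n \<le> k\<close> by simp
        then have "x' \<otimes> (u \<otimes> z) \<in> ?K" using self X'_def by (intro ideal_prod.prod) auto
        moreover have "\<mu> \<otimes> z \<in> M (n + (?s - n))" using M_mult'[OF u(2) z] .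
        then have "\<mu> \<otimes> z \<in> M ?s" using \<open>n \<le> k\<close> by simp
        ultimately show ?thesis unfolding set_add_def' by blast
      qed
    qed
    finally show "I (Suc k) \<subseteq> ?K" by (rule I_nakayama[OF KI])
  qed
  moreover have "card X' < card X"
  proof -
    have "card (X - {x, y}) = card X - 2" using X xy by (subst card_Diff_subset) auto
    moreover have "card {x, y} \<le> card X" using X xy by (intro card_mono) auto
    ultimately show ?thesis unfolding X'_def using X xy card_insert_le_m1[of "card X - 1" "X - {x, y}" x'] by simp
  qed
  ultimately show ?thesis using fin X'I X'J by blast
qed

lemma exists_principal_of_generators:
  assumes "finite X" "X \<subseteq> I 1" "\<And>n. n \<ge> N \<Longrightarrow> (Idl X) \<cdot> I n = I (Suc n)"
  shows "\<exists>a\<in>Idl X. \<exists>N. \<forall>n\<ge>N. (PIdl a) \<cdot> I n = I (Suc n)"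
  using assms
proof (induct "card X" arbitrary: X N rule: less_induct)
  case less
  have Xc: "X \<subseteq> carrier A" using less(3) I.Icarr by blast
  consider "X = {}" | a where "X = {a}" | x y where "x \<in> X" "y \<in> X" "x \<noteq> y" by blast
  then show ?case
  proof cases
    case 1
    then have "Idl X = PIdl \<zero>"
      using cgenideal_eq_genideal[OF zero_closed] genideal_zero genideal_empty by simp
    then show ?thesis using cgenideal_self[OF zero_closed] less(4) by metis
  next
    case (2 a)
    then have "Idl X = PIdl a" "a \<in> carrier A" using cgenideal_eq_genideal Xc by auto
    then show ?thesis using cgenideal_self less(4) by metis
  next
    case (3 x y)
    have ex: "\<exists>X' N'. finite X' \<and> card X' < card X \<and> X' \<subseteq> I 1 \<and> X' \<subseteq> Idl X \<and>
      (\<forall>n\<ge>N'. (Idl X') \<cdot> I n = I (Suc n))"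
    proof (rule reduce_generators[OF less(2,3) _ 3])
      show "(Idl X) \<cdot> I n = I (Suc n)" if "n \<ge> N" for n by (rule less(4)[OF that])
    qed
    obtain X' N' where X': "finite X'" "card X' < card X" "X' \<subseteq> I 1" "X' \<subseteq> Idl X"
      "\<forall>n\<ge>N'. (Idl X') \<cdot> I n = I (Suc n)"
      using ex by (elim exE conjE) (rule that; assumption)
    have "Idl X' \<subseteq> Idl X" using genideal_minimal[OF genideal_ideal[OF Xc] X'(4)] .
    then show ?thesis using less(1)[OF X'(2,1,3), of N'] X'(5) by blast
  qed
qed

lemma exists_principal_reduction:
  assumes "reduction A I J" shows "\<exists>a\<in>J. a \<in> I 1 \<and> reduction A I (PIdl a)"
proof -
  obtain N where J: "ideal J A" "J \<subseteq> I 1" "\<And>n. n \<ge> N \<Longrightarrow> J \<cdot> I n = I (Suc n)"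
    using assms unfolding reduction_def by blast
  obtain X where X: "X \<subseteq> carrier A" "finite X" "J = Idl X" using finetely_gen[OF J(1)] by blast
  have "X \<subseteq> I 1" using genideal_self[OF X(1)] X(3) J(2) by blast
  then obtain a N' where a: "a \<in> J" "\<forall>n\<ge>N'. (PIdl a) \<cdot> I n = I (Suc n)"
    using exists_principal_of_generators[OF X(2) _ J(3)[unfolded X(3)]] X(3) by blast
  have "a \<in> I 1" using a J by blast
  then have "reduction A I (PIdl a)"
    unfolding reduction_def using a cgenideal_ideal[OF I.Icarr] cgenideal_minimal[OF I_ideal] by blast
  then show ?thesis using a \<open>a \<in> I 1\<close> by blast
qed

section \<open>Principal reductions and minimality\<close>

lemma reduction_PIdlD:
  assumes "a \<in> carrier A" "reduction A I (PIdl a)"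
  obtains N where "a \<in> I 1" "\<And>n. n \<ge> N \<Longrightarrow> I (Suc n) = {a \<otimes> z | z. z \<in> I n}"
proof -
  obtain N where N: "\<And>n. n \<ge> N \<Longrightarrow> (PIdl a) \<cdot> I n = I (Suc n)" and sub: "PIdl a \<subseteq> I 1"
    using assms(2) unfolding reduction_def by blast
  show thesis
    by (rule that[of N]) (use sub cgenideal_self[OF assms(1)] N PIdl_prod_eq[OF I_ideal assms(1)] in auto)
qed

text \<open>A smaller reduction contains a principal one, generated by
  \<open>b = c \<otimes> a\<close>. If \<open>c\<close> were in \<open>m\<close>, some
  \<open>I (Suc N)\<close> would equal \<open>m \<cdot> I (Suc N)\<close>, against Nakayama's lemma;
  so \<open>c\<close> is a unit and \<open>a\<close> is recovered.\<close>

lemma minimal_reduction_PIdl: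
  assumes a: "a \<in> carrier A" "reduction A I (PIdl a)"
  shows "minimal_reduction A I (PIdl a)"
  unfolding minimal_reduction_def
proof (intro conjI allI impI)
  fix K assume K: "reduction A I K \<and> K \<subseteq> PIdl a"
  then obtain b where b: "b \<in> K" "reduction A I (PIdl b)" using exists_principal_reduction by blast
  then obtain c where c: "c \<in> carrier A" "b = c \<otimes> a" using K unfolding cgenideal_def by blast
  have bc: "b \<in> carrier A" using c a by simp
  obtain N where aI: "a \<in> I 1" using reduction_PIdlD[OF a] by blast
  obtain N where N: "\<And>n. n \<ge> N \<Longrightarrow> I (Suc n) = {b \<otimes> z | z. z \<in> I n}"
    using reduction_PIdlD[OF bc b(2)] by blast
  have "c \<notin> m"
  proof
    assume cm: "c \<in> m"
    have "b \<otimes> z \<in> M (Suc N)" if z: "z \<in> I N" for z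
    proof -
      have "b \<otimes> z = c \<otimes> (a \<otimes> z)" using c a z I.Icarr by (simp add: m_assoc)
      then show ?thesis using I_mult[OF aI z] cm ideal_prod.prod[of c m "a \<otimes> z" "I (Suc N)" A] by simp
    qed
    then show False using N[of N] I_not_sub_M[of "Suc N"] by auto
  qed
  moreover have "ideal K A" using K unfolding reduction_def by blast
  ultimately have "a \<in> K" using m.unit_mult_mem[of K c a] c a b by blast
  then show "K = PIdl a" using K cgenideal_minimal[OF \<open>ideal K A\<close>] by blast
qed (rule a)

lemma minimal_reduction_principal:
  assumes "minimal_reduction A I J" shows "\<exists>a\<in>I 1. J = PIdl a"
proof -
  have J: "reduction A I J" using assms unfolding minimal_reduction_def by blast
  then obtain a where a: "a \<in> J" "a \<in> I 1" "reduction A I (PIdl a)" using exists_principal_reduction by blast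
  have "PIdl a \<subseteq> J" using cgenideal_minimal[of J a] J a unfolding reduction_def by blast
  then show ?thesis using assms a unfolding minimal_reduction_def by blast
qed

lemma exists_minimal_reduction: "\<exists>a\<in>I 1. minimal_reduction A I (PIdl a)"
proof -
  have "reduction A I (I 1)"
    using good I_ideal[of 1] unfolding good_filtration_def reduction_def by auto
  then show ?thesis using exists_principal_reduction minimal_reduction_PIdl I.Icarr by blast
qed

text \<open>A high power of a nonzerodivisor in \<open>I 1\<close> lies in \<open>I (Suc N)\<close>
  and is therefore a multiple of \<open>a\<close>; a divisor of a nonzerodivisor is a
  nonzerodivisor.\<close>

lemma reduction_nonzerodivisor:
  assumes a: "a \<in> carrier A" "reduction A I (PIdl a)"
  shows "nonzerodivisor A a"
  unfolding nonzerodivisor_def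
proof (intro conjI ballI impI)
  fix y assume y: "y \<in> carrier A" "a \<otimes> y = \<zero>"
  obtain N where N: "\<And>n. n \<ge> N \<Longrightarrow> I (Suc n) = {a \<otimes> z | z. z \<in> I n}"
    using reduction_PIdlD[OF a] by blast
  obtain x where x: "x \<in> I 1" "nonzerodivisor A x" using regular by blast
  have "x [^] Suc N \<in> I (Suc N)" using I_pow[OF x(1), of "Suc N"] by simp
  then obtain z where z: "z \<in> I N" "x [^] Suc N = a \<otimes> z" using N[of N] by blast
  have "x [^] Suc N \<otimes> y = z \<otimes> (a \<otimes> y)" unfolding z(2) using a(1) y(1) I.Icarr[OF z(1)] by (simp add: m_ac)
  then have "x [^] Suc N \<otimes> y = \<zero>" using y z I.Icarr by simp
  then show "y = \<zero>" using nonzerodivisorD(2)[OF nonzerodivisor_pow[OF x(2)]] y by blast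
qed (rule a)

lemma reduction_I_eq_pow:
  assumes a: "a \<in> carrier A" and N: "\<And>n. n \<ge> N \<Longrightarrow> I (Suc n) = {a \<otimes> z | z. z \<in> I n}"
    and x: "x \<in> I (N + k)"
  shows "\<exists>z\<in>I N. x = a [^] k \<otimes> z"
  using x
proof (induct k arbitrary: x)
  case 0 then show ?case using I.Icarr by auto
next
  case (Suc k)
  then obtain y where y: "y \<in> I (N + k)" "x = a \<otimes> y" using N[of "N + k"] by auto
  then obtain z where z: "z \<in> I N" "y = a [^] k \<otimes> z" using Suc(1) by blast
  have "x = a [^] Suc k \<otimes> z" unfolding y z using a z I.Icarr by (simp add: m_ac)
  then show ?case using z by blast
qed

text \<open>Otherwise \<open>I (N + n)\<close>, which consists of multiples
  \<open>a [^] n \<otimes> z\<close> with \<open>z \<in> I N\<close>, would be contained in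
  \<open>M (N + n)\<close>. In \<open>F\<close> this says that the initial form of \<open>a\<close>
  is not nilpotent.\<close>

lemma reduction_pow_not_in_M:
  assumes a: "a \<in> carrier A" "reduction A I (PIdl a)"
  shows "a [^] n \<notin> M n"
proof
  assume an: "a [^] n \<in> M n"
  obtain N where N: "\<And>n. n \<ge> N \<Longrightarrow> I (Suc n) = {a \<otimes> z | z. z \<in> I n}"
    using reduction_PIdlD[OF a] by blast
  have "a [^] n \<otimes> z \<in> M (N + n)" if "z \<in> I N" for z
    using M_mult'[OF an that] by (simp add: add.commute)
  then have "I (N + n) \<subseteq> M (N + n)" using reduction_I_eq_pow[OF a(1) N] by blast
  then show False using I_not_sub_M by blast
qed

subsection \<open>Reduction numbers\<close>

text \<open>The supremum of a set of integers is informative only when the set is nonempty and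
  bounded above: 0 belongs to it because \<open>J\<close> is proper, and the reduction equation
  bounds it.\<close>

lemma reduction_number_wrt_props:
  assumes "reduction A I J"
  shows "0 \<le> reduction_number_wrt A I J"
    and "\<And>n. reduction_number_wrt A I J < int (Suc n) \<Longrightarrow> I (Suc n) = J \<cdot> I n"
proof -
  define I' where "I' = (\<lambda>n :: int. if n \<le> 0 then carrier A else I (nat n))"
  define S where "S = {n :: int. I' n \<noteq> J \<cdot> I' (n - 1)}"
  have r: "reduction_number_wrt A I J = Sup S"
    unfolding reduction_number_wrt_def S_def I'_def Let_def ..
  obtain N where J: "ideal J A" "J \<subseteq> I 1" and N: "\<And>n. n \<ge> N \<Longrightarrow> J \<cdot> I n = I (Suc n)"
    using assms unfolding reduction_def by blast
  have I'Suc: "I' (int (Suc n)) = I (Suc n)" "I' (int (Suc n) - 1) = I n" for n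
  proof -
    have "int (Suc n) - 1 = int n" by simp
    then show "I' (int (Suc n) - 1) = I n" unfolding I'_def using I_0 by simp
    show "I' (int (Suc n)) = I (Suc n)" unfolding I'_def using nat_int[of "Suc n"] by (simp del: of_nat_Suc)
  qed
  have S_iff: "int (Suc n) \<in> S \<longleftrightarrow> I (Suc n) \<noteq> J \<cdot> I n" for n
    unfolding S_def mem_Collect_eq I'Suc ..
  have "J \<noteq> carrier A" using J(2) filt I.a_subset[of 1] unfolding filtration_def by auto
  then have 0: "0 \<in> S" unfolding S_def I'_def using ideal_prod_one[OF J(1)] by simp
  have bd: "bdd_above S"
  proof (rule bdd_aboveI)
    fix x assume x: "x \<in> S"
    show "x \<le> int N"
    proof (rule ccontr)
      assume "\<not> x \<le> int N"
      then have "x = int (Suc (nat x - 1))" "nat x - 1 \<ge> N" by auto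
      then show False using S_iff[of "nat x - 1"] N[of "nat x - 1"] x by simp
    qed
  qed
  show "0 \<le> reduction_number_wrt A I J" unfolding r by (rule cSup_upper[OF 0 bd])
  fix n assume "reduction_number_wrt A I J < int (Suc n)"
  then have "int (Suc n) \<notin> S" using cSup_upper[OF _ bd, of "int (Suc n)"] r by force
  then show "I (Suc n) = J \<cdot> I n" using S_iff by blast
qed

text \<open>All the numbers are nonnegative, so well-ordering provides a least one, and this is the
  infimum.\<close>

lemma reduction_number_attained:
  "\<exists>a\<in>I 1. minimal_reduction A I (PIdl a) \<and> reduction_number A I = reduction_number_wrt A I (PIdl a)"
proof -
  let ?S = "{reduction_number_wrt A I J | J. minimal_reduction A I J}"
  have nonneg: "0 \<le> z" if "z \<in> ?S" for z
    using that reduction_number_wrt_props(1) unfolding minimal_reduction_def by blast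
  obtain w where "w \<in> ?S" using exists_minimal_reduction by blast
  then obtain z where z: "z \<in> ?S" "\<And>y. y \<in> ?S \<Longrightarrow> nat z \<le> nat y"
    using ex_has_least_nat[of "\<lambda>y. y \<in> ?S" w nat] by blast
  have "Inf ?S = z"
  proof (rule cInf_eq_minimum[OF z(1)])
    fix y assume y: "y \<in> ?S"
    then show "z \<le> y" using z(2)[OF y] nonneg[OF y] by (simp only: nat_le_eq_zle)
  qed
  then show ?thesis using z(1) minimal_reduction_principal unfolding reduction_number_def by blast
qed

end

subsection \<open>Multiplication by an element of degree one\<close>

context local_filtration
begin

text \<open>Injectivity of multiplication by \<open>a\<close> from \<open>I n / M n\<close> to
  \<open>I (Suc n) / M (Suc n)\<close>, the common form into which conditions (2) to (5) are
  translated.\<close>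

definition "inj_at a n \<longleftrightarrow> (\<forall>z\<in>I n. a \<otimes> z \<in> M (Suc n) \<longrightarrow> z \<in> M n)"

lemma inj_at_iff_colon:
  assumes a: "a \<in> I 1"
  shows "I n \<inter> colon A (m \<cdot> I (n + 1)) a = m \<cdot> I n \<longleftrightarrow> inj_at a n"
proof -
  have ac: "a \<in> carrier A" using a I.Icarr by blast
  have "M n \<subseteq> I n \<inter> colon A (M (n + 1)) a"
    using M_sub_I M_mult'[OF _ a] M.Icarr unfolding colon_def by auto
  moreover have "I n \<inter> colon A (M (n + 1)) a \<subseteq> M n \<longleftrightarrow> inj_at a n"
    unfolding inj_at_def colon_def using ac I.Icarr m_comm[of a] by auto
  ultimately show ?thesis by blast
qed

text \<open>Regularity of \<open>a\<close> on \<open>A\<close> enters here: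
  \<open>a \<otimes> z = a \<otimes> w\<close> with \<open>w \<in> M n\<close> gives
  \<open>z = w\<close>, so an equality of multiples of \<open>a\<close> says something about
  \<open>z\<close>.\<close>

lemma inj_at_iff_inter:
  assumes a: "a \<in> I 1" "nonzerodivisor A a"
  shows "((PIdl a) \<cdot> I n) \<inter> (m \<cdot> I (n + 1)) = (PIdl a) \<cdot> (m \<cdot> I n) \<longleftrightarrow> inj_at a n"
proof -
  have ac: "a \<in> carrier A" using a I.Icarr by blast
  have 1: "(PIdl a) \<cdot> I n = {a \<otimes> z | z. z \<in> I n}" "(PIdl a) \<cdot> M n = {a \<otimes> z | z. z \<in> M n}"
    by (rule PIdl_prod_eq[OF I_ideal ac], rule PIdl_prod_eq[OF M_ideal ac])
  have "{a \<otimes> z | z. z \<in> M n} \<subseteq> {a \<otimes> z | z. z \<in> I n} \<inter> M (n + 1)"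
    using M_sub_I M_mult[OF a(1)] by auto
  moreover have "{a \<otimes> z | z. z \<in> I n} \<inter> M (n + 1) \<subseteq> {a \<otimes> z | z. z \<in> M n} \<longleftrightarrow> inj_at a n"
  proof
    assume sub: "{a \<otimes> z | z. z \<in> I n} \<inter> M (n + 1) \<subseteq> {a \<otimes> z | z. z \<in> M n}"
    show "inj_at a n" unfolding inj_at_def
    proof (intro ballI impI)
      fix z assume z: "z \<in> I n" "a \<otimes> z \<in> M (Suc n)"
      then have "a \<otimes> z \<in> {a \<otimes> z | z. z \<in> M n}" using sub by auto
      then obtain w where "a \<otimes> z = a \<otimes> w" "w \<in> M n" by blast
      then show "z \<in> M n" using nonzerodivisor_cancel[OF a(2), of z w] z I.Icarr M.Icarr by blast
    qed
  qed (auto simp: inj_at_def)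
  ultimately show ?thesis unfolding 1 by blast
qed

lemma inj_at_pow:
  assumes a: "a \<in> I 1" and inj: "\<And>n. inj_at a n"
    and z: "z \<in> I n" "a [^] q \<otimes> z \<in> M (n + q)"
  shows "z \<in> M n"
  using z
proof (induct q arbitrary: z n)
  case 0 then show ?case using I.Icarr by simp
next
  case (Suc q)
  have c: "a \<in> carrier A" "z \<in> carrier A" using a Suc I.Icarr by blast+
  have "a [^] Suc q \<otimes> z = a [^] q \<otimes> (a \<otimes> z)" using c by (simp add: m_assoc)
  then have "a [^] q \<otimes> (a \<otimes> z) \<in> M (Suc n + q)" using Suc(3) by simp
  moreover have "a \<otimes> z \<in> I (Suc n)" using I_mult[OF a Suc(2)] by simp
  ultimately have "a \<otimes> z \<in> M (Suc n)" using Suc(1) by blast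
  then show ?case using inj[of n] Suc(2) unfolding inj_at_def by blast
qed

text \<open>Multiplication by a homogeneous element of degree 1 shifts coefficients by one degree,
  so its annihilator is tested degree by degree; in the direction towards \<open>inj_at\<close> the
  monomials \<open>monom (UP A) z n\<close> serve as test elements.\<close>

lemma colon_initial_form_iff:
  assumes a: "a \<in> I 1"
  shows "colon F {\<zero>\<^bsub>F\<^esub>} (initial_form A m I a) = {\<zero>\<^bsub>F\<^esub>} \<longleftrightarrow> (\<forall>n. inj_at a n)"
proof -
  let ?X = "monom (UP A) a 1"
  have ac: "a \<in> carrier A" using a I.Icarr by blast
  have X: "?X \<in> rees" using a by (rule rees_monom)
  have mult: "form p \<otimes>\<^bsub>F\<^esub> form ?X = \<zero>\<^bsub>F\<^esub> \<longleftrightarrow> (\<forall>n. a \<otimes> coeff (UP A) p n \<in> M (Suc n))"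
    if p: "p \<in> rees" for p
  proof -
    have "form p \<otimes>\<^bsub>F\<^esub> form ?X = form (?X \<otimes>\<^bsub>UP A\<^esub> p)"
      unfolding form_mult[OF X p] using X p by (simp add: F.m_comm)
    then have "form p \<otimes>\<^bsub>F\<^esub> form ?X = \<zero>\<^bsub>F\<^esub> \<longleftrightarrow> (\<forall>n. coeff (UP A) (?X \<otimes>\<^bsub>UP A\<^esub> p) n \<in> M n)"
      using form_eq_zero_iff[OF rees_closed(5)[OF X p]] by simp
    also have "\<dots> \<longleftrightarrow> (\<forall>n. a \<otimes> coeff (UP A) p n \<in> M (Suc n))"
      unfolding coeff_monom_mult_if[OF ac rees_carrier[OF p]]
    proof (intro iffI allI)
      fix n assume "\<forall>n. (if 1 \<le> n then a \<otimes> coeff (UP A) p (n - 1) else \<zero>) \<in> M n"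
      from spec[OF this, of "Suc n"] show "a \<otimes> coeff (UP A) p n \<in> M (Suc n)" by simp
    next
      fix n assume "\<forall>n. a \<otimes> coeff (UP A) p n \<in> M (Suc n)"
      from spec[OF this, of "n - 1"]
      show "(if 1 \<le> n then a \<otimes> coeff (UP A) p (n - 1) else \<zero>) \<in> M n"
        using M.zero_closed[of n] by (cases n) simp_all
    qed
    finally show ?thesis .
  qed
  have colon_iff: "form p \<in> colon F {\<zero>\<^bsub>F\<^esub>} (initial_form A m I a) \<longleftrightarrow>
    (\<forall>n. a \<otimes> coeff (UP A) p n \<in> M (Suc n))" if p: "p \<in> rees" for p
    unfolding colon_def initial_form_eq[OF a] using mult[OF p] p by simp
  show ?thesis
  proof
    assume eq: "colon F {\<zero>\<^bsub>F\<^esub>} (initial_form A m I a) = {\<zero>\<^bsub>F\<^esub>}"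
    show "\<forall>n. inj_at a n"
      unfolding inj_at_def
    proof (intro allI ballI impI)
      fix n z assume z: "z \<in> I n" "a \<otimes> z \<in> M (Suc n)"
      have zc: "z \<in> carrier A" using z I.Icarr by blast
      have p: "monom (UP A) z n \<in> rees" using z by (intro rees_monom)
      have "a \<otimes> coeff (UP A) (monom (UP A) z n) k \<in> M (Suc k)" for k
        using z zc ac M.zero_closed[of "Suc k"] by auto
      then have "form (monom (UP A) z n) = \<zero>\<^bsub>F\<^esub>" using colon_iff[OF p] eq by blast
      then have "coeff (UP A) (monom (UP A) z n) n \<in> M n" using form_eq_zero_iff[OF p] by blast
      then show "z \<in> M n" using zc by simp
    qed
  next
    assume inj: "\<forall>n. inj_at a n"
    have "f = \<zero>\<^bsub>F\<^esub>" if f: "f \<in> colon F {\<zero>\<^bsub>F\<^esub>} (initial_form A m I a)" for f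
    proof -
      have "f \<in> carrier F" using f unfolding colon_def by blast
      then obtain p where p: "p \<in> rees" "f = form p" using F_elem by metis
      then have "coeff (UP A) p n \<in> M n" for n
        using f colon_iff[OF p(1)] inj rees_coeff[OF p(1)] unfolding inj_at_def by blast
      then show ?thesis using form_eq_zero_iff p by blast
    qed
    moreover have "\<zero>\<^bsub>F\<^esub> \<in> colon F {\<zero>\<^bsub>F\<^esub>} (initial_form A m I a)"
      unfolding colon_def initial_form_eq[OF a] using X by simp
    ultimately show "colon F {\<zero>\<^bsub>F\<^esub>} (initial_form A m I a) = {\<zero>\<^bsub>F\<^esub>}" by blast
  qed
qed

lemma nonzerodivisor_initial_form_iff:
  assumes a: "a \<in> I 1"
  shows "nonzerodivisor F (initial_form A m I a) \<longleftrightarrow> (\<forall>n. inj_at a n)"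
proof -
  have c: "initial_form A m I a \<in> carrier F"
    unfolding initial_form_eq[OF a] using rees_monom[OF a] by simp
  have "colon F {\<zero>\<^bsub>F\<^esub>} (initial_form A m I a)
      = {y \<in> carrier F. initial_form A m I a \<otimes>\<^bsub>F\<^esub> y = \<zero>\<^bsub>F\<^esub>}"
    unfolding colon_def using F.m_comm[OF _ c] by (intro Collect_cong) (metis singleton_iff)
  then have "nonzerodivisor F (initial_form A m I a) \<longleftrightarrow> colon F {\<zero>\<^bsub>F\<^esub>} (initial_form A m I a) = {\<zero>\<^bsub>F\<^esub>}"
    unfolding nonzerodivisor_def using c F.r_null[OF c] F.zero_closed by (simp only:) blast
  then show ?thesis using colon_initial_form_iff[OF a] by simp
qed

end

section \<open>Injectivity in single degrees, and its expression by lengths\<close>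

context noetherian_filtration
begin

lemma inj_at_change:
  assumes a: "a \<in> I 1" "\<And>n. inj_at a n" and b: "b \<in> carrier A" "reduction A I (PIdl b)"
  shows "inj_at b n"
  unfolding inj_at_def
proof (intro ballI impI)
  fix z assume z: "z \<in> I n" "b \<otimes> z \<in> M (Suc n)"
  obtain N where N: "\<And>n. n \<ge> N \<Longrightarrow> I (Suc n) = {b \<otimes> z | z. z \<in> I n}"
    using reduction_PIdlD[OF b] by blast
  have "a [^] Suc N \<in> I (Suc N)" using I_pow[OF a(1), of "Suc N"] by simp
  then obtain k where k: "k \<in> I N" "a [^] Suc N = b \<otimes> k" using N[of N] by blast
  have c: "z \<in> carrier A" "k \<in> carrier A" using z k I.Icarr by blast+
  have "a [^] Suc N \<otimes> z = k \<otimes> (b \<otimes> z)" unfolding k(2) using c b(1) by (simp add: m_ac)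
  also have "\<dots> \<in> M (N + Suc n)" using M_mult[OF k(1) z(2)] .
  finally have "a [^] Suc N \<otimes> z \<in> M (n + Suc N)" by (simp add: add_ac)
  then show "z \<in> M n" using inj_at_pow[OF a z(1)] by blast
qed

text \<open>A counterexample \<open>z\<close> would be a unit, since \<open>M 0 = m\<close>, and
  would place \<open>a\<close> in \<open>M 1\<close>, against
  \<open>reduction_pow_not_in_M\<close>.\<close>

lemma inj_at_0:
  assumes a: "a \<in> carrier A" "reduction A I (PIdl a)"
  shows "inj_at a 0"
  unfolding inj_at_def M_0
proof (intro ballI impI)
  fix z assume z: "z \<in> I 0" "a \<otimes> z \<in> M (Suc 0)"
  have zc: "z \<in> carrier A" using z I_0 by simp
  show "z \<in> m"
  proof (rule ccontr)
    assume "z \<notin> m"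
    moreover have "z \<otimes> a \<in> M 1" using z zc a m_comm by simp
    ultimately have "a \<in> M 1" using m.unit_mult_mem[OF M_ideal zc _ a(1)] by blast
    then show False using reduction_pow_not_in_M[OF a, of 1] a(1) by simp
  qed
qed

text \<open>The equality propagates to \<open>M (Suc n) = (PIdl a) \<cdot> M n\<close>, and
  \<open>a\<close> cancels in \<open>A\<close>.\<close>

lemma inj_at_of_surj:
  assumes a: "a \<in> carrier A" "reduction A I (PIdl a)" and n: "I (Suc n) = (PIdl a) \<cdot> I n"
  shows "inj_at a n"
  unfolding inj_at_def
proof (intro ballI impI)
  fix z assume z: "z \<in> I n" "a \<otimes> z \<in> M (Suc n)"
  have P: "ideal (PIdl a) A" using a by (intro cgenideal_ideal)
  have "M (Suc n) = (PIdl a) \<cdot> M n"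
    unfolding n ideal_prod_assoc[OF m.is_ideal P I_ideal, symmetric]
      ideal_prod_commute[OF m.is_ideal P] by (rule ideal_prod_assoc[OF P m.is_ideal I_ideal])
  then obtain w where w: "w \<in> M n" "a \<otimes> z = a \<otimes> w"
    using z PIdl_prod_eq[OF M_ideal a(1), of n] by blast
  have c: "z \<in> carrier A" "w \<in> carrier A" using z w I.Icarr M.Icarr by blast+
  then have "z = w" using nonzerodivisor_cancel[OF reduction_nonzerodivisor[OF a]] w(2) by blast
  then show "z \<in> M n" using w(1) by simp
qed

text \<open>Finiteness is what lets the common summand cancel from the difference in condition
  (5).\<close>

lemma mu_finite: "ideal_length A (M n) (I n) \<noteq> \<infinity>"
proof -
  obtain X where X: "X \<subseteq> carrier A" "finite X" "I n = Idl X" using finetely_gen[OF I_ideal] by blast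
  have XI: "X \<subseteq> I n" using genideal_self[OF X(1)] X(3) by simp
  have c: "M n \<union> X \<subseteq> carrier A" using X M.Icarr by blast
  have sub: "I n \<subseteq> Idl (M n \<union> X)"
    unfolding X(3) using subset_Idl_subset[OF c, of X] X(3) by simp
  have "ideal_length A (M n) (I n) \<le> enat (card X)"
    by (rule ideal_length_leI, rule m.ideal_chain_le_card[OF X(2,1) M_ideal _ _ sub])
      (use XI ideal_prod.prod in \<open>auto intro: ideal_prod.prod\<close>)
  then show ?thesis by (metis infinity_ileE)
qed

text \<open>Let \<open>K\<close> be the set of \<open>z \<in> I k\<close> with
  \<open>a \<otimes> z \<in> M (Suc k)\<close>. Multiplication by \<open>a\<close> matches
  \<open>I k / K\<close> with \<open>(M (Suc k) <+> (PIdl a) \<cdot> I k) / M (Suc k)\<close>. By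
  additivity of length the two sides differ by the length of \<open>K / M k\<close>, which vanishes
  exactly when multiplication is injective.\<close>

lemma inj_at_iff_length:
  assumes a: "a \<in> I 1"
  shows "ereal_of_enat (module_length A (ideal_quotient A (I (Suc k)) (M (Suc k) <+> (PIdl a) \<cdot> I k)))
     = ereal_of_enat (num_gens A m (I (Suc k))) - ereal_of_enat (num_gens A m (I k)) \<longleftrightarrow> inj_at a k"
proof -
  let ?n = "Suc k"
  let ?W = "M ?n <+> (PIdl a) \<cdot> I k" and ?K = "{z \<in> carrier A. a \<otimes> z \<in> M ?n} \<inter> I k"
  have ac: "a \<in> carrier A" using a I.Icarr by blast
  have PI: "ideal ((PIdl a) \<cdot> I k) A" by (intro ideal_prod_is_ideal cgenideal_ideal I_ideal ac)
  have WI: "ideal ?W A" by (intro add_ideals M_ideal PI)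
  have KI: "ideal ?K A" by (intro i_intersect colon_ideal M_ideal I_ideal ac)
  have P_eq: "(PIdl a) \<cdot> I k = {a \<otimes> z | z. z \<in> I k}" by (rule PIdl_prod_eq[OF I_ideal ac])
  have MW: "M ?n \<subseteq> ?W" and PW: "(PIdl a) \<cdot> I k \<subseteq> ?W"
    by (rule add_ideals_upper[OF M_ideal PI])+
  have aI: "a \<otimes> z \<in> I ?n" if "z \<in> I k" for z using I_mult[OF a that] by simp
  have "(PIdl a) \<cdot> I k \<subseteq> I ?n" unfolding P_eq using aI by blast
  then have WIn: "?W \<subseteq> I ?n" using M_sub_I[of ?n] unfolding set_add_def' by auto
  have MK: "M k \<subseteq> ?K" using M_sub_I M_mult[OF a] M.Icarr by auto
  \<comment> \<open>Ideals above the kernel are pushed forward by \<open>a\<close>; strictness holds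
    because they contain the kernel.\<close>
  have le1: "ideal_length A ?K (I k) \<le> ideal_length A (M ?n) ?W"
  proof (rule ideal_length_le_of_map[where f = "\<lambda>T. M ?n <+> (PIdl a) \<cdot> T"])
    fix T assume T: "ideal T A" "?K \<subseteq> T" "T \<subseteq> I k"
    have PT: "ideal ((PIdl a) \<cdot> T) A" by (intro ideal_prod_is_ideal cgenideal_ideal T ac)
    have "M ?n \<subseteq> M ?n <+> (PIdl a) \<cdot> T" by (rule add_ideals_upper[OF M_ideal PT])
    moreover have "M ?n <+> (PIdl a) \<cdot> T \<subseteq> ?W"
      using ideal_prod_mono[OF T(3), of "PIdl a"] unfolding set_add_def' by blast
    ultimately show "ideal (M ?n <+> (PIdl a) \<cdot> T) A \<and> M ?n \<subseteq> M ?n <+> (PIdl a) \<cdot> T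
        \<and> M ?n <+> (PIdl a) \<cdot> T \<subseteq> ?W"
      using add_ideals[OF M_ideal PT] by blast
  next
    fix T T' assume T: "ideal T A" "ideal T' A" "?K \<subseteq> T" "T \<subset> T'" "T' \<subseteq> I k"
    interpret T: ideal T A by fact
    obtain z where z: "z \<in> T'" "z \<notin> T" using T(4) by blast
    have zc: "z \<in> carrier A" "z \<in> I k" using z T(5) I.Icarr by blast+
    have "a \<otimes> z = \<zero> \<oplus> a \<otimes> z" using ac zc by simp
    then have in': "a \<otimes> z \<in> M ?n <+> (PIdl a) \<cdot> T'"
      using z M.zero_closed[of ?n] unfolding PIdl_prod_eq[OF T(2) ac] set_add_def' by blast
    have "a \<otimes> z \<notin> M ?n <+> (PIdl a) \<cdot> T"
    proof
      assume "a \<otimes> z \<in> M ?n <+> (PIdl a) \<cdot> T"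
      then obtain \<mu> t where t: "\<mu> \<in> M ?n" "t \<in> T" "a \<otimes> z = \<mu> \<oplus> a \<otimes> t"
        unfolding PIdl_prod_eq[OF T(1) ac] set_add_def' by blast
      have c: "\<mu> \<in> carrier A" "t \<in> carrier A" using t M.Icarr T.Icarr by blast+
      have "a \<otimes> (z \<oplus> \<ominus> t) = a \<otimes> z \<oplus> \<ominus> (a \<otimes> t)" using ac zc c by algebra
      also have "\<dots> = \<mu>" unfolding t(3) using ac c by algebra
      finally have "a \<otimes> (z \<oplus> \<ominus> t) \<in> M ?n" using t by simp
      moreover have "t \<in> I k" using t T(4,5) by blast
      then have "z \<oplus> \<ominus> t \<in> I k" using zc(2) by simp
      ultimately have "z \<oplus> \<ominus> t \<in> ?K" using zc c by simp
      then have "(z \<oplus> \<ominus> t) \<oplus> t \<in> T" using T(3) t(2) by blast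
      moreover have "(z \<oplus> \<ominus> t) \<oplus> t = z" using zc c by algebra
      ultimately show False using z by simp
    qed
    moreover have "M ?n <+> (PIdl a) \<cdot> T \<subseteq> M ?n <+> (PIdl a) \<cdot> T'"
      using ideal_prod_mono[of T T' "PIdl a"] T(4) unfolding set_add_def' by blast
    ultimately show "M ?n <+> (PIdl a) \<cdot> T \<subset> M ?n <+> (PIdl a) \<cdot> T'" using in' by blast
  qed (rule WI)
  \<comment> \<open>In the other direction ideals are pulled back along multiplication by
    \<open>a\<close>; strictness holds because every element of \<open>?W\<close> is a multiple of
    \<open>a\<close> modulo \<open>M ?n\<close>.\<close>
  have le2: "ideal_length A (M ?n) ?W \<le> ideal_length A ?K (I k)"
  proof (rule ideal_length_le_of_map[where f = "\<lambda>T. {z \<in> carrier A. a \<otimes> z \<in> T} \<inter> I k"])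
    fix T assume T: "ideal T A" "M ?n \<subseteq> T" "T \<subseteq> ?W"
    show "ideal ({z \<in> carrier A. a \<otimes> z \<in> T} \<inter> I k) A \<and> ?K \<subseteq> {z \<in> carrier A. a \<otimes> z \<in> T} \<inter> I k
       \<and> {z \<in> carrier A. a \<otimes> z \<in> T} \<inter> I k \<subseteq> I k"
      using i_intersect[OF colon_ideal[OF T(1) ac] I_ideal] T(2) by auto
  next
    fix T T' assume T: "ideal T A" "ideal T' A" "M ?n \<subseteq> T" "T \<subset> T'" "T' \<subseteq> ?W"
    interpret T: ideal T A by fact
    interpret T': ideal T' A by fact
    obtain u where u: "u \<in> T'" "u \<notin> T" using T(4) by blast
    then obtain \<mu> z where z: "\<mu> \<in> M ?n" "z \<in> I k" "u = \<mu> \<oplus> a \<otimes> z"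
      using T(5) unfolding P_eq set_add_def' by blast
    have c: "\<mu> \<in> carrier A" "z \<in> carrier A" using z M.Icarr I.Icarr by blast+
    have "a \<otimes> z = u \<oplus> \<ominus> \<mu>" unfolding z(3) using c ac by algebra
    moreover have "\<mu> \<in> T'" using z T(3,4) by blast
    ultimately have "a \<otimes> z \<in> T'" using u by simp
    moreover have "a \<otimes> z \<notin> T" using u z(1) T(3) z(3) by auto
    ultimately show "{z \<in> carrier A. a \<otimes> z \<in> T} \<inter> I k \<subset> {z \<in> carrier A. a \<otimes> z \<in> T'} \<inter> I k"
      using c z(2) T(4) by blast
  qed (rule I_ideal)
  have len: "ideal_length A ?K (I k) = ideal_length A (M ?n) ?W" using le1 le2 by simp
  interpret quot: ideal_pair "I ?n" ?W A
    by (intro ideal_pair.intro ideal_pair_axioms.intro is_cring I_ideal WI WIn)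
  have eq_n: "ideal_length A (M ?n) (I ?n) = ideal_length A (M ?n) ?W + ideal_length A ?W (I ?n)"
    by (rule ideal_length_additive[OF M_ideal WI I_ideal MW WIn])
  have eq_k: "ideal_length A (M k) (I k) = ideal_length A (M k) ?K + ideal_length A ?K (I k)"
    by (rule ideal_length_additive[OF M_ideal KI I_ideal MK]) blast
  have fin: "ideal_length A (M ?n) ?W \<noteq> \<infinity>" "ideal_length A ?W (I ?n) \<noteq> \<infinity>" "ideal_length A (M k) ?K \<noteq> \<infinity>"
    using mu_finite[of ?n] mu_finite[of k] unfolding eq_n eq_k plus_eq_infty_iff_enat
    by (simp_all only: de_Morgan_disj simp_thms)
  obtain w p where wp: "ideal_length A (M ?n) ?W = enat w" "ideal_length A ?W (I ?n) = enat p"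
    using fin by auto
  obtain t where t: "ideal_length A (M k) ?K = enat t" using fin by auto
  \<comment> \<open>The summand \<open>w\<close> is common to both numbers, so their difference is
    \<open>p - t\<close>, with \<open>p\<close> the length on the left side and \<open>t\<close> the
    length of the kernel.\<close>
  have mus: "num_gens A m (I ?n) = enat (w + p)" "num_gens A m (I k) = enat (t + w)"
    unfolding num_gens_def comp.module_length_eq using eq_n eq_k len wp t by simp_all
  have "t = 0 \<longleftrightarrow> inj_at a k"
  proof
    assume t0: "t = 0"
    have "?K \<subseteq> M k"
    proof (rule ccontr)
      assume "\<not> ?K \<subseteq> M k"
      then have "ideal_chain A (M k) ?K (Suc 0)"
        using ideal_chain.step[OF ideal_chain.base[OF M_ideal order_refl] _ KI] MK by blast
      then have "enat (Suc 0) \<le> enat t" using ideal_length_ge t by metis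
      then show False using t0 by simp
    qed
    then show "inj_at a k" unfolding inj_at_def using I.Icarr by blast
  next
    assume "inj_at a k"
    then have K: "?K \<subseteq> M k" unfolding inj_at_def by blast
    have "n \<le> 0" if "ideal_chain A (M k) ?K n" for n
      using that
    proof cases
      case (step T j)
      then show ?thesis using ideal_chain_ideal[of A "M k" T j] K by blast
    qed simp
    then have "ideal_length A (M k) ?K \<le> enat 0" by (rule ideal_length_leI)
    then show "t = 0" unfolding t by simp
  qed
  moreover have "ereal_of_enat (module_length A (ideal_quotient A (I ?n) ?W)) = ereal (real p)"
    unfolding quot.module_length_eq wp by simp
  ultimately show ?thesis unfolding mus by auto
qed

subsection \<open>The fiber cone is Noetherian\<close>

text \<open>Hilbert's basis argument: the coefficients in degree \<open>n\<close> of the elements of \<open>L\<close> without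
  components above \<open>n\<close>.  They stabilize, up to powers of \<open>a\<close>, because $I_{N+j} = a^j I_N$.\<close>

definition "lead L n = {c \<in> I n. \<exists>p\<in>rees. form p \<in> L \<and> coeff (UP A) p n = c \<and>
  (\<forall>j>n. coeff (UP A) p j = \<zero>)}"

lemma lead_ideal:
  assumes "ideal L F" shows "ideal (lead L n) A"
proof (rule idealI[OF ring_axioms])
  interpret L: ideal L F by fact
  have mult: "r \<otimes> c \<in> lead L n" if c: "c \<in> lead L n" and r: "r \<in> carrier A" for c r
  proof -
    obtain p where p: "p \<in> rees" "form p \<in> L" "coeff (UP A) p n = c" "\<forall>j>n. coeff (UP A) p j = \<zero>" "c \<in> I n"
      using c unfolding lead_def by blast
    let ?r = "monom (UP A) r 0"
    have R: "?r \<in> rees" using r I_0 by (intro rees_monom) simp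
    have "coeff (UP A) (?r \<otimes>\<^bsub>UP A\<^esub> p) j = r \<otimes> coeff (UP A) p j" for j
      using coeff_monom_mult_if[OF r rees_carrier[OF p(1)], of 0 j] by simp
    moreover have "form (?r \<otimes>\<^bsub>UP A\<^esub> p) \<in> L" unfolding form_mult[OF R p(1)] using p R by (simp add: L.I_l_closed)
    ultimately show ?thesis
      using p r rees_closed(5)[OF R p(1)] I.I_l_closed[OF p(5) r] unfolding lead_def by auto
  qed
  show "subgroup (lead L n) (add_monoid A)"
  proof (rule add.subgroupI)
    show sub: "lead L n \<subseteq> carrier A" unfolding lead_def using I.Icarr by blast
    have "\<zero> \<in> lead L n" unfolding lead_def using rees_closed(1) form_zero L.zero_closed
      by (auto intro!: bexI[of _ "\<zero>\<^bsub>UP A\<^esub>"])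
    then show "lead L n \<noteq> {}" by blast
    show "\<ominus> c \<in> lead L n" if c: "c \<in> lead L n" for c
    proof -
      have "\<ominus> c = (\<ominus> \<one>) \<otimes> c" using c sub by (auto simp: l_minus)
      then show ?thesis using mult[OF c, of "\<ominus> \<one>"] by simp
    qed
    show "c \<oplus> d \<in> lead L n" if cd: "c \<in> lead L n" "d \<in> lead L n" for c d
    proof -
      obtain p where p: "p \<in> rees" "form p \<in> L" "coeff (UP A) p n = c" "\<forall>j>n. coeff (UP A) p j = \<zero>" "c \<in> I n"
        using cd(1) unfolding lead_def by blast
      obtain q where q: "q \<in> rees" "form q \<in> L" "coeff (UP A) q n = d" "\<forall>j>n. coeff (UP A) q j = \<zero>" "d \<in> I n"
        using cd(2) unfolding lead_def by blast
      have "form (p \<oplus>\<^bsub>UP A\<^esub> q) \<in> L" unfolding form_add[OF p(1) q(1)] using p q by simp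
      then show ?thesis using p q rees_closed(4)[OF p(1) q(1)] unfolding lead_def
        by (auto simp: rees_carrier intro!: bexI[of _ "p \<oplus>\<^bsub>UP A\<^esub> q"])
    qed
  qed
  show "r \<otimes> c \<in> lead L n" if "c \<in> lead L n" "r \<in> carrier A" for c r by (rule mult[OF that])
  show "c \<otimes> r \<in> lead L n" if cr: "c \<in> lead L n" "r \<in> carrier A" for c r
  proof -
    have "c \<in> carrier A" using cr(1) I.Icarr unfolding lead_def by blast
    then show ?thesis using mult[OF cr] m_comm[OF cr(2)] by simp
  qed
qed

lemma lead_shift:
  assumes "ideal L F" "a \<in> I 1" "c \<in> lead L n" shows "a \<otimes> c \<in> lead L (Suc n)"
proof -
  interpret L: ideal L F by fact
  obtain p where p: "p \<in> rees" "form p \<in> L" "coeff (UP A) p n = c" "\<forall>j>n. coeff (UP A) p j = \<zero>" "c \<in> I n"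
    using assms(3) unfolding lead_def by blast
  let ?X = "monom (UP A) a 1"
  have X: "?X \<in> rees" using assms(2) by (rule rees_monom)
  have ac: "a \<in> carrier A" using assms(2) I.Icarr by blast
  have co: "coeff (UP A) (?X \<otimes>\<^bsub>UP A\<^esub> p) (Suc j) = a \<otimes> coeff (UP A) p j" for j
    using coeff_monom_mult_if[OF ac rees_carrier[OF p(1)], of 1 "Suc j"] by simp
  have "coeff (UP A) (?X \<otimes>\<^bsub>UP A\<^esub> p) j = \<zero>" if "j > Suc n" for j
    using co[of "j - 1"] p(4) that ac by simp
  moreover have "form (?X \<otimes>\<^bsub>UP A\<^esub> p) \<in> L" unfolding form_mult[OF X p(1)] using p X by (simp add: L.I_l_closed)
  moreover have "a \<otimes> c \<in> I (Suc n)" using I_mult[OF assms(2) p(5)] by simp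
  ultimately show ?thesis using co[of n] p(3) rees_closed(5)[OF X p(1)] unfolding lead_def by blast
qed

text \<open>Subtracting an element of \<open>K\<close> with the same leading coefficient lowers the
  degree of a representative, until the representative vanishes.\<close>

lemma lead_subset_imp_subset:
  assumes L: "ideal L F" and K: "ideal K F" "K \<subseteq> L" and lead: "\<And>n. lead L n \<subseteq> lead K n"
  shows "L \<subseteq> K"
proof
  interpret L: ideal L F by fact
  interpret K: ideal K F by fact
  have step: "form p \<in> K" if "p \<in> rees" "form p \<in> L" "\<forall>j\<ge>n. coeff (UP A) p j = \<zero>" for p n
    using that
  proof (induct n arbitrary: p)
    case 0
    have "form p = \<zero>\<^bsub>F\<^esub>" using form_eq_zero_iff[OF 0(1)] 0(3) M.zero_closed by simp
    then show ?case by simp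
  next
    case (Suc n)
    have "coeff (UP A) p n \<in> lead L n"
      using Suc(2-4) rees_coeff[OF Suc(2)] unfolding lead_def by auto
    then obtain q where q: "q \<in> rees" "form q \<in> K" "coeff (UP A) q n = coeff (UP A) p n"
      "\<forall>j>n. coeff (UP A) q j = \<zero>" using lead unfolding lead_def by blast
    let ?d = "p \<oplus>\<^bsub>UP A\<^esub> (\<ominus>\<^bsub>UP A\<^esub> q)"
    have nq: "\<ominus>\<^bsub>UP A\<^esub> q \<in> rees" using q rees_closed by blast
    have d: "?d \<in> rees" using Suc(2) nq by (rule rees_closed)
    have fd: "form ?d = form p \<oplus>\<^bsub>F\<^esub> (\<ominus>\<^bsub>F\<^esub> form q)"
      by (simp only: form_add[OF Suc(2) nq] form_minus[OF q(1)])
    have "form q \<in> L" using q K by blast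
    then have "form ?d \<in> L" unfolding fd using Suc(3) by simp
    moreover have "coeff (UP A) ?d j = \<zero>" if "j \<ge> n" for j
      using Suc(2,4) q nq that by (cases "j = n") (auto simp: rees_carrier r_neg)
    ultimately have "form ?d \<in> K" using Suc(1)[OF d] by blast
    then have "form ?d \<oplus>\<^bsub>F\<^esub> form q \<in> K" using q(2) by simp
    moreover have "form ?d \<oplus>\<^bsub>F\<^esub> form q = form p"
      unfolding fd using form_closed[OF Suc(2)] form_closed[OF q(1)] by (simp add: F.a_assoc F.l_neg)
    ultimately show ?case by simp
  qed
  fix x assume x: "x \<in> L"
  then obtain p where p: "p \<in> rees" "x = form p" using F_elem L.Icarr by metis
  have "\<forall>j\<ge>Suc (deg A p). coeff (UP A) p j = \<zero>" using U.deg_aboveD rees_carrier[OF p(1)] by auto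
  then show "x \<in> K" using step[OF p(1)] x p(2) by blast
qed

lemma lead_stabilizes:
  assumes L: "ideal L F" and a: "a \<in> I 1"
    and N: "\<And>n. n \<ge> N \<Longrightarrow> I (Suc n) = {a \<otimes> z | z. z \<in> I n}"
  shows "\<exists>k. \<forall>n\<ge>k. \<forall>c\<in>lead L (Suc n). \<exists>d\<in>lead L n. c = a \<otimes> d"
proof -
  have ac: "a \<in> carrier A" using a I.Icarr by blast
  \<comment> \<open>The leading coefficients in degree \<open>N + j\<close>, divided by
    \<open>a [^] j\<close>: an ascending chain of ideals inside the fixed ideal \<open>I N\<close>,
    hence stationary as \<open>A\<close> is Noetherian.\<close>
  define T where "T j = {z \<in> carrier A. a [^] j \<otimes> z \<in> lead L (N + j)} \<inter> I N" for j :: nat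
  have TI: "ideal (T j) A" for j
    unfolding T_def using ac by (intro i_intersect colon_ideal lead_ideal L I_ideal) simp
  have T_Suc: "T j \<subseteq> T (Suc j)" for j
  proof
    fix z assume z: "z \<in> T j"
    then have "a \<otimes> (a [^] j \<otimes> z) \<in> lead L (Suc (N + j))"
      unfolding T_def by (intro lead_shift[OF L a]) simp
    moreover have "a \<otimes> (a [^] j \<otimes> z) = a [^] Suc j \<otimes> z" using z ac unfolding T_def by (simp add: m_ac)
    ultimately show "z \<in> T (Suc j)" using z unfolding T_def by simp
  qed
  have T_mono: "T i \<subseteq> T j" if "i \<le> j" for i j using T_Suc that by (rule lift_Suc_mono_le)
  have "subset.chain {J. ideal J A} (range T)"
    unfolding subset_chain_def
  proof (intro conjI ballI)
    show "range T \<subseteq> {J. ideal J A}" using TI by blast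
    fix X Y assume "X \<in> range T" "Y \<in> range T"
    then obtain i j where "X = T i" "Y = T j" by blast
    then show "X \<subseteq> Y \<or> Y \<subseteq> X" using T_mono[of i j] T_mono[of j i] nat_le_linear[of i j] by blast
  qed
  then have "\<Union>(range T) \<in> range T" by (intro ideal_chain_is_trivial) auto
  then obtain k where k: "\<Union>(range T) = T k" by blast
  show ?thesis
  proof (intro exI[of _ "N + k"] allI impI ballI)
    fix n c assume n: "n \<ge> N + k" and c: "c \<in> lead L (Suc n)"
    define j where "j = n - N"
    have nj: "n = N + j" "j \<ge> k" unfolding j_def using n by auto
    have "c \<in> I (N + Suc j)" using c nj unfolding lead_def by simp
    then obtain z where z: "z \<in> I N" "c = a [^] Suc j \<otimes> z" using reduction_I_eq_pow[OF ac N] by blast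
    have zc: "z \<in> carrier A" using z I.Icarr by blast
    have "z \<in> T (Suc j)" using z c nj zc unfolding T_def by simp
    then have "z \<in> T k" using k by blast
    then have "z \<in> T j" using T_mono[OF nj(2)] by blast
    then have "a [^] j \<otimes> z \<in> lead L n" unfolding T_def nj(1) by simp
    moreover have "c = a \<otimes> (a [^] j \<otimes> z)" unfolding z(2) using ac zc by (simp add: m_ac)
    ultimately show "\<exists>d\<in>lead L n. c = a \<otimes> d" by blast
  qed
qed

lemma F_noetherian: "noetherian_ring F"
proof (rule F.noetherian_ringI)
  fix L assume L: "ideal L F"
  interpret L: ideal L F by fact
  obtain a where a: "a \<in> I 1" "minimal_reduction A I (PIdl a)" using exists_minimal_reduction by blast
  have ac: "a \<in> carrier A" using a I.Icarr by blast
  have red: "reduction A I (PIdl a)" using a(2) unfolding minimal_reduction_def by blast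
  obtain N where N: "\<And>n. n \<ge> N \<Longrightarrow> I (Suc n) = {a \<otimes> z | z. z \<in> I n}"
    using reduction_PIdlD[OF ac red] by blast
  obtain k where k: "\<forall>n\<ge>k. \<forall>c\<in>lead L (Suc n). \<exists>d\<in>lead L n. c = a \<otimes> d"
    using lead_stabilizes[OF L a(1) N] by blast
  have "\<forall>n. \<exists>C. C \<subseteq> carrier A \<and> finite C \<and> lead L n = Idl C"
    using finetely_gen[OF lead_ideal[OF L]] by blast
  then obtain C where C: "\<And>n. C n \<subseteq> carrier A" "\<And>n. finite (C n)" "\<And>n. lead L n = Idl (C n)" by metis
  have C_lead: "C n \<subseteq> lead L n" for n using genideal_self[OF C(1)] C(3) by simp
  have "\<forall>n. \<forall>c\<in>C n. \<exists>p. p \<in> rees \<and> form p \<in> L \<and> coeff (UP A) p n = c \<and> (\<forall>j>n. coeff (UP A) p j = \<zero>)"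
    using C_lead unfolding lead_def by blast
  then obtain P where P: "\<And>n c. c \<in> C n \<Longrightarrow> P n c \<in> rees \<and> form (P n c) \<in> L \<and>
      coeff (UP A) (P n c) n = c \<and> (\<forall>j>n. coeff (UP A) (P n c) j = \<zero>)" by metis
  \<comment> \<open>Generators for the degrees up to \<open>k\<close> suffice: beyond
    \<open>k\<close>, leading coefficients are \<open>a\<close> times those one degree lower, which
    \<open>lead_shift\<close> reproduces in the ideal generated by \<open>G\<close>.\<close>
  define G where "G = (\<Union>n\<le>k. (\<lambda>c. form (P n c)) ` C n)"
  have G: "finite G" "G \<subseteq> L" unfolding G_def using C(2) P by auto
  have Gc: "G \<subseteq> carrier F" using G(2) L.a_subset by blast
  let ?K = "Idl\<^bsub>F\<^esub> G"
  have KI: "ideal ?K F" using F.genideal_ideal[OF Gc] .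
  have KL: "?K \<subseteq> L" using F.genideal_minimal[OF L G(2)] .
  have "lead L n \<subseteq> lead ?K n" for n
  proof (induct n)
    have small: "lead L n \<subseteq> lead ?K n" if n: "n \<le> k" for n
      unfolding C(3)
    proof (rule genideal_minimal[OF lead_ideal[OF KI]], rule subsetI)
      fix c assume c: "c \<in> C n"
      then have "form (P n c) \<in> G" unfolding G_def using n by blast
      then have "form (P n c) \<in> ?K" using F.genideal_self[OF Gc] by blast
      moreover have "c \<in> I n" using C_lead c unfolding lead_def by blast
      ultimately show "c \<in> lead ?K n" unfolding lead_def using P[OF c] by blast
    qed
    case 0 show ?case by (rule small) simp
    case (Suc n)
    show ?case
    proof (cases "Suc n \<le> k")
      case True then show ?thesis by (rule small)
    next
      case False
      show ?thesis
      proof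
        fix c assume "c \<in> lead L (Suc n)"
        then obtain d where "d \<in> lead L n" "c = a \<otimes> d" using k[rule_format, of n c] False by auto
        then show "c \<in> lead ?K (Suc n)" using Suc lead_shift[OF KI a(1)] by blast
      qed
    qed
  qed
  then have "L \<subseteq> ?K" by (rule lead_subset_imp_subset[OF L KI KL])
  then show "\<exists>B\<subseteq>carrier F. finite B \<and> L = Idl\<^bsub>F\<^esub> B" using KL G Gc by blast
qed

subsection \<open>Cohen--Macaulayness of the fiber cone\<close>

lemma initial_form_mem_irr:
  assumes "a \<in> I 1" shows "initial_form A m I a \<in> irr"
  unfolding initial_form_eq[OF assms]
  using form_mem_irr_iff[OF rees_monom[OF assms]] I.Icarr[OF assms] by simp

lemma nonzerodivisor_of_not_irr:
  assumes "f \<in> carrier F" "f \<notin> irr" shows "nonzerodivisor F f"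
proof -
  obtain p where p: "p \<in> rees" "f = form p" using assms F_elem by metis
  have "coeff (UP A) p 0 \<notin> m" using assms p form_mem_irr_iff by blast
  then show ?thesis unfolding nonzerodivisor_def
    using form_mult_eq_zero[OF p(1)] p F_elem assms(1) by metis
qed

lemma cohen_macaulay_of_nonzerodivisor:
  assumes a: "a \<in> I 1" and nzd: "nonzerodivisor F (initial_form A m I a)"
  shows "cohen_macaulay F"
  unfolding cohen_macaulay_def
proof (intro conjI allI impI)
  show "cring F" by (rule F_cring)
  show "noetherian_ring F" by (rule F_noetherian)
  fix Q assume Q: "maximalideal Q F"
  interpret Q: prime_complement Q F
    using F.maximalideal_prime[OF Q] by (rule prime_complement.intro)
  have "\<exists>f\<in>Q. nonzerodivisor F f"
  proof (cases "Q \<subseteq> irr")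
    case True
    \<comment> \<open>Maximality of \<open>Q\<close> forces equality. If instead \<open>Q\<close> is
      not contained in \<open>irr\<close>, any element of \<open>Q\<close> outside
      \<open>irr\<close> is a nonzerodivisor.\<close>
    then have "irr = Q"
      using maximalideal.I_maximal[OF Q irr_ideal] maximalideal.I_notcarr[OF irr_maximalideal]
        ideal.Icarr[OF irr_ideal] by blast
    then show ?thesis using initial_form_mem_irr[OF a] nzd by blast
  next
    case False
    then show ?thesis using nonzerodivisor_of_not_irr Q.Icarr by blast
  qed
  then obtain f where f: "f \<in> Q" "nonzerodivisor F f" by blast
  have "fraction F (carrier F - Q) f \<one>\<^bsub>F\<^esub> \<in> Q.max_frac"
    unfolding Q.max_frac_def using f Q.one_in_S by blast
  then have "depth Q.L Q.max_frac = krull_dim Q.L"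
    by (rule Q.L.depth_eq_krull_dim[OF Q.local_ring_L Q.krull_dim_L_le_1[OF dim] _ Q.nonzerodivisor_frac[OF f(2)]])
  then show "cohen_macaulay_local (localization F (carrier F - Q))"
    unfolding cohen_macaulay_local_def using Q.local_ring_L Q.L_noetherian[OF F_noetherian] by blast
qed

text \<open>Below degree \<open>N + 1\<close> the power of \<open>f\<close> vanishes, and from there on its components are
  multiples of \<open>a\<^sup>o\<close>.\<close>

lemma irr_power_annihilates:
  assumes a: "a \<in> I 1" and N: "\<And>n. n \<ge> N \<Longrightarrow> I (Suc n) = {a \<otimes> z | z. z \<in> I n}"
    and f: "f \<in> irr" and z: "z \<in> carrier F" "initial_form A m I a \<otimes>\<^bsub>F\<^esub> z = \<zero>\<^bsub>F\<^esub>"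
  shows "f [^]\<^bsub>F\<^esub> Suc N \<otimes>\<^bsub>F\<^esub> z = \<zero>\<^bsub>F\<^esub>"
proof -
  let ?c = "coeff (UP A)"
  have ac: "a \<in> carrier A" using a I.Icarr by blast
  obtain p where p: "p \<in> rees" "?c p 0 \<in> m" "f = form p" using f unfolding irr_def by blast
  obtain s where s: "s \<in> rees" "z = form s" using z F_elem by metis
  let ?X = "monom (UP A) a 1"
  have X: "?X \<in> rees" using a by (rule rees_monom)
  have as: "a \<otimes> ?c s n \<in> M (Suc n)" for n
  proof -
    have "form (?X \<otimes>\<^bsub>UP A\<^esub> s) = \<zero>\<^bsub>F\<^esub>"
      using z(2) unfolding form_mult[OF X s(1)] initial_form_eq[OF a] s(2) .
    then have "?c (?X \<otimes>\<^bsub>UP A\<^esub> s) (Suc n) \<in> M (Suc n)"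
      using form_eq_zero_iff[OF rees_closed(5)[OF X s(1)]] by blast
    then show ?thesis
      using coeff_monom_mult_if[OF ac rees_carrier[OF s(1)], of 1 "Suc n"] by simp
  qed
  \<comment> \<open>Every term of the convolution has either a coefficient of the smaller power in a
    degree below \<open>q\<close>, or the coefficient of \<open>p\<close> in degree 0, which lies in
    \<open>m\<close>.\<close>
  have low: "?c (p [^]\<^bsub>UP A\<^esub> q) i \<in> M i" if "i < q" for i q
    using that
  proof (induct q arbitrary: i)
    case (Suc q)
    have pq: "p [^]\<^bsub>UP A\<^esub> q \<in> rees" using p by (intro rees_pow)
    have "?c (p [^]\<^bsub>UP A\<^esub> q) l \<otimes> ?c p (i - l) \<in> M i" if l: "l \<le> i" for l
    proof (cases "l < q")
      case True
      then show ?thesis using M_mult'[OF Suc(1)[OF True] rees_coeff[OF p(1)], of "i - l"] l by simp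
    next
      case False
      then have "i = l" using l Suc(2) by simp
      moreover have "?c p 0 \<in> M 0" using p(2) M_0 by simp
      ultimately show ?thesis using M_mult[OF rees_coeff[OF pq, of l], of "?c p 0" 0] by simp
    qed
    then have "(\<Oplus>l\<in>{..i}. ?c (p [^]\<^bsub>UP A\<^esub> q) l \<otimes> ?c p (i - l)) \<in> M i" by (intro M.finsum_mem) auto
    then show ?case using p pq by (simp add: rees_carrier)
  qed simp
  let ?P = "p [^]\<^bsub>UP A\<^esub> Suc N"
  have P: "?P \<in> rees" using p by (intro rees_pow)
  have "?c (?P \<otimes>\<^bsub>UP A\<^esub> s) n \<in> M n" for n
  proof -
    have "?c ?P i \<otimes> ?c s (n - i) \<in> M n" if i: "i \<le> n" for i
    proof (cases "i < Suc N")
      case True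
      then show ?thesis using M_mult'[OF low[OF True] rees_coeff[OF s(1)], of "n - i"] i by simp
    next
      case False
      then obtain j where j: "i = Suc j" "j \<ge> N" by (cases i) auto
      \<comment> \<open>From degree \<open>Suc N\<close> on the coefficient of the power is
        \<open>a \<otimes> k\<close>; moving \<open>a\<close> over to the coefficient of
        \<open>s\<close> lands in \<open>M\<close>, since \<open>a\<close> annihilates
        \<open>s\<close> modulo \<open>M\<close>.\<close>
      have "?c ?P i \<in> I (Suc j)" using rees_coeff[OF P] j by blast
      then obtain k where k: "k \<in> I j" "?c ?P i = a \<otimes> k" using N[OF j(2)] by auto
      have kc: "k \<in> carrier A" "?c s (n - i) \<in> carrier A" using k I.Icarr rees_carrier[OF s(1)] by auto
      have "k \<otimes> (a \<otimes> ?c s (n - i)) \<in> M (j + Suc (n - i))" using M_mult[OF k(1) as] .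
      moreover have "j + Suc (n - i) = n" using j i by simp
      moreover have "?c ?P i \<otimes> ?c s (n - i) = k \<otimes> (a \<otimes> ?c s (n - i))"
        unfolding k(2) using ac kc by (simp add: m_ac)
      ultimately show ?thesis by simp
    qed
    then have "(\<Oplus>i\<in>{..n}. ?c ?P i \<otimes> ?c s (n - i)) \<in> M n" by (intro M.finsum_mem) auto
    then show ?thesis using U.coeff_mult[OF rees_carrier[OF P] rees_carrier[OF s(1)]] by simp
  qed
  then have "form (?P \<otimes>\<^bsub>UP A\<^esub> s) = \<zero>\<^bsub>F\<^esub>" using form_eq_zero_iff[OF rees_closed(5)[OF P s(1)]] by blast
  then show ?thesis unfolding form_mult[OF P s(1)] form_pow[OF p(1)] p(3) s(2) .
qed

text \<open>Depth equals dimension at \<open>irr\<close>, and the dimension there is positive, so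
  some fraction \<open>f / s\<close> in the maximal ideal is a nonzerodivisor. A power of
  \<open>f\<close> annihilates whatever the initial form of \<open>a\<close> annihilates, which must
  therefore be zero.\<close>

lemma nonzerodivisor_of_cohen_macaulay:
  assumes cm: "cohen_macaulay F" and a: "a \<in> I 1" "reduction A I (PIdl a)"
  shows "nonzerodivisor F (initial_form A m I a)"
proof -
  interpret Q: prime_complement irr F
    using F.maximalideal_prime[OF irr_maximalideal] by (rule prime_complement.intro)
  interpret h: ring_hom_cring F Q.L "\<lambda>x. Q.fr x \<one>\<^bsub>F\<^esub>" by (rule Q.frac_hom)
  have ac: "a \<in> carrier A" using a I.Icarr by blast
  let ?a = "initial_form A m I a"
  have aF: "?a \<in> carrier F" "?a \<in> irr" using initial_form_mem_irr[OF a(1)] Q.Icarr by blast+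
  obtain m' where m': "local_ring Q.L m'" "depth Q.L m' = krull_dim Q.L"
    using cm irr_maximalideal unfolding cohen_macaulay_def cohen_macaulay_local_def by blast
  have m'eq: "m' = Q.max_frac"
    using m'(1) Q.local_ring_L unfolding local_ring_def by blast
  have mmax: "maximalideal Q.max_frac Q.L" and uniq: "\<And>J. maximalideal J Q.L \<Longrightarrow> J = Q.max_frac"
    using Q.local_ring_L unfolding local_ring_def by auto
  \<comment> \<open>The map from \<open>F\<close> to its localization at \<open>irr\<close> is
    injective, because all denominators are nonzerodivisors.\<close>
  have cancel: "g = \<zero>\<^bsub>F\<^esub>" if g: "g \<in> carrier F" "Q.fr g \<one>\<^bsub>F\<^esub> = \<zero>\<^bsub>Q.L\<^esub>" for g
  proof -
    obtain u where u: "u \<in> carrier F - irr" "u \<otimes>\<^bsub>F\<^esub> g = \<zero>\<^bsub>F\<^esub>"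
      using Q.frac_eq_zero_iff[OF g(1) Q.one_in_S] g(2) by blast
    then show ?thesis using nonzerodivisor_of_not_irr[of u] g unfolding nonzerodivisor_def by blast
  qed
  have frac_a: "Q.fr ?a \<one>\<^bsub>F\<^esub> \<in> Q.max_frac" unfolding Q.max_frac_def using aF Q.one_in_S by blast
  \<comment> \<open>The initial form of \<open>a\<close> is not nilpotent in the localization; a
    prime missing it lies strictly below the maximal ideal, so the dimension is at least
    one.\<close>
  have "Q.fr ?a \<one>\<^bsub>F\<^esub> [^]\<^bsub>Q.L\<^esub> n \<notin> {\<zero>\<^bsub>Q.L\<^esub>}" for n :: nat
  proof
    assume "Q.fr ?a \<one>\<^bsub>F\<^esub> [^]\<^bsub>Q.L\<^esub> n \<in> {\<zero>\<^bsub>Q.L\<^esub>}"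
    then have "Q.fr (?a [^]\<^bsub>F\<^esub> n) \<one>\<^bsub>F\<^esub> = \<zero>\<^bsub>Q.L\<^esub>" using h.hom_pow[OF aF(1), of n] by simp
    then have "?a [^]\<^bsub>F\<^esub> n = \<zero>\<^bsub>F\<^esub>" using cancel[of "?a [^]\<^bsub>F\<^esub> n"] aF by simp
    then have "form (monom (UP A) a 1 [^]\<^bsub>UP A\<^esub> n) = \<zero>\<^bsub>F\<^esub>"
      unfolding initial_form_eq[OF a(1)] form_pow[OF rees_monom[OF a(1)]] .
    then have "coeff (UP A) (monom (UP A) a 1 [^]\<^bsub>UP A\<^esub> n) n \<in> M n"
      using form_eq_zero_iff[OF rees_pow[OF rees_monom[OF a(1)]]] by blast
    then have "a [^] n \<in> M n" using ac by (simp add: U.monom_pow)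
    then show False using reduction_pow_not_in_M[OF ac a(2)] by blast
  qed
  then obtain P where P: "primeideal P Q.L" "Q.fr ?a \<one>\<^bsub>F\<^esub> \<notin> P"
    using Q.L.exists_prime_not_containing[OF Q.L.zeroideal, of "Q.fr ?a \<one>\<^bsub>F\<^esub>"] Q.frac_closed[OF aF(1) Q.one_in_S]
    by metis
  have "P \<subseteq> Q.max_frac"
    using Q.L.exists_maximalideal[OF primeideal.axioms(1)[OF P(1)]] uniq primeideal.I_notcarr[OF P(1)] by metis
  then have "P \<subset> Q.max_frac" using P frac_a by blast
  then have "1 \<le> krull_dim Q.L" by (rule krull_dim_ge_1[OF P(1) Q.L.maximalideal_prime[OF mmax]])
  then have d1: "1 \<le> depth Q.L Q.max_frac" using m' m'eq by simp
  \<comment> \<open>Positive depth requires a nonempty regular sequence. Its head is a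
    nonzerodivisor modulo the ideal generated by the empty set, which is zero.\<close>
  have "\<exists>xs. set xs \<subseteq> Q.max_frac \<and> regular_sequence Q.L xs \<and> xs \<noteq> []"
  proof (rule ccontr)
    assume "\<not> ?thesis"
    then have "depth Q.L Q.max_frac \<le> 0" unfolding depth_def by (intro Sup_least) (auto simp: zero_enat_def)
    then show False using d1 by simp
  qed
  then obtain x xs where xs: "set (x # xs) \<subseteq> Q.max_frac" "regular_sequence Q.L (x # xs)"
    by (metis neq_Nil_conv)
  have xm: "x \<in> Q.max_frac" using xs by simp
  then have xc: "x \<in> carrier Q.L" using ideal.Icarr[OF Q.max_frac_ideal] by blast
  have "nonzerodivisor (Q.L Quot {\<zero>\<^bsub>Q.L\<^esub>}) ({\<zero>\<^bsub>Q.L\<^esub>} +>\<^bsub>Q.L\<^esub> x)"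
    using xs(2) unfolding regular_sequence_def by (force simp: Q.L.genideal_empty)
  then have xnz: "nonzerodivisor Q.L x"
    using ideal.nonzerodivisor_quot_iff[OF Q.L.zeroideal Q.L_cring xc] xc unfolding nonzerodivisor_def by simp
  obtain f s where f: "f \<in> irr" "s \<in> carrier F - irr" "x = Q.fr f s" using xm unfolding Q.max_frac_def by blast
  have fc: "f \<in> carrier F" using f Q.Icarr by blast
  obtain N where N: "\<And>n. n \<ge> N \<Longrightarrow> I (Suc n) = {a \<otimes> z | z. z \<in> I n}"
    using reduction_PIdlD[OF ac a(2)] by blast
  have "z = \<zero>\<^bsub>F\<^esub>" if z: "z \<in> carrier F" "?a \<otimes>\<^bsub>F\<^esub> z = \<zero>\<^bsub>F\<^esub>" for z
  proof -
    let ?f = "Q.fr f \<one>\<^bsub>F\<^esub>" and ?z = "Q.fr z \<one>\<^bsub>F\<^esub>" and ?s = "Q.fr \<one>\<^bsub>F\<^esub> s"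
    have c: "?f \<in> carrier Q.L" "?z \<in> carrier Q.L" "?s \<in> carrier Q.L"
      using fc z f(2) Q.one_in_S by (auto intro!: Q.frac_closed)
    have "Q.fr (f [^]\<^bsub>F\<^esub> Suc N \<otimes>\<^bsub>F\<^esub> z) \<one>\<^bsub>F\<^esub> = ?f [^]\<^bsub>Q.L\<^esub> Suc N \<otimes>\<^bsub>Q.L\<^esub> ?z"
      using fc z h.hom_mult[of "f [^]\<^bsub>F\<^esub> Suc N" z] h.hom_pow[OF fc, of "Suc N"] by (simp only: F.nat_pow_closed)
    then have zero: "?f [^]\<^bsub>Q.L\<^esub> Suc N \<otimes>\<^bsub>Q.L\<^esub> ?z = \<zero>\<^bsub>Q.L\<^esub>"
      using irr_power_annihilates[OF a(1) N f(1) z] h.hom_zero by simp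
    \<comment> \<open>The denominator only contributes a factor \<open>?s\<close>, so the vanishing
      of \<open>f [^] Suc N\<close> times \<open>z\<close> passes to the same power of
      \<open>x\<close>, which can be cancelled.\<close>
    have "x = ?s \<otimes>\<^bsub>Q.L\<^esub> ?f" unfolding f(3) by (rule Q.frac_split(1)[OF fc f(2)])
    then have "x [^]\<^bsub>Q.L\<^esub> Suc N = ?s [^]\<^bsub>Q.L\<^esub> Suc N \<otimes>\<^bsub>Q.L\<^esub> ?f [^]\<^bsub>Q.L\<^esub> Suc N"
      by (simp only: Q.L.nat_pow_distrib[OF c(3,1)])
    then have "x [^]\<^bsub>Q.L\<^esub> Suc N \<otimes>\<^bsub>Q.L\<^esub> ?z = ?s [^]\<^bsub>Q.L\<^esub> Suc N \<otimes>\<^bsub>Q.L\<^esub> (?f [^]\<^bsub>Q.L\<^esub> Suc N \<otimes>\<^bsub>Q.L\<^esub> ?z)"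
      using c Q.L.m_assoc[of "?s [^]\<^bsub>Q.L\<^esub> Suc N" "?f [^]\<^bsub>Q.L\<^esub> Suc N" ?z] by (simp only: Q.L.nat_pow_closed)
    also have "\<dots> = \<zero>\<^bsub>Q.L\<^esub>" unfolding zero using c by (simp only: Q.L.r_null Q.L.nat_pow_closed)
    finally have "?z = \<zero>\<^bsub>Q.L\<^esub>"
      using Q.L.nonzerodivisorD(2)[OF Q.L.nonzerodivisor_pow[OF xnz] c(2)] by blast
    then show ?thesis using cancel z by blast
  qed
  then show ?thesis unfolding nonzerodivisor_def using aF by blast
qed

end

theorem lemma3p8:
  fixes A :: "('a, 'b) ring_scheme" (structure)
    and m :: "'a set"
    and I :: "nat \<Rightarrow> 'a set"
    and r :: int
  assumes "local_ring A m"
    and "noetherian_ring A"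
    and "infinite (carrier (A Quot m))"
    and "good_filtration A I"
    and "\<exists>x\<in>I 1. nonzerodivisor A x"
    and "krull_dim (fiber_cone A m I) = 1"
    and "r = reduction_number A I"
  shows
   "let F = fiber_cone A m I;
        C1 = cohen_macaulay F;
        C2 = (\<forall>a\<in>I 1. minimal_reduction A I (PIdl a) \<longrightarrow>
               colon F {\<zero>\<^bsub>F\<^esub>} (initial_form A m I a) = {\<zero>\<^bsub>F\<^esub>});
        C3 = (\<forall>a\<in>I 1. minimal_reduction A I (PIdl a) \<longrightarrow>
               (\<forall>n. 1 \<le> n \<and> int n \<le> r - 1 \<longrightarrow>
                 I n \<inter> colon A (m \<cdot> I (n + 1)) a = m \<cdot> I n));
        C4 = (\<forall>a\<in>I 1. minimal_reduction A I (PIdl a) \<longrightarrow>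
               (\<forall>n. 1 \<le> n \<and> int n \<le> r - 1 \<longrightarrow>
                 ((PIdl a) \<cdot> I n) \<inter> (m \<cdot> I (n + 1)) = (PIdl a) \<cdot> (m \<cdot> I n)));
        C5 = (\<forall>a\<in>I 1. minimal_reduction A I (PIdl a) \<longrightarrow>
               (\<forall>n. 1 \<le> n \<and> int n \<le> r \<longrightarrow>
                 ereal_of_enat (module_length A
                   (ideal_quotient A (I n) ((m \<cdot> I n) <+> ((PIdl a) \<cdot> I (n - 1)))))
                 = ereal_of_enat (num_gens A m (I n)) - ereal_of_enat (num_gens A m (I (n - 1)))))
    in (C1 \<longleftrightarrow> C2) \<and> (C2 \<longleftrightarrow> C3) \<and> (C3 \<longleftrightarrow> C4) \<and> (C4 \<longleftrightarrow> C5)"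
proof -
  have "cring A" using assms(1) unfolding local_ring_def by blast
  then interpret noetherian_filtration A m I
    using assms unfolding good_filtration_def
    by (intro noetherian_filtration.intro local_filtration.intro local_filtration_axioms.intro
        noetherian_filtration_axioms.intro) (simp_all add: good_filtration_def)
  let ?S = "{a \<in> I 1. minimal_reduction A I (PIdl a)}"
  have S: "a \<in> I 1" "a \<in> carrier A" "reduction A I (PIdl a)" if "a \<in> ?S" for a
    using that I.Icarr unfolding minimal_reduction_def by blast+
  \<comment> \<open>As \<open>b\<close> attains \<open>r\<close>, the equality
    \<open>I (Suc n) = (PIdl b) \<cdot> I n\<close> holds for all \<open>n \<ge> r\<close>; for
    other minimal reductions it may set in later.\<close>
  obtain b where b: "b \<in> ?S" "r = reduction_number_wrt A I (PIdl b)"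
    using reduction_number_attained assms(7) by blast
  let ?C1 = "cohen_macaulay F"
  let ?C2 = "\<forall>a\<in>I 1. minimal_reduction A I (PIdl a) \<longrightarrow>
    colon F {\<zero>\<^bsub>F\<^esub>} (initial_form A m I a) = {\<zero>\<^bsub>F\<^esub>}"
  let ?C3 = "\<forall>a\<in>I 1. minimal_reduction A I (PIdl a) \<longrightarrow>
    (\<forall>n. 1 \<le> n \<and> int n \<le> r - 1 \<longrightarrow> I n \<inter> colon A (m \<cdot> I (n + 1)) a = m \<cdot> I n)"
  let ?C4 = "\<forall>a\<in>I 1. minimal_reduction A I (PIdl a) \<longrightarrow>
    (\<forall>n. 1 \<le> n \<and> int n \<le> r - 1 \<longrightarrow>
      ((PIdl a) \<cdot> I n) \<inter> (m \<cdot> I (n + 1)) = (PIdl a) \<cdot> (m \<cdot> I n))"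
  let ?C5 = "\<forall>a\<in>I 1. minimal_reduction A I (PIdl a) \<longrightarrow>
    (\<forall>n. 1 \<le> n \<and> int n \<le> r \<longrightarrow>
      ereal_of_enat (module_length A
        (ideal_quotient A (I n) ((m \<cdot> I n) <+> ((PIdl a) \<cdot> I (n - 1)))))
      = ereal_of_enat (num_gens A m (I n)) - ereal_of_enat (num_gens A m (I (n - 1))))"
  let ?D = "\<forall>a\<in>?S. \<forall>n. 1 \<le> n \<and> int n \<le> r - 1 \<longrightarrow> inj_at a n"
  have C2: "?C2 \<longleftrightarrow> (\<forall>a\<in>?S. \<forall>n. inj_at a n)"
    using colon_initial_form_iff by blast
  have C3: "?C3 \<longleftrightarrow> ?D" using inj_at_iff_colon by blast
  have C4: "?C4 \<longleftrightarrow> ?D"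
    using inj_at_iff_inter[OF S(1) reduction_nonzerodivisor[OF S(2,3)]] by blast
  have C5: "?C5 \<longleftrightarrow> ?D"
  proof
    assume c5: ?C5
    show ?D
    proof (intro ballI allI impI)
      fix a n assume a: "a \<in> ?S" and n: "1 \<le> n \<and> int n \<le> r - 1"
      \<comment> \<open>Condition (5) in degree \<open>Suc n\<close> is about multiplication out of
        degree \<open>n\<close>, which accounts for the upper bounds \<open>r\<close> and
        \<open>r - 1\<close>.\<close>
      have "int (Suc n) \<le> r" using n by simp
      then show "inj_at a n"
        using c5[rule_format, of a "Suc n"] a inj_at_iff_length[of a n] by simp
    qed
  next
    assume D: ?D
    show ?C5
    proof (intro ballI allI impI)
      fix a n assume a: "a \<in> I 1" "minimal_reduction A I (PIdl a)" and n: "1 \<le> n \<and> int n \<le> r"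
      then have aS: "a \<in> ?S" by blast
      obtain k where k: "n = Suc k" using n by (cases n) auto
      have "inj_at a k"
      proof (cases k)
        \<comment> \<open>Condition (5) for \<open>n = 1\<close> concerns degree 0, which lies
          outside the range of (3) and (4).\<close>
        case 0 then show ?thesis using inj_at_0 S[OF aS] by blast
      next
        case (Suc l) then show ?thesis using D aS n k by auto
      qed
      then show "ereal_of_enat (module_length A
          (ideal_quotient A (I n) ((m \<cdot> I n) <+> ((PIdl a) \<cdot> I (n - 1)))))
        = ereal_of_enat (num_gens A m (I n)) - ereal_of_enat (num_gens A m (I (n - 1)))"
        using inj_at_iff_length[OF a(1), of k] unfolding k by simp
    qed
  qed
  have D2: "?D \<longleftrightarrow> (\<forall>a\<in>?S. \<forall>n. inj_at a n)"
  proof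
    assume D: ?D
    have "inj_at b n" for n
    proof (cases "int n \<le> r - 1")
      case True
      then show ?thesis using D b(1) inj_at_0 S[OF b(1)] by (cases n) auto
    next
      case False
      then have "reduction_number_wrt A I (PIdl b) < int (Suc n)" using b(2) by simp
      then have "I (Suc n) = (PIdl b) \<cdot> I n" by (rule reduction_number_wrt_props(2)[OF S(3)[OF b(1)]])
      then show ?thesis by (rule inj_at_of_surj[OF S(2,3)[OF b(1)]])
    qed
    then show "\<forall>a\<in>?S. \<forall>n. inj_at a n"
      using inj_at_change[OF S(1)[OF b(1)]] S by blast
  qed blast
  have C1: "?C1 \<longleftrightarrow> (\<forall>a\<in>?S. \<forall>n. inj_at a n)"
  proof
    assume ?C1
    then show "\<forall>a\<in>?S. \<forall>n. inj_at a n"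
      using nonzerodivisor_of_cohen_macaulay nonzerodivisor_initial_form_iff S by blast
  next
    assume "\<forall>a\<in>?S. \<forall>n. inj_at a n"
    \<comment> \<open>The existence of \<open>b\<close> keeps the hypothesis from being
      vacuous.\<close>
    then have "nonzerodivisor F (initial_form A m I b)"
      using nonzerodivisor_initial_form_iff[OF S(1)[OF b(1)]] b(1) by blast
    then show ?C1 by (rule cohen_macaulay_of_nonzerodivisor[OF S(1)[OF b(1)]])
  qed
  have "(?C1 \<longleftrightarrow> ?C2) \<and> (?C2 \<longleftrightarrow> ?C3) \<and> (?C3 \<longleftrightarrow> ?C4) \<and> (?C4 \<longleftrightarrow> ?C5)"
    using C1 C2 C3 C4 C5 D2 by argo
  then show ?thesis unfolding Let_def .
qed

end
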